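(* Let $p$ be a prime with $p\equiv 1 \pmod{8}$. Then the class number of $\mathbb{Q}\left(p^{1/4}\right)$ is even.
   Context: $p^{1/4}$ denotes the real positive fourth root of $p$. *)

theory Defs
  imports
    "HOL-Algebra.Algebra"
    "HOL-Algebra.Algebraic_Closure_Type"
    "HOL-Number_Theory.Number_Theory"
begin

text \<open>
  A number field is represented by its underlying set \<open>K\<close> inside an ambient field of
  characteristic 0 (here the reals).  As the ambient field has characteristic 0, the subfield
  generated by \<open>x\<close> is the field obtained by adjoining \<open>x\<close> to the rationals.
\<close>

definition rat_adjoin :: "'a::field_char_0 \<Rightarrow> 'a set" where
  "rat_adjoin x = generate_field ring_of_type_algebra {x}"

definition ring_of_integers :: "'a::field_char_0 set \<Rightarrow> 'a set" where
  "ring_of_integers K = {x \<in> K. algebraic_int x}"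

text \<open>Fractional ideals are nonzero by convention.\<close>

definition fractional_ideal :: "'a::field_char_0 set \<Rightarrow> 'a set \<Rightarrow> bool" where
  "fractional_ideal K I \<longleftrightarrow>
     I \<subseteq> K \<and> 0 \<in> I \<and> I \<noteq> {0} \<and>
     (\<forall>x\<in>I. \<forall>y\<in>I. x + y \<in> I) \<and>
     (\<forall>a\<in>ring_of_integers K. \<forall>x\<in>I. a * x \<in> I) \<and>
     (\<exists>d\<in>ring_of_integers K. d \<noteq> 0 \<and> (\<forall>x\<in>I. d * x \<in> ring_of_integers K))"

text \<open>
  The operation \<^const>\<open>ideal_prod\<close>, taken in the ambient field, forms all finite sums of
  products \<open>i * j\<close> with \<open>i\<close> in the first and \<open>j\<close> in the second factor, so it is
  the usual product of fractional ideals.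
\<close>

definition ideal_group :: "'a::field_char_0 set \<Rightarrow> 'a set monoid" where
  "ideal_group K =
     \<lparr>carrier = {I. fractional_ideal K I},
      monoid.mult = ideal_prod ring_of_type_algebra,
      one = ring_of_integers K\<rparr>"

definition principal_fractional_ideals :: "'a::field_char_0 set \<Rightarrow> 'a set set" where
  "principal_fractional_ideals K = {(\<lambda>x. a * x) ` ring_of_integers K | a. a \<in> K \<and> a \<noteq> 0}"

definition class_group :: "'a::field_char_0 set \<Rightarrow> 'a set set monoid" where
  "class_group K = ideal_group K Mod principal_fractional_ideals K"

text \<open>
  Since \<^const>\<open>Coset.order\<close> is defined by \<^const>\<open>card\<close>, this is meaningful only if the class
  group is finite; an infinite class group would give the value 0.
\<close>

definition class_number :: "'a::field_char_0 set \<Rightarrow> nat" where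
  "class_number K = Coset.order (class_group K)"

end

theory Submission
  imports Defs "HOL-Analysis.Analysis"
begin

text \<open>
  Let \<open>K\<close> be the field generated by the fourth root \<open>\<theta>\<close> of \<open>p\<close>.  Reducing the norm form modulo \<open>p\<close> shows that
  the norm of an integral element of \<open>K\<close> is a fourth power modulo \<open>p\<close>, and since \<open>p \<equiv> 1 (mod 8)\<close> so
  is \<open>- 1\<close>.  Hence the norm induces a homomorphism from ideal classes (prime to \<open>p\<close>) to the residues modulo
  fourth powers, and it suffices to find an ideal whose norm is not a fourth power.  If \<open>r \<equiv> 3 (mod 4)\<close> is a
  prime which is a square but not a fourth power modulo \<open>p\<close>, then by quadratic reciprocity \<open>p\<close> is a square, hence
  a fourth power \<open>a ^ 4\<close>, modulo \<open>r\<close>, and the ideal generated by \<open>r\<close> and \<open>\<theta> - a\<close> has norm \<open>r\<close>.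

  Such an \<open>r\<close> exists by Dirichlet's method.  Let \<open>\<chi>\<close> be the nontrivial character modulo 4 and \<open>\<psi>\<close> a character of
  order 4 modulo \<open>p\<close>.  If no such \<open>r\<close> existed, the Euler factors of \<open>L(1) L(\<psi>\<^sup>2) L(\<chi>\<psi>) L(\<chi>\<psi>\<^sup>3)\<close> and
  \<open>L(\<chi>) L(\<chi>\<psi>\<^sup>2) L(\<psi>) L(\<psi>\<^sup>3)\<close> would coincide.  The first product is at least 1 and the second is bounded as
  \<open>s \<rightarrow> 1\<close>.  As \<open>L(1)\<close> has a pole and \<open>L(\<psi>\<^sup>2)\<close> does not vanish at 1, both factors \<open>L(\<chi>\<psi>)\<close> and
  \<open>L(\<chi>\<psi>\<^sup>3)\<close>, being complex conjugates, vanish there, so the first product tends to 0, a contradiction.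

  The fractional ideals form a group because the number of classes is finite (Hurwitz): two powers of an ideal lie
  in the same class, and Nakayama's lemma then shows that some power is principal.
\<close>

section \<open>Dirichlet series of periodic completely multiplicative functions\<close>

text \<open>The grouping of the eight characters is the Fourier expansion of an indicator: \<open>1
  + psi^2 + chi psi + chi psi^3 - chi - chi psi^2 - psi - psi^3\<close> factors as
  \<open>(1 - chi) (1 - psi) (1 + psi^2)\<close>, which is 8 where \<open>chi = psi = -1\<close> and
  0 at every other pair of values. Only the primes sought can separate the two products. The
  condition on \<open>r\<close> modulo 4 makes every square modulo \<open>r\<close> a fourth power,
  so that quadratic reciprocity suffices. The homomorphism on ideal classes is never built, as ideal
  norms are not defined. For the ideal \<open>J\<close> over \<open>r\<close> and the class number
  \<open>h\<close>, the power \<open>J^h\<close> has a generator, and divisibility relations among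
  norms of elements force the norm of this generator to be \<open>r^h\<close> up to sign; being a
  fourth power residue, it makes \<open>h\<close> even. An integral basis is avoided too: four times
  an integral element has integer coordinates, so norms are fourth powers modulo \<open>p\<close> up
  to the factor \<open>256 = 4^4\<close>.\<close>

text \<open>Complete multiplicativity turns the part of the sieved series carried by the multiples
  of \<open>q\<close> into \<open>g q\<close> times the whole sieved series, so discarding these
  multiples costs exactly the factor \<open>1 - g q\<close>.\<close>

lemma sieve_step:
  fixes g :: "nat \<Rightarrow> complex"
  assumes mult: "\<And>a b. g (a * b) = g a * g b" and sm: "summable (\<lambda>n. norm (g n))"
    and S: "finite S" "\<And>q. q \<in> S \<Longrightarrow> Factorial_Ring.prime q"
  shows "(\<lambda>n. if \<exists>q\<in>S. q dvd n then 0 else g n) sums ((\<Prod>q\<in>S. 1 - g q) * suminf g)"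
  using S
proof (induction S rule: finite_induct)
  case empty
  then show ?case using sm by (simp add: summable_norm_cancel summable_sums)
next
  case (insert q S)
  let ?h = "\<lambda>n. if \<exists>q\<in>S. q dvd n then 0 else g n"
  let ?T = "(\<Prod>q\<in>S. 1 - g q) * suminf g"
  have h: "?h sums ?T" using insert by auto
  have pq: "Factorial_Ring.prime q" using insert by auto
  have eq: "?h (q * n) = g q * ?h n" for n
  proof -
    have "(\<exists>q'\<in>S. q' dvd q * n) \<longleftrightarrow> (\<exists>q'\<in>S. q' dvd n)"
      using insert pq by (metis insertI1 insertI2 dvd_mult prime_dvd_multD primes_dvd_imp_eq)
    then show ?thesis by (simp add: mult)
  qed
  let ?k = "\<lambda>n. if q dvd n then ?h n else 0"
  have "(\<lambda>n. ?k (q * n)) sums (g q * ?T)"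
    using sums_mult[OF h, of "g q"] by (simp add: eq)
  moreover have "strict_mono ((*) q)"
    using prime_gt_0_nat[OF pq] by (auto simp: strict_mono_def)
  ultimately have "?k sums (g q * ?T)"
    by (subst (asm) sums_mono_reindex) (auto simp: image_iff elim!: dvdE)
  from sums_diff[OF h this] have "(\<lambda>n. ?h n - ?k n) sums (?T - g q * ?T)" .
  moreover have "(\<lambda>n. ?h n - ?k n) = (\<lambda>n. if \<exists>q\<in>insert q S. q dvd n then 0 else g n)"
    by auto
  moreover have "?T - g q * ?T = (\<Prod>q\<in>insert q S. 1 - g q) * suminf g"
    using insert by (simp add: algebra_simps)
  ultimately show ?case by simp
qed

text \<open>Once the primes up to \<open>N\<close> are sieved out, the only nonzero term below
  \<open>Suc N\<close> is the one at 1, so the distance to 1 is at most a tail of an absolutely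
  convergent series. Keeping the factors \<open>1 - g q\<close> beside the sum, instead of inverting
  them, avoids any question of nonvanishing.\<close>

lemma euler_product_tendsto:
  fixes g :: "nat \<Rightarrow> complex"
  assumes mult: "\<And>a b. g (a * b) = g a * g b" and sm: "summable (\<lambda>n. norm (g n))"
    and g0: "g 0 = 0" and g1: "g 1 = 1"
  shows "(\<lambda>N. (\<Prod>q | Factorial_Ring.prime q \<and> q \<le> N. 1 - g q) * suminf g) \<longlonglongrightarrow> 1"
proof -
  let ?S = "\<lambda>N. {q. Factorial_Ring.prime q \<and> q \<le> (N::nat)}"
  let ?h = "\<lambda>N n. if \<exists>q\<in>?S N. q dvd n then 0 else g n"
  have fin: "finite (?S N)" for N by (rule finite_subset[of _ "{..N}"]) auto
  let ?P = "\<lambda>N. (\<Prod>q\<in>?S N. 1 - g q) * suminf g"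
  have sums: "?h N sums ?P N" for N
    by (rule sieve_step[OF mult sm fin]) auto
  let ?R = "\<lambda>N. suminf (\<lambda>n. norm (g n)) - (\<Sum>n<Suc N. norm (g n))"
  have bound: "norm (?P N - 1) \<le> ?R N" if "N \<ge> 1" for N
  proof -
    have hs: "summable (\<lambda>n. norm (?h N n))"
      by (rule summable_comparison_test'[OF sm, of 0]) auto
    have ini: "(\<Sum>n<Suc N. ?h N n) = 1"
    proof -
      have "?h N n = (if n = 1 then 1 else 0)" if "n < Suc N" for n
      proof (cases "n = 0 \<or> n = 1")
        case True
        then show ?thesis using g0 g1 by (auto dest: prime_gt_1_nat)
      next
        case False
        then obtain q where "Factorial_Ring.prime q" "q dvd n"
          by (metis prime_factor_nat)
        moreover from this have "q \<le> N" using False that by (auto dest!: dvd_imp_le)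
        ultimately show ?thesis using False by auto
      qed
      then have "(\<Sum>n<Suc N. ?h N n) = (\<Sum>n<Suc N. if n = 1 then 1 else 0)"
        by (intro sum.cong) auto
      also have "\<dots> = 1" using that by (subst sum.delta) auto
      finally show ?thesis .
    qed
    have "?P N - 1 = suminf (\<lambda>n. ?h N (n + Suc N))"
      using suminf_minus_initial_segment[of "?h N" "Suc N"] sums[of N] ini
      by (simp add: sums_iff)
    also have "norm \<dots> \<le> suminf (\<lambda>n. norm (?h N (n + Suc N)))"
      by (rule summable_norm[OF summable_ignore_initial_segment[OF hs, of "Suc N"]])
    also have "\<dots> \<le> suminf (\<lambda>n. norm (g (n + Suc N)))"
      by (rule suminf_le[OF _ summable_ignore_initial_segment[OF hs, of "Suc N"] summable_ignore_initial_segment[OF sm, of "Suc N"]]) auto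
    also have "\<dots> = ?R N"
      using suminf_minus_initial_segment[OF sm, of "Suc N"] by simp
    finally show ?thesis .
  qed
  have "(\<lambda>N. \<Sum>n<Suc N. norm (g n)) \<longlonglongrightarrow> suminf (\<lambda>n. norm (g n))"
    using summable_LIMSEQ[OF sm] by (rule LIMSEQ_Suc)
  then have "?R \<longlonglongrightarrow> 0" by (intro tendsto_eq_intros | assumption | simp)+
  then have "(\<lambda>N. ?P N - 1) \<longlonglongrightarrow> 0"
    by (rule Lim_null_comparison[rotated]) (rule eventually_sequentiallyI[of 1], rule bound)
  then show ?thesis by (simp add: LIM_zero_iff)
qed

section \<open>Partial summation estimates\<close>

lemma abel_summation_bound:
  fixes f :: "nat \<Rightarrow> 'a::real_normed_vector" and a :: "nat \<Rightarrow> real"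
  assumes B: "\<And>N. norm (\<Sum>i<N. f i) \<le> B"
    and dec: "\<And>i. i \<ge> M \<Longrightarrow> a (Suc i) \<le> a i" and nn: "\<And>i. i \<ge> M \<Longrightarrow> 0 \<le> a i"
  shows "norm (\<Sum>i\<in>{M..<N}. a i *\<^sub>R f i) \<le> 2 * B * a M"
proof -
  have B0: "B \<ge> 0" using B[of 0] by simp
  show ?thesis
  proof (cases "M \<le> N")
    case False
    then show ?thesis using B0 nn[of M] by simp
  next
    case True
    let ?F = "\<lambda>N. \<Sum>i<N. f i"
    \<comment> \<open>Removing both boundary terms leaves the sum of
      \<open>(a k - a (Suc k)) * F (Suc k)\<close>, and the bounds of these summands telescope to
      \<open>B * (a M - a N)\<close>; the two boundary terms raise this to
      \<open>2 * B * a M\<close>.\<close>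
    have "norm ((\<Sum>i\<in>{M..<N}. a i *\<^sub>R f i) - a N *\<^sub>R ?F N + a M *\<^sub>R ?F M) \<le> B * (a M - a N)"
      using True
    proof (induction N rule: dec_induct)
      case base
      then show ?case by simp
    next
      case (step k)
      have "norm ((\<Sum>i\<in>{M..<Suc k}. a i *\<^sub>R f i) - a (Suc k) *\<^sub>R ?F (Suc k) + a M *\<^sub>R ?F M)
        = norm (((\<Sum>i\<in>{M..<k}. a i *\<^sub>R f i) - a k *\<^sub>R ?F k + a M *\<^sub>R ?F M) + (a k - a (Suc k)) *\<^sub>R ?F (Suc k))"
        using step by (simp add: algebra_simps)
      also have "\<dots> \<le> B * (a M - a k) + (a k - a (Suc k)) * B"
      proof (rule norm_triangle_mono[OF step.IH])
        have "norm ((a k - a (Suc k)) *\<^sub>R ?F (Suc k)) = (a k - a (Suc k)) * norm (?F (Suc k))"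
          using dec[of k] step by simp
        also have "\<dots> \<le> (a k - a (Suc k)) * B"
          using dec[of k] step(1) by (intro mult_left_mono B) auto
        finally show "norm ((a k - a (Suc k)) *\<^sub>R ?F (Suc k)) \<le> (a k - a (Suc k)) * B" .
      qed
      also have "\<dots> = B * (a M - a (Suc k))" by (simp add: algebra_simps)
      finally show ?case .
    qed
    moreover have "norm (a N *\<^sub>R ?F N) \<le> B * a N"
      using mult_left_mono[OF B[of N] nn[of N]] nn[of N] True by (simp add: mult.commute)
    moreover have "norm (a M *\<^sub>R ?F M) \<le> B * a M"
      using mult_left_mono[OF B[of M] nn[of M]] nn[of M] by (simp add: mult.commute)
    moreover have "norm (\<Sum>i\<in>{M..<N}. a i *\<^sub>R f i) \<le>
       norm ((\<Sum>i\<in>{M..<N}. a i *\<^sub>R f i) - a N *\<^sub>R ?F N + a M *\<^sub>R ?F M) + norm (a N *\<^sub>R ?F N) + norm (a M *\<^sub>R ?F M)"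
      using norm_triangle_ineq[of "(\<Sum>i\<in>{M..<N}. a i *\<^sub>R f i) - a N *\<^sub>R ?F N + a M *\<^sub>R ?F M" "a N *\<^sub>R ?F N - a M *\<^sub>R ?F M"]
        norm_triangle_ineq4[of "a N *\<^sub>R ?F N" "a M *\<^sub>R ?F M"] by simp
    ultimately show ?thesis by (simp add: algebra_simps)
  qed
qed

text \<open>Complete periods cancel; what is left over has at most \<open>m\<close> terms, each of
  norm at most 1.\<close>

lemma periodic_sum_bound:
  fixes f :: "nat \<Rightarrow> 'a::real_normed_vector"
  assumes m: "m > 0" and per: "\<And>n. f (n + m) = f n" and le: "\<And>n. norm (f n) \<le> 1"
    and z: "(\<Sum>n<m. f n) = 0"
  shows "norm (\<Sum>n<N. f n) \<le> real m"
proof (induction N rule: less_induct)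
  case (less N)
  show ?case
  proof (cases "N \<le> m")
    case True
    have "norm (\<Sum>n<N. f n) \<le> (\<Sum>n<N. 1)" using le by (intro sum_norm_le) auto
    then show ?thesis using True by simp
  next
    case False
    then obtain M where M: "N = m + M" "M < N" using m by (metis add_diff_inverse_nat diff_less le_eq_less_or_eq linorder_not_less nat_less_le not_gr0 zero_less_diff trans_less_add1 less_add_same_cancel2)
    have "(\<Sum>n<N. f n) = (\<Sum>n<m. f n) + (\<Sum>n<M. f (n + m))"
      unfolding M(1) lessThan_atLeast0
      by (subst sum.atLeastLessThan_concat[of 0 m "m+M", symmetric])
         (use sum.shift_bounds_nat_ivl[of f 0 m M] in \<open>auto simp: add.commute\<close>)
    then show ?thesis using less[OF M(2)] z per by simp
  qed
qed

section \<open>Dirichlet characters and their series on the real axis\<close>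

text \<open>The term at 0 vanishes since \<open>0 powr x = 0\<close>. At \<open>s = 1\<close> the
  value may be that of an only conditionally convergent series, as \<open>suminf\<close> is the
  limit of the partial sums.\<close>

definition dirichlet_series :: "(nat \<Rightarrow> complex) \<Rightarrow> real \<Rightarrow> complex" where
  "dirichlet_series f s = suminf (\<lambda>n. f n * of_real (real n powr - s))"

locale residue_character =
  fixes m :: nat and f :: "nat \<Rightarrow> complex"
  assumes m_gt_1: "m > 1"
    and mult: "f (a * b) = f a * f b"
    and one: "f 1 = 1"
    and periodic: "f (n + m) = f n"
    and norm_le_1: "norm (f n) \<le> 1"
    and zero: "\<not> coprime n m \<Longrightarrow> f n = 0"
begin

lemma mod_eq: "f (n mod m) = f n"
proof -
  have "f (r + k * m) = f r" for r k
    by (induction k) (simp_all add: periodic add.assoc[symmetric] add.commute[of m])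
  from this[of "n mod m" "n div m"] show ?thesis by simp
qed

lemma summable_norm_terms:
  assumes "s > 1"
  shows "summable (\<lambda>n. norm (f n * of_real (real n powr - s)))"
proof (rule summable_comparison_test')
  show "summable (\<lambda>n. real n powr - s)"
    using assms by (simp add: summable_real_powr_iff)
  show "norm (norm (f n * of_real (real n powr - s))) \<le> real n powr - s" for n
    using mult_right_mono[OF norm_le_1[of n], of "real n powr - s"] by (simp add: norm_mult)
qed

lemma euler_product:
  assumes "s > 1"
  shows "(\<lambda>N. (\<Prod>q | Factorial_Ring.prime q \<and> q \<le> N. 1 - f q * of_real (real q powr - s)) * dirichlet_series f s) \<longlonglongrightarrow> 1"
  unfolding dirichlet_series_def
proof (rule euler_product_tendsto)
  show "summable (\<lambda>n. norm (f n * of_real (real n powr - s)))" by (rule summable_norm_terms[OF assms])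
qed (use one in \<open>simp_all add: mult powr_mult\<close>)

text \<open>Multiplication by a unit \<open>c\<close> permutes the residues modulo \<open>m\<close>,
  so the sum equals \<open>f c\<close> times itself.\<close>

lemma sum_period_eq_0:
  assumes c: "coprime c m" "f c \<noteq> 1"
  shows "(\<Sum>n<m. f n) = 0"
proof -
  have "inj_on (\<lambda>n. (c * n) mod m) {..<m}"
  proof (rule inj_onI)
    fix x y assume xy: "x \<in> {..<m}" "y \<in> {..<m}" "c * x mod m = c * y mod m"
    then have "[c * x = c * y] (mod m)" by (simp add: unique_euclidean_semiring_class.cong_def)
    then have "[x = y] (mod m)" using c(1) by (simp add: cong_mult_lcancel_nat coprime_commute)
    then show "x = y" using xy by (simp add: unique_euclidean_semiring_class.cong_def)
  qed
  moreover have "(\<lambda>n. (c * n) mod m) ` {..<m} \<subseteq> {..<m}" using m_gt_1 by auto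
  ultimately have bij: "bij_betw (\<lambda>n. (c * n) mod m) {..<m} {..<m}"
    by (simp add: bij_betw_def endo_inj_surj)
  have "(\<Sum>n<m. f n) = (\<Sum>n<m. f ((c * n) mod m))"
    by (rule sum.reindex_bij_betw[OF bij, symmetric])
  also have "\<dots> = f c * (\<Sum>n<m. f n)" by (simp add: mod_eq mult sum_distrib_left)
  finally show ?thesis using c(2) by simp
qed

end

locale nonprincipal_character = residue_character +
  assumes nonprincipal: "\<exists>c. coprime c m \<and> f c \<noteq> 1"
begin

lemma partial_sum_bound: "norm (\<Sum>n<N. f n) \<le> real m"
  using nonprincipal m_gt_1
  by (intro periodic_sum_bound) (auto simp: periodic norm_le_1 intro: sum_period_eq_0)

text \<open>The bound is free of \<open>N\<close> and tends to 0 with growing \<open>M\<close>, also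
  at \<open>s = 1\<close>; it supplies convergence there and, from \<open>M = 1\<close>, a bound
  uniform in \<open>s\<close>.\<close>

lemma tail_bound:
  assumes "s \<ge> 1" "M \<ge> 1"
  shows "norm (\<Sum>n\<in>{M..<N}. f n * of_real (real n powr - s)) \<le> 2 * real m * (real M powr - s)"
proof -
  have "norm (\<Sum>n\<in>{M..<N}. (real n powr - s) *\<^sub>R f n) \<le> 2 * real m * (real M powr - s)"
    by (rule abel_summation_bound[OF partial_sum_bound])
       (use assms in \<open>auto intro!: powr_mono2'\<close>)
  then show ?thesis by (simp add: scaleR_conv_of_real mult.commute)
qed

lemma partial_sum_eq:
  "(\<Sum>n<N. f n * of_real (real n powr - s)) = (\<Sum>n\<in>{1..<N}. f n * of_real (real n powr - s))"
  by (rule sum.mono_neutral_right) (auto simp: Suc_le_eq)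

lemma summable_terms:
  assumes "s \<ge> 1"
  shows "summable (\<lambda>n. f n * of_real (real n powr - s))"
  unfolding summable_Cauchy
proof (intro allI impI)
  fix e :: real assume e: "e > 0"
  have "(\<lambda>M. 2 * real m * (real M powr - s)) \<longlonglongrightarrow> 2 * real m * 0"
    using assms by (intro tendsto_intros tendsto_neg_powr filterlim_real_sequentially) auto
  then have "eventually (\<lambda>M. 2 * real m * (real M powr - s) < e) sequentially"
    using e by (intro order_tendstoD) auto
  then obtain N where N: "\<And>M. M \<ge> N \<Longrightarrow> 2 * real m * (real M powr - s) < e"
    by (auto simp: eventually_sequentially)
  show "\<exists>N. \<forall>M\<ge>N. \<forall>n. norm (\<Sum>n\<in>{M..<n}. f n * of_real (real n powr - s)) < e"
    by (rule exI[of _ "max 1 N"]) (use N tail_bound[OF assms] in \<open>fastforce intro: le_less_trans\<close>)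
qed

lemma partial_sums_tendsto:
  assumes "s \<ge> 1"
  shows "(\<lambda>N. \<Sum>n<N. f n * of_real (real n powr - s)) \<longlonglongrightarrow> dirichlet_series f s"
  unfolding dirichlet_series_def by (rule summable_LIMSEQ[OF summable_terms[OF assms]])

lemma bounded:
  assumes "s \<ge> 1"
  shows "norm (dirichlet_series f s) \<le> 2 * real m"
proof (rule LIMSEQ_le_const2[OF tendsto_norm[OF partial_sums_tendsto[OF assms]]])
  show "\<exists>N. \<forall>n\<ge>N. norm (\<Sum>n<n. f n * of_real (real n powr - s)) \<le> 2 * real m"
    using tail_bound[OF assms, of 1] by (simp add: partial_sum_eq)
qed

text \<open>Up to sign these are the derivatives of the partial sums. The weight
  \<open>ln x * x powr - s\<close> is decreasing from \<open>exp 1\<close> on for every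
  \<open>s\<close> at least 1, so partial summation starts at 3; the terms at 0 and 1 vanish and the
  one at 2 is worth at most \<open>ln 2\<close>.\<close>

lemma log_terms_bound:
  assumes s: "s \<ge> 1"
  shows "norm (\<Sum>n<N. f n * of_real (ln (real n) * real n powr - s)) \<le> ln 2 + 2 * real m * ln 3"
proof -
  let ?t = "\<lambda>n. f n * of_real (ln (real n) * real n powr - s)"
  have dec: "ln (real (Suc i)) * real (Suc i) powr - s \<le> ln (real i) * real i powr - s" if "i \<ge> 3" for i
  proof -
    have "\<exists>y. ((\<lambda>x. ln x * x powr - s) has_real_derivative y) (at x) \<and> y \<le> 0"
      if x: "real i \<le> x" "x \<le> real (Suc i)" for x
    proof -
      have x3: "x \<ge> 3" using x \<open>i \<ge> 3\<close> by simp
      have "exp 1 \<le> x" using exp_le x3 by linarith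
      then have "ln x \<ge> 1" using x3 by (subst ln_ge_iff) auto
      then have sl: "s * ln x \<ge> 1" using s mult_mono[of 1 s 1 "ln x"] by simp
      have p: "x powr (- s - 1) = x powr - s / x" using x3 by (simp add: powr_diff)
      have "((\<lambda>x. ln x * x powr - s) has_real_derivative (x powr - s / x * (1 - s * ln x))) (at x)"
        using x3 by (auto intro!: derivative_eq_intros simp: field_simps p)
      moreover have "x powr - s / x * (1 - s * ln x) \<le> 0"
        using sl x3 by (intro mult_nonneg_nonpos) auto
      ultimately show ?thesis by blast
    qed
    then show ?thesis by (intro DERIV_nonpos_imp_nonincreasing[of "real i" "real (Suc i)"]) auto
  qed
  have A: "norm (\<Sum>n\<in>{3..<N}. ?t n) \<le> 2 * real m * (ln 3 * 3 powr - s)"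
  proof -
    have "norm (\<Sum>n\<in>{3..<N}. (ln (real n) * real n powr - s) *\<^sub>R f n) \<le> 2 * real m * (ln (real 3) * real 3 powr - s)"
      by (rule abel_summation_bound[where f = f and a = "\<lambda>n. ln (real n) * real n powr - s" and M = 3, OF partial_sum_bound dec]) auto
    then show ?thesis by (simp add: scaleR_conv_of_real mult.commute)
  qed
  also have "\<dots> \<le> 2 * real m * (ln 3 * 1)"
    using s powr_mono[of "-s" 0 "3::real"] by (intro mult_left_mono) auto
  finally have A: "norm (\<Sum>n\<in>{3..<N}. ?t n) \<le> 2 * real m * ln 3" by simp
  have "norm (\<Sum>n<min N 3. ?t n) \<le> ln 2"
  proof -
    have t2: "norm (?t 2) \<le> ln 2"
    proof -
      have "norm (?t 2) = norm (f 2) * (ln 2 * 2 powr - s)" by (simp add: norm_mult)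
      also have "\<dots> \<le> 1 * (ln 2 * 1)"
        using s norm_le_1[of 2] powr_mono[of "-s" 0 "2::real"] by (intro mult_mono) auto
      finally show ?thesis by simp
    qed
    have "N = 0 \<or> N = 1 \<or> N = 2 \<or> min N 3 = 3" by linarith
    then show ?thesis using t2 by (auto simp: eval_nat_numeral lessThan_Suc)
  qed
  moreover have split: "(\<Sum>n<N. ?t n) = (\<Sum>n<min N 3. ?t n) + (\<Sum>n\<in>{3..<N}. ?t n)"
  proof -
    have "(\<Sum>n\<in>{..<min N 3} \<union> {3..<N}. ?t n) = (\<Sum>n<min N 3. ?t n) + (\<Sum>n\<in>{3..<N}. ?t n)"
      by (rule sum.union_disjoint) auto
    moreover have "{..<min N 3} \<union> {3..<N} = {..<N}" by auto
    ultimately show ?thesis by simp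
  qed
  ultimately show ?thesis unfolding split using A by (intro norm_triangle_mono)
qed

text \<open>The mean value estimate is applied to the partial sums, whose derivatives are bounded
  uniformly in their length, and survives the limit. It yields continuity at 1 and a linear bound
  near a zero there.\<close>

lemma lipschitz:
  obtains C where "C > 0"
    "\<And>s t. s \<ge> 1 \<Longrightarrow> t \<ge> 1 \<Longrightarrow> norm (dirichlet_series f s - dirichlet_series f t) \<le> C * \<bar>s - t\<bar>"
proof -
  let ?C = "ln 2 + 2 * real m * ln 3"
  let ?P = "\<lambda>N s. \<Sum>n<N. f n * of_real (real n powr - s)"
  have P: "norm (?P N s - ?P N t) \<le> ?C * \<bar>s - t\<bar>" if "s \<ge> 1" "t \<ge> 1" for N s t
  proof -
    let ?D = "\<lambda>s. - (\<Sum>n<N. f n * of_real (ln (real n) * real n powr - s))"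
    have D: "(?P N has_vector_derivative ?D x) (at x within {1..})" for x
    proof -
      have "((\<lambda>s. f n * of_real (real n powr - s)) has_vector_derivative
              - (f n * of_real (ln (real n) * real n powr - x))) (at x within {1..})" for n
      proof (cases "n = 0")
        case False
        then have "((\<lambda>s. real n powr - s) has_real_derivative - (ln (real n) * real n powr - x)) (at x within {1..})"
          by (auto intro!: derivative_eq_intros simp: powr_def)
        from has_vector_derivative_mult_right[OF has_vector_derivative_of_real[OF this, where 'a=complex], of "f n"]
        show ?thesis by simp
      qed simp
      then show ?thesis
        unfolding sum_negf[symmetric] by (intro has_vector_derivative_sum) 
    qed
    have "norm (?P N s - ?P N t) \<le> ?C * norm (s - t)"
    proof (rule differentiable_bound[of "{1..}" _ "\<lambda>x h. h *\<^sub>R ?D x"])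
      show "(?P N has_derivative (\<lambda>h. h *\<^sub>R ?D x)) (at x within {1..})" for x
        using D by (simp add: has_vector_derivative_def)
      show "onorm (\<lambda>h. h *\<^sub>R ?D x) \<le> ?C" if "x \<in> {1..}" for x
      proof (rule onorm_le)
        fix h :: real
        show "norm (h *\<^sub>R ?D x) \<le> ?C * norm h"
          using log_terms_bound[of x N] that by (simp add: mult.commute mult_left_mono)
      qed
    qed (use that in auto)
    then show ?thesis by simp
  qed
  have "norm (dirichlet_series f s - dirichlet_series f t) \<le> ?C * \<bar>s - t\<bar>" if "s \<ge> 1" "t \<ge> 1" for s t
    by (rule LIMSEQ_le_const2[OF tendsto_norm[OF tendsto_diff[OF partial_sums_tendsto partial_sums_tendsto]]])
       (use that P in auto)
  moreover have "?C > 0" by (intro add_pos_nonneg mult_nonneg_nonneg) auto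
  ultimately show thesis using that by blast
qed

end

section \<open>Nonvanishing for real characters (Monsky)\<close>

lemma divisor_sum_mult_coprime:
  fixes c :: "nat \<Rightarrow> real"
  assumes mult: "\<And>a b. c (a * b) = c a * c b" and ab: "coprime a b" "a > 0" "b > 0"
  shows "(\<Sum>d | d dvd a * b. c d) = (\<Sum>d | d dvd a. c d) * (\<Sum>d | d dvd b. c d)"
proof -
  have "inj_on (\<lambda>(x, y). x * y) ({d. d dvd a} \<times> {d. d dvd b})"
  proof (rule inj_onI, clarify)
    fix x y x' y' assume h: "x dvd a" "y dvd b" "x' dvd a" "y' dvd b" "x * y = x' * y'"
    have "coprime x y'" "coprime x' y" using h ab(1) by (meson coprime_divisors)+
    then have "x dvd x'" "x' dvd x" using h(5)
      by (metis coprime_dvd_mult_left_iff dvd_triv_left)+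
    then have "x = x'" by (rule dvd_antisym)
    moreover have "x > 0" using h(1) ab(2) by (meson dvd_pos_nat)
    ultimately show "x = x' \<and> y = y'" using h(5) by simp
  qed
  moreover have "{d. d dvd a * b} = (\<lambda>(x, y). x * y) ` ({d. d dvd a} \<times> {d. d dvd b})"
  proof (intro equalityI subsetI)
    fix d assume "d \<in> {d. d dvd a * b}"
    then obtain x y where "d = x * y" "x dvd a" "y dvd b" by (auto elim: dvd_productE)
    then show "d \<in> (\<lambda>(x, y). x * y) ` ({d. d dvd a} \<times> {d. d dvd b})" by (auto simp: image_iff)
  qed (auto intro: mult_dvd_mono)
  ultimately have "(\<Sum>d | d dvd a * b. c d) = (\<Sum>(x, y)\<in>{d. d dvd a} \<times> {d. d dvd b}. c (x * y))"
    by (simp add: sum.reindex case_prod_unfold)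
  then show ?thesis by (simp add: mult sum_product sum.cartesian_product)
qed

text \<open>For \<open>c q\<close> equal to 1, 0, -1 the sum is \<open>k + 1\<close>, 1, or 1 and 0
  alternately, the 0 occurring at odd \<open>k\<close>. By multiplicativity all divisor sums are
  then nonnegative, and those at squares are at least 1.\<close>

lemma divisor_sum_prime_power:
  fixes c :: "nat \<Rightarrow> real"
  assumes mult: "\<And>a b. c (a * b) = c a * c b" and one: "c 1 = 1"
    and val: "\<And>n. c n \<in> {-1, 0, 1}" and q: "Factorial_Ring.prime q"
  shows "(\<Sum>d | d dvd q ^ k. c d) \<ge> (if even k then 1 else 0)"
proof -
  have pw: "c (q ^ i) = c q ^ i" for i by (induction i) (simp_all add: mult one[simplified])
  have "{d. d dvd q ^ k} = (\<lambda>i. q ^ i) ` {..k}"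
    unfolding divides_primepow_nat[OF q] by auto
  moreover have "inj_on (\<lambda>i. q ^ i) {..k}"
    using power_inject_exp[OF prime_gt_1_nat[OF q]] by (intro inj_onI) blast
  ultimately have eq: "(\<Sum>d | d dvd q ^ k. c d) = (\<Sum>i\<le>k. c q ^ i)"
    by (simp add: sum.reindex pw)
  have m1: "(\<Sum>i\<le>k. (-1::real) ^ i) = (if even k then 1 else 0)"
    by (induction k) auto
  have z: "(\<Sum>i\<le>k. (0::real) ^ i) = 1"
    by (induction k) auto
  have "c q = -1 \<or> c q = 0 \<or> c q = 1" using val[of q] by simp
  moreover have "(\<Sum>i\<le>k. (1::real) ^ i) \<ge> 1" by simp
  ultimately have "(\<Sum>i\<le>k. c q ^ i) \<ge> (if even k then 1 else 0)"
    using m1 z by (elim disjE) auto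
  then show ?thesis unfolding eq .
qed

lemma prime_power_split:
  fixes n :: nat
  assumes "n > 1"
  obtains q k l where "Factorial_Ring.prime q" "n = q ^ k * l" "coprime q l" "l < n" "l > 0"
proof -
  obtain q where q: "Factorial_Ring.prime q" "q dvd n"
    using assms by (metis nat_neq_iff prime_factor_nat)
  obtain l where l: "n = q ^ multiplicity q n * l" "\<not> q dvd l"
    using multiplicity_decompose'[of n q] assms q prime_gt_1_nat[OF q(1)] by auto
  have "coprime q l" using l q prime_imp_coprime by blast
  moreover have "l > 0" using l(2) by (cases l) auto
  moreover have "multiplicity q n > 0"
    using q assms by (simp add: prime_multiplicity_gt_zero_iff)
  then have "q ^ multiplicity q n > 1" using prime_gt_1_nat[OF q(1)] by (intro one_less_power)
  then have "l < n" using l(1) \<open>l > 0\<close> n_less_m_mult_n[of l "q ^ multiplicity q n"] by simp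
  ultimately show thesis using that q l by blast
qed

lemma divisor_sum_nonneg:
  fixes c :: "nat \<Rightarrow> real"
  assumes mult: "\<And>a b. c (a * b) = c a * c b" and one: "c 1 = 1"
    and val: "\<And>n. c n \<in> {-1, 0, 1}" and n: "n > 0"
  shows "(\<Sum>d | d dvd n. c d) \<ge> 0"
  using n
proof (induction n rule: less_induct)
  case (less n)
  show ?case
  proof (cases "n = 1")
    case True
    then show ?thesis using one by simp
  next
    case False
    then obtain q k l where d: "Factorial_Ring.prime q" "n = q ^ k * l" "coprime q l" "l < n" "l > 0"
      using less.prems prime_power_split[of n] by (metis nat_neq_iff less_one)
    have "(\<Sum>d | d dvd q ^ k. c d) \<ge> 0"
      using divisor_sum_prime_power[where c=c and q = q and k = k, OF mult one val d(1)] by (auto split: if_splits)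
    then show ?thesis
      using d less.IH[of l] divisor_sum_mult_coprime[where c=c, OF mult, of "q ^ k" l] prime_gt_0_nat[OF d(1)]
      by auto
  qed
qed

lemma divisor_sum_square:
  fixes c :: "nat \<Rightarrow> real"
  assumes mult: "\<And>a b. c (a * b) = c a * c b" and one: "c 1 = 1"
    and val: "\<And>n. c n \<in> {-1, 0, 1}" and n: "n > 0"
  shows "(\<Sum>d | d dvd n ^ 2. c d) \<ge> 1"
  using n
proof (induction n rule: less_induct)
  case (less n)
  show ?case
  proof (cases "n = 1")
    case True
    then show ?thesis using one by simp
  next
    case False
    then obtain q k l where d: "Factorial_Ring.prime q" "n = q ^ k * l" "coprime q l" "l < n" "l > 0"
      using less.prems prime_power_split[of n] by (metis nat_neq_iff less_one)
    have n2: "n ^ 2 = q ^ (2 * k) * l ^ 2" by (simp add: d(2) power_mult_distrib power_mult mult.commute)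
    have "(\<Sum>d | d dvd q ^ (2 * k). c d) \<ge> 1"
      using divisor_sum_prime_power[where c=c and q = q and k = "2 * k", OF mult one val d(1)] by auto
    moreover have "(\<Sum>d | d dvd l ^ 2. c d) \<ge> 1" using less.IH d by auto
    ultimately have "(\<Sum>d | d dvd q ^ (2 * k). c d) * (\<Sum>d | d dvd l ^ 2. c d) \<ge> 1 * 1"
      by (intro mult_mono) auto
    then show ?thesis
      unfolding n2 using d divisor_sum_mult_coprime[where c=c, OF mult, of "q ^ (2 * k)" "l ^ 2"] prime_gt_0_nat[OF d(1)]
      by auto
  qed
qed

section \<open>Monsky's monotone weights and Lambert series\<close>

text \<open>The index \<open>i\<close> is paired with \<open>n - Suc i\<close>, and the inequality
  of arithmetic and geometric means is applied to each pair.\<close>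

lemma geometric_sum_ge:
  fixes u :: real
  assumes "0 < u"
  shows "real n * u ^ (n - 1) \<le> (\<Sum>i<n. (u ^ 2) ^ i)"
proof -
  have "2 * (\<Sum>i<n. (u ^ 2) ^ i) = (\<Sum>i<n. (u ^ 2) ^ i) + (\<Sum>i<n. (u ^ 2) ^ (n - Suc i))"
    by (subst sum.nat_diff_reindex) simp
  also have "\<dots> = (\<Sum>i<n. (u ^ 2) ^ i + (u ^ 2) ^ (n - Suc i))" by (simp add: sum.distrib)
  also have "\<dots> \<ge> (\<Sum>i<n. 2 * u ^ (n - 1))"
  proof (rule sum_mono)
    fix i assume "i \<in> {..<n}"
    then have e: "u ^ i * u ^ (n - Suc i) = u ^ (n - 1)" by (simp add: power_add[symmetric])
    have "0 \<le> (u ^ i - u ^ (n - Suc i)) ^ 2" by simp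
    also have "\<dots> = (u ^ 2) ^ i + (u ^ 2) ^ (n - Suc i) - 2 * (u ^ i * u ^ (n - Suc i))"
      by (simp add: power2_eq_square algebra_simps power_mult_distrib)
    finally show "2 * u ^ (n - 1) \<le> (u ^ 2) ^ i + (u ^ 2) ^ (n - Suc i)" unfolding e by simp
  qed
  finally show ?thesis by simp
qed

text \<open>With \<open>S n = 1 + t + ... + t ^ (n - 1)\<close>, the weight times
  \<open>1 - t\<close> is \<open>1 / n - t ^ n / S n\<close>, and its decrease from \<open>n\<close>
  to \<open>Suc n\<close> is \<open>1 / (n (n + 1)) - t ^ n / (S n * S (Suc n))\<close>. This is
  nonnegative because \<open>S n\<close> is at least \<open>n\<close> times \<open>t\<close> to the
  power \<open>(n - 1) / 2\<close>.\<close>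

lemma lambert_weight:
  fixes t :: real
  assumes t: "0 < t" "t < 1" and n: "n \<ge> 1"
  shows "1 / (real (Suc n) * (1 - t)) - t ^ Suc n / (1 - t ^ Suc n) \<le> 1 / (real n * (1 - t)) - t ^ n / (1 - t ^ n)"
    and "0 \<le> 1 / (real n * (1 - t)) - t ^ n / (1 - t ^ n)"
proof -
  \<comment> \<open>The square root turns the half-integral exponents of the mean inequality into
    natural ones.\<close>
  define u where "u = sqrt t"
  have u: "0 < u" "u < 1" "u ^ 2 = t" using t by (auto simp: u_def)
  define S where "S = (\<lambda>n. \<Sum>i<n. t ^ i)"
  have S: "1 - t ^ k = (1 - t) * S k" for k
    using one_diff_power_eq[of t k] by (simp add: S_def)
  have Sg: "real k * u ^ (k - 1) \<le> S k" for k using geometric_sum_ge[OF u(1), of k] u by (simp add: S_def)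
  have Spos: "S k > 0" if "k \<ge> 1" for k
  proof -
    have "0 < real k * u ^ (k - 1)" using that u(1) by (intro mult_pos_pos) auto
    then show ?thesis using Sg[of k] by linarith
  qed
  have "real n * real (Suc n) * t ^ n \<le> S n * S (Suc n)"
  proof -
    have "t ^ n = u ^ (2 * n)" using u(3) by (simp add: power_mult)
    also have "\<dots> \<le> u ^ (n - 1 + n)" using u by (intro power_decreasing) auto
    finally have "real n * real (Suc n) * t ^ n \<le> real n * real (Suc n) * u ^ (n - 1 + n)"
      by (intro mult_left_mono) auto
    also have "\<dots> = (real n * u ^ (n - 1)) * (real (Suc n) * u ^ (Suc n - 1))"
      by (simp only: power_add diff_Suc_1 mult_ac)
    also have "\<dots> \<le> S n * S (Suc n)"
      using Sg[of n] Sg[of "Suc n"] Spos[OF n] u(1) by (intro mult_mono) auto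
    finally show ?thesis .
  qed
  then have "t ^ n / (S n * S (Suc n)) \<le> 1 / (real n * real (Suc n))"
    using Spos[OF n] Spos[of "Suc n"] n by (subst divide_le_eq_1_pos | simp add: divide_simps mult_ac)+
  moreover have "t ^ n / (S n * S (Suc n)) = t ^ n / S n - t ^ Suc n / S (Suc n)"
  proof -
    have S1: "S (Suc n) - t * S n = 1"
      using sum.lessThan_Suc_shift[of "\<lambda>i. t ^ i" n] by (simp add: S_def sum_distrib_left)
    then have "t ^ n * S (Suc n) - t ^ Suc n * S n = t ^ n"
      using arg_cong[OF S1, of "\<lambda>x. t ^ n * x"] by (simp add: algebra_simps)
    then show ?thesis using Spos[OF n] Spos[of "Suc n"] by (simp add: field_simps)
  qed
  moreover have "1 / (real n * real (Suc n)) = 1 / real n - 1 / real (Suc n)"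
    using n by (simp add: field_simps)
  ultimately have "(1 / real (Suc n) - t ^ Suc n / S (Suc n)) / (1 - t) \<le> (1 / real n - t ^ n / S n) / (1 - t)"
    using t by (intro divide_right_mono) auto
  then show "1 / (real (Suc n) * (1 - t)) - t ^ Suc n / (1 - t ^ Suc n) \<le> 1 / (real n * (1 - t)) - t ^ n / (1 - t ^ n)"
    unfolding S by (simp add: diff_divide_distrib mult.commute)
  have "real n * t ^ n \<le> S n"
  proof -
    have "t ^ n = u ^ (2 * n)" using u(3) by (simp add: power_mult)
    also have "\<dots> \<le> u ^ (n - 1)" using u by (intro power_decreasing) auto
    finally show ?thesis using Sg[of n] by (meson mult_left_mono of_nat_0_le_iff order_trans)
  qed
  then have "t ^ n / S n \<le> 1 / real n" using Spos[OF n] n by (simp add: field_simps)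
  then have "0 \<le> (1 / real n - t ^ n / S n) / (1 - t)" using t by simp
  then show "0 \<le> 1 / (real n * (1 - t)) - t ^ n / (1 - t ^ n)"
    unfolding S by (simp add: diff_divide_distrib mult.commute)
qed

lemma divisor_sum_rearrange:
  fixes c :: "nat \<Rightarrow> real"
  shows "(\<Sum>n=1..N. (\<Sum>d | d dvd n. c d) * t ^ n) = (\<Sum>d=1..N. c d * (\<Sum>k=1..N div d. t ^ (d * k)))"
proof -
  have "(\<Sum>n=1..N. (\<Sum>d | d dvd n. c d) * t ^ n) = (\<Sum>(n, d)\<in>(SIGMA n:{1..N}. {d. d dvd n}). c d * t ^ n)"
    by (subst sum.Sigma[symmetric]) (auto simp: sum_distrib_right)
  also have "\<dots> = (\<Sum>(d, k)\<in>(SIGMA d:{1..N}. {1..N div d}). c d * t ^ (d * k))"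
  proof (rule sum.reindex_bij_witness[of _ "\<lambda>(d, k). (d * k, d)" "\<lambda>(n, d). (d, n div d)"], goal_cases)
    case (1 a)
    then show ?case by auto
  next
    case (2 a)
    then obtain n d where a: "a = (n, d)" "1 \<le> n" "n \<le> N" "d dvd n" by auto
    then have d: "d > 0" "d \<le> n" by (auto dest: dvd_imp_le intro: Nat.gr0I)
    then have "n div d > 0" "n div d \<le> N div d" using a by (auto simp: div_greater_zero_iff div_le_mono)
    then show ?case using a d by auto
  next
    case (3 a)
    then show ?case by auto
  next
    case (4 a)
    then obtain d k where a: "a = (d, k)" "1 \<le> d" "1 \<le> k" "k \<le> N div d" by auto
    then have "d * k \<le> N" using mult_le_mono2[of k "N div d" d] div_times_less_eq_dividend[of N d] by (metis le_trans mult.commute)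
    then show ?case using a by auto
  next
    case (5 a)
    then show ?case by auto
  qed
  also have "\<dots> = (\<Sum>d=1..N. c d * (\<Sum>k=1..N div d. t ^ (d * k)))"
    by (subst sum.Sigma[symmetric]) (auto simp: sum_distrib_left)
  finally show ?thesis .
qed

text \<open>Cutting the geometric series in \<open>t ^ d\<close> after \<open>N div d\<close> terms
  loses at most \<open>t ^ N / (1 - t)\<close>, since \<open>d * Suc (N div d)\<close> is at least
  \<open>N\<close>. The total error tends to 0 with growing \<open>N\<close>, so only finite double
  sums are ever rearranged.\<close>

lemma lambert_truncation:
  fixes c :: "nat \<Rightarrow> real"
  assumes val: "\<And>n. \<bar>c n\<bar> \<le> 1" and t: "0 < t" "t < 1"
  shows "(\<Sum>n=1..N. (\<Sum>d | d dvd n. c d) * t ^ n) \<le> (\<Sum>d=1..N. c d * (t ^ d / (1 - t ^ d))) + real N * (t ^ N / (1 - t))"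
proof -
  have "c d * (\<Sum>k=1..N div d. t ^ (d * k)) \<le> c d * (t ^ d / (1 - t ^ d)) + t ^ N / (1 - t)"
    if d: "d \<in> {1..N}" for d
  proof -
    let ?x = "t ^ d" and ?K = "N div d"
    have "?x \<le> t" using d t power_decreasing[of 1 d t] by simp
    then have x: "0 < ?x" "?x < 1" "1 - t \<le> 1 - ?x" using t by auto
    have "(\<Sum>k=1..?K. t ^ (d * k)) = (\<Sum>k=1..?K. ?x ^ k)" by (simp add: power_mult)
    also have "\<dots> = ?x / (1 - ?x) - ?x ^ Suc ?K / (1 - ?x)"
      using x by (simp add: sum_gp diff_divide_distrib)
    finally have eq: "(\<Sum>k=1..?K. t ^ (d * k)) = ?x / (1 - ?x) - ?x ^ Suc ?K / (1 - ?x)" .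
    have "N \<le> d * Suc ?K"
      using d by (metis dividend_less_times_div less_imp_le mult_Suc_right atLeastAtMost_iff less_le_trans zero_less_one)
    then have "?x ^ Suc ?K \<le> t ^ N" using t by (simp only: power_mult[symmetric]) (rule power_decreasing, auto)
    then have "?x ^ Suc ?K / (1 - ?x) \<le> t ^ N / (1 - t)"
      using x t by (intro frac_le) auto
    moreover have "\<bar>c d * (?x ^ Suc ?K / (1 - ?x))\<bar> \<le> 1 * (?x ^ Suc ?K / (1 - ?x))"
      unfolding abs_mult using x val[of d] by (intro mult_mono) auto
    ultimately have "- (c d * (?x ^ Suc ?K / (1 - ?x))) \<le> t ^ N / (1 - t)" by linarith
    then show ?thesis unfolding eq by (simp only: right_diff_distrib)
  qed
  then have "(\<Sum>d=1..N. c d * (\<Sum>k=1..N div d. t ^ (d * k))) \<le> (\<Sum>d=1..N. c d * (t ^ d / (1 - t ^ d)) + t ^ N / (1 - t))"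
    by (rule sum_mono)
  also have "\<dots> = (\<Sum>d=1..N. c d * (t ^ d / (1 - t ^ d))) + real N * (t ^ N / (1 - t))"
    by (simp only: sum.distrib) simp
  finally show ?thesis unfolding divisor_sum_rearrange .
qed

text \<open>If the series vanished, the Lambert series of \<open>c\<close> would be, up to sign, the
  sum of \<open>c n\<close> against the monotone weights and would stay bounded as \<open>t\<close>
  tends to 1. But its expansion in powers of \<open>t\<close> has the divisor sums of
  \<open>c\<close> as coefficients, nonnegative and at least 1 at squares, so it dominates the sum
  of \<open>t ^ (j ^ 2)\<close>, which is unbounded.\<close>

lemma real_character_series_nonzero:
  fixes c :: "nat \<Rightarrow> real"
  assumes mult: "\<And>a b. c (a * b) = c a * c b" and one: "c 1 = 1"
    and val: "\<And>n. c n \<in> {-1, 0, 1}" and bound: "\<And>N. \<bar>\<Sum>n<N. c n\<bar> \<le> B"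
  shows "\<not> (\<lambda>N. \<Sum>n=1..N. c n / real n) \<longlonglongrightarrow> 0"
proof
  assume lim: "(\<lambda>N. \<Sum>n=1..N. c n / real n) \<longlonglongrightarrow> 0"
  have val': "\<bar>c n\<bar> \<le> 1" for n using val[of n] by auto
  \<comment> \<open>\<open>2 * B\<close> comes from partial summation, the first weight being 1. The
    remaining 2 absorbs two errors that vanish for large \<open>N\<close>: the partial sum of
    \<open>c n / n\<close> divided by \<open>1 - t\<close>, and the truncation of the Lambert
    series.\<close>
  have squares: "(\<Sum>j=1..J. t ^ (j ^ 2)) \<le> 2 * B + 2" if t: "0 < t" "t < 1" for t J
  proof -
    let ?a = "\<lambda>n. 1 / (real n * (1 - t)) - t ^ n / (1 - t ^ n)"
    have a1: "?a 1 = 1" using t by (simp add: diff_divide_distrib[symmetric])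
    have A: "\<bar>\<Sum>n=1..N. c n * ?a n\<bar> \<le> 2 * B" for N
    proof -
      have "norm (\<Sum>i\<in>{1..<Suc N}. ?a i *\<^sub>R c i) \<le> 2 * B * ?a 1"
        by (rule abel_summation_bound[where f = c and a = ?a and M = 1])
           (use lambert_weight[OF t] bound in auto)
      then show ?thesis unfolding a1 by (simp add: mult.commute atLeastLessThanSuc_atLeastAtMost)
    qed
    have "(\<lambda>N. (\<Sum>n=1..N. c n / real n) / (1 - t)) \<longlonglongrightarrow> 0 / (1 - t)"
      using t by (intro tendsto_divide lim tendsto_const) auto
    moreover have "(\<lambda>N. real N * t ^ N * (1 / (1 - t))) \<longlonglongrightarrow> 0 * (1 / (1 - t))"
      using t by (intro tendsto_mult tendsto_const powser_times_n_limit_0) auto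
    ultimately have "eventually (\<lambda>N. (\<Sum>n=1..N. c n / real n) / (1 - t) < 1 \<and> real N * t ^ N * (1 / (1 - t)) < 1 \<and> N \<ge> J ^ 2) sequentially"
      by (intro eventually_conj order_tendstoD eventually_ge_at_top) auto
    then obtain N where N: "(\<Sum>n=1..N. c n / real n) / (1 - t) < 1" "real N * t ^ N * (1 / (1 - t)) < 1" "N \<ge> J ^ 2"
      unfolding eventually_sequentially by blast
    have "(\<Sum>n=1..N. c n * ?a n) = (\<Sum>n=1..N. c n / real n) / (1 - t) - (\<Sum>n=1..N. c n * (t ^ n / (1 - t ^ n)))"
      unfolding sum_divide_distrib sum_subtractf[symmetric]
      by (intro sum.cong refl) (simp add: right_diff_distrib)
    then have *: "(\<Sum>n=1..N. (\<Sum>d | d dvd n. c d) * t ^ n) \<le> 2 * B + 2"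
      using lambert_truncation[where c = c and N = N, OF val' t] A[of N] N by simp
    have "(\<Sum>j=1..J. t ^ (j ^ 2)) \<le> (\<Sum>j=1..J. (\<Sum>d | d dvd j ^ 2. c d) * t ^ (j ^ 2))"
    proof (rule sum_mono)
      fix j assume "j \<in> {1..J}"
      then show "t ^ (j ^ 2) \<le> (\<Sum>d | d dvd j ^ 2. c d) * t ^ (j ^ 2)"
        using mult_right_mono[OF divisor_sum_square[where c = c and n = j, OF mult one val], of "t ^ (j ^ 2)"] t by simp
    qed
    also have "\<dots> = (\<Sum>n\<in>(\<lambda>j. j ^ 2) ` {1..J}. (\<Sum>d | d dvd n. c d) * t ^ n)"
      by (subst sum.reindex) (auto intro!: inj_onI)
    also have "\<dots> \<le> (\<Sum>n=1..N. (\<Sum>d | d dvd n. c d) * t ^ n)"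
    proof (rule sum_mono2)
      show "(\<lambda>j. j ^ 2) ` {1..J} \<subseteq> {1..N}"
        using N(3) by (auto simp: power_mono intro: order_trans[OF power_mono])
      show "0 \<le> (\<Sum>d | d dvd n. c d) * t ^ n" if "n \<in> {1..N} - (\<lambda>j. j ^ 2) ` {1..J}" for n
        using that t divisor_sum_nonneg[where c = c and n = n, OF mult one val] by auto
    qed auto
    finally show ?thesis using * by linarith
  qed
  have "real J \<le> 2 * B + 2" for J
  proof (rule tendsto_le[of "at_left (1::real)"])
    show "((\<lambda>t. \<Sum>j=1..J. t ^ (j ^ 2)) \<longlongrightarrow> real J) (at_left 1)"
      by (rule tendsto_eq_intros refl tendsto_ident_at | simp)+
    show "eventually (\<lambda>t. (\<Sum>j=1..J. t ^ (j ^ 2)) \<le> 2 * B + 2) (at_left (1::real))"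
      using squares eventually_at_left[of 0 "1::real"] by (auto intro!: exI[of _ 0])
  qed auto
  then show False using reals_Archimedean2[of "2 * B + 2"] by (metis not_less)
qed

section \<open>The characters of order dividing 4 and a prime with prescribed values\<close>

locale quartic_characters =
  fixes p g :: nat
  assumes p_prime: "Factorial_Ring.prime p" and p_mod_8: "p mod 8 = 1"
    and g: "residue_primroot p g"
begin

text \<open>For \<open>n\<close> prime to \<open>p\<close> the index is determined only modulo
  \<open>p - 1\<close>; as 4 divides \<open>p - 1\<close>, the power \<open>\<i> ^ ind n\<close>
  does not depend on the choice.\<close>

definition ind :: "nat \<Rightarrow> nat" where
  "ind n = (SOME k. [n = g ^ k] (mod p))"

text \<open>This is \<open>chi ^ a * psi ^ b\<close> restricted to the common modulus
  \<open>4 * p\<close>. All these functions vanish at the same arguments, so the primes 2 and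
  \<open>p\<close> contribute trivial Euler factors throughout.\<close>

definition chr :: "nat \<Rightarrow> nat \<Rightarrow> nat \<Rightarrow> complex" where
  "chr a b n = (if coprime n (4 * p) then (if n mod 4 = 1 then 1 else -1) ^ a * \<i> ^ (b * ind n) else 0)"

lemma p_gt_1: "p > 1"
  using p_prime by (rule prime_gt_1_nat)

lemma coprime_4_p: "coprime 4 p"
proof -
  have "odd p" using p_mod_8 by presburger
  then have "coprime (2 ^ 2) p" by (subst coprime_power_left_iff) auto
  then show ?thesis by simp
qed

lemma coprime_4p_iff: "coprime n (4 * p) \<longleftrightarrow> odd n \<and> coprime n p"
proof -
  have "coprime n (2 ^ 2) \<longleftrightarrow> odd n" by (subst coprime_power_right_iff) auto
  then show ?thesis by simp
qed

lemma power_g_cong_iff: "[g ^ j = g ^ k] (mod p) \<longleftrightarrow> [j = k] (mod (p - 1))"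
  using g order_divides_expdiff[of p g j k] p_prime by (simp add: residue_primroot_def totient_prime)

lemma ex_ind:
  assumes "coprime n p"
  shows "\<exists>k. [n = g ^ k] (mod p)"
proof -
  have "n mod p \<in> totatives p" using assms p_gt_1
    by (auto simp: totatives_def coprime_commute intro!: Nat.gr0I)
  then obtain k where "n mod p = g ^ k mod p"
    using residue_primroot_is_generator[OF p_gt_1 g] by (auto simp: bij_betw_def)
  then show ?thesis by (auto simp: unique_euclidean_semiring_class.cong_def)
qed

lemma ind_cong: "coprime n p \<Longrightarrow> [n = g ^ ind n] (mod p)"
  unfolding ind_def by (rule someI_ex) (rule ex_ind)

lemma i_power_ind:
  assumes n: "[n = g ^ k] (mod p)"
  shows "\<i> ^ ind n = \<i> ^ k"
proof -
  have "[n = g ^ ind n] (mod p)" unfolding ind_def using n by (rule someI)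
  then have "[g ^ ind n = g ^ k] (mod p)" using n by (meson cong_sym cong_trans)
  then have "[ind n = k] (mod (p - 1))" by (simp add: power_g_cong_iff)
  moreover have "4 dvd p - 1" using p_mod_8 by presburger
  ultimately have "[ind n = k] (mod 4)" by (rule cong_dvd_modulus_nat)
  moreover have "\<i> ^ j = \<i> ^ (j mod 4)" for j
  proof -
    have "\<i> ^ j = (\<i> ^ 4) ^ (j div 4) * \<i> ^ (j mod 4)"
      by (simp only: power_mult[symmetric] power_add[symmetric]) simp
    then show ?thesis by simp
  qed
  ultimately show ?thesis by (metis unique_euclidean_semiring_class.cong_def)
qed

lemma i_power_ind_mult:
  assumes "coprime m p" "coprime n p"
  shows "\<i> ^ ind (m * n) = \<i> ^ ind m * \<i> ^ ind n"
proof -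
  have "[m * n = g ^ (ind m + ind n)] (mod p)"
    using cong_mult[OF ind_cong[OF assms(1)] ind_cong[OF assms(2)]] by (simp add: power_add)
  then have "\<i> ^ ind (m * n) = \<i> ^ (ind m + ind n)" by (rule i_power_ind)
  then show ?thesis by (simp add: power_add)
qed

lemma chr_nonzero: "coprime n (4 * p) \<Longrightarrow> chr a b n = (if n mod 4 = 1 then 1 else -1) ^ a * (\<i> ^ ind n) ^ b"
  by (simp add: chr_def power_mult[symmetric] mult.commute)

lemma residue_character_chr: "residue_character (4 * p) (chr a b)"
proof
  show "4 * p > 1" using p_gt_1 by simp
  show "chr a b (m * n) = chr a b m * chr a b n" for m n
  proof (cases "coprime m (4 * p) \<and> coprime n (4 * p)")
    case True
    then have cp: "coprime (m * n) (4 * p)" by simp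
    have o: "odd m" "odd n" "coprime m p" "coprime n p" using True coprime_4p_iff by auto
    then have "m mod 4 = 1 \<or> m mod 4 = 3" "n mod 4 = 1 \<or> n mod 4 = 3" by presburger+
    then have "(if (m * n) mod 4 = 1 then 1 else -1 :: complex) =
        (if m mod 4 = 1 then 1 else -1) * (if n mod 4 = 1 then 1 else -1)"
      using mod_mult_eq[of m 4 n] by auto
    then show ?thesis
      using True o by (simp only: chr_nonzero[OF cp] chr_nonzero i_power_ind_mult power_mult_distrib mult_ac)
  next
    case False
    then show ?thesis by (auto simp: chr_def)
  qed
  show "chr a b 1 = 1"
    using i_power_ind[of 1 0] by (simp add: chr_nonzero)
  show "chr a b (n + 4 * p) = chr a b n" for n
  proof (cases "coprime n (4 * p)")
    case True
    then have cp: "coprime (n + 4 * p) (4 * p)" by (metis add.commute coprime_iff_gcd_eq_1 gcd_add2 gcd.commute)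
    have "coprime n p" using True by simp
    have "[n + 4 * p = g ^ ind n] (mod p)"
      using ind_cong[OF \<open>coprime n p\<close>] by (simp add: unique_euclidean_semiring_class.cong_def)
    then have "\<i> ^ ind (n + 4 * p) = \<i> ^ ind n" by (rule i_power_ind)
    moreover have "(n + 4 * p) mod 4 = n mod 4" by presburger
    ultimately show ?thesis using True cp by (simp only: chr_nonzero)
  next
    case False
    then have "\<not> coprime (n + 4 * p) (4 * p)" by (metis add.commute coprime_iff_gcd_eq_1 gcd_add2 gcd.commute)
    then show ?thesis using False by (simp add: chr_def)
  qed
  show "norm (chr a b n) \<le> 1" for n
    by (simp add: chr_def norm_mult norm_power)
  show "chr a b n = 0" if "\<not> coprime n (4 * p)" for n
    using that by (simp add: chr_def)
qed

text \<open>The Chinese remainder theorem prescribes the class modulo 4 and the index independently: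
  class 3 detects \<open>chi\<close>, and class 1 with index 1 detects every nontrivial power of
  \<open>psi\<close>.\<close>

lemma nonprincipal_chr:
  assumes "a < 2" "b < 4" "(a, b) \<noteq> (0, 0)"
  shows "nonprincipal_character (4 * p) (chr a b)"
proof -
  interpret residue_character "4 * p" "chr a b" by (rule residue_character_chr)
  have ex: "\<exists>c. coprime c (4 * p) \<and> c mod 4 = e \<and> \<i> ^ ind c = \<i> ^ k" if "e = 1 \<or> e = 3" for e k
  proof -
    obtain c where c: "[c = e] (mod 4)" "[c = g ^ k] (mod p)"
      using binary_chinese_remainder_nat[OF coprime_4_p] by blast
    have "coprime g p" using g by (simp add: residue_primroot_def coprime_commute)
    then have "coprime (g ^ k) p" by simp
    then have "coprime c p" using c(2) by (metis cong_imp_coprime cong_sym)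
    moreover have m: "c mod 4 = e" using c(1) that by (auto simp: unique_euclidean_semiring_class.cong_def)
    then have "odd c" using that by presburger
    ultimately show ?thesis using i_power_ind[OF c(2)] m by (intro exI[of _ c]) (simp only: coprime_4p_iff, simp)
  qed
  have "\<exists>c. coprime c (4 * p) \<and> chr a b c \<noteq> 1"
  proof (cases "b = 0")
    case True
    then have "a = 1" using assms by auto
    moreover obtain c where "coprime c (4 * p)" "c mod 4 = 3" using ex[of 3 0] by auto
    ultimately show ?thesis using True by (intro exI[of _ c]) (simp add: chr_nonzero)
  next
    case False
    then have "b = 1 \<or> b = 2 \<or> b = 3" using assms by linarith
    moreover obtain c where "coprime c (4 * p)" "c mod 4 = 1" "\<i> ^ ind c = \<i> ^ 1" using ex[of 1 1] by auto
    ultimately show ?thesis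
      by (intro exI[of _ c]) (auto simp: chr_nonzero power2_eq_square power3_eq_cube complex_eq_iff)
  qed
  then show ?thesis by unfold_locales
qed

lemma ind_eq_cases:
  obtains "\<i> ^ ind n = 1" | "\<i> ^ ind n = -1" | "\<i> ^ ind n = \<i>" | "\<i> ^ ind n = - \<i>"
proof -
  have "\<i> ^ k \<in> {1, -1, \<i>, -\<i>}" for k by (induction k) auto
  then show thesis using that by blast
qed

text \<open>The value -1 means that the index is 2 modulo 4, so the power is congruent to
  \<open>g ^ ((p - 1) div 2)\<close>.\<close>

lemma power_quarter_cong:
  assumes n: "coprime n p" and "\<i> ^ ind n = -1"
  shows "[int n ^ ((p - 1) div 4) = -1] (mod int p)"
proof -
  have i2: "\<i> ^ (k mod 4) = \<i> ^ k" for k :: nat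
  proof -
    have "\<i> ^ k = (\<i> ^ 4) ^ (k div 4) * \<i> ^ (k mod 4)"
      by (simp only: power_mult[symmetric] power_add[symmetric]) simp
    then show ?thesis by simp
  qed
  have "\<i> ^ (ind n mod 4) = -1" using i2[of "ind n"] assms(2) by simp
  moreover have "ind n mod 4 < 4" by simp
  then have "ind n mod 4 = 0 \<or> ind n mod 4 = 1 \<or> ind n mod 4 = 2 \<or> ind n mod 4 = 3" by linarith
  ultimately have "ind n mod 4 = 2" by (auto simp: power3_eq_cube complex_eq_iff)
  then obtain j where j: "ind n = 4 * j + 2" by (metis mult_div_mod_eq)
  \<comment> \<open>A square root of 1 modulo \<open>p\<close>, and different from 1 because
    \<open>g\<close> is a primitive root; hence it is -1.\<close>
  let ?h = "g ^ ((p - 1) div 2)"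
  have p4: "p - 1 = 4 * ((p - 1) div 4)" "p - 1 = 2 * ((p - 1) div 2)" using p_mod_8 by presburger+
  have "?h ^ 2 = g ^ (p - 1)" using p4(2) by (metis power_mult mult.commute)
  then have "[?h ^ 2 = 1] (mod p)" using power_g_cong_iff[of "p - 1" 0] by (simp add: unique_euclidean_semiring_class.cong_def)
  then have "[int ?h ^ 2 = 1] (mod int p)" by (metis cong_int_iff of_nat_1 of_nat_power)
  then have "int p dvd (int ?h - 1) * (int ?h + 1)"
    by (simp add: cong_iff_dvd_diff power2_eq_square algebra_simps)
  moreover have "\<not> int p dvd int ?h - 1"
  proof
    assume "int p dvd int ?h - 1"
    then have "[?h = g ^ 0] (mod p)" by (metis cong_iff_dvd_diff cong_int_iff of_nat_1 power_0)
    then have "[(p - 1) div 2 = 0] (mod (p - 1))" by (simp only: power_g_cong_iff)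
    then have "p - 1 dvd (p - 1) div 2" by (simp only: cong_0_iff)
    moreover have "(p - 1) div 2 > 0" "(p - 1) div 2 < p - 1" using p_gt_1 p_mod_8 by presburger+
    ultimately show False by (meson dvd_imp_le not_less)
  qed
  ultimately have h: "[int ?h = -1] (mod int p)"
    using p_prime by (simp add: cong_iff_dvd_diff prime_dvd_mult_iff)
  have "[n ^ ((p - 1) div 4) = (g ^ ind n) ^ ((p - 1) div 4)] (mod p)"
    by (rule cong_pow[OF ind_cong[OF n]])
  also have "(g ^ ind n) ^ ((p - 1) div 4) = g ^ ((p - 1) * j + (p - 1) div 2)"
  proof -
    have "ind n * ((p - 1) div 4) = 4 * ((p - 1) div 4) * j + 2 * ((p - 1) div 4)" by (simp add: j algebra_simps)
    also have "\<dots> = (p - 1) * j + (p - 1) div 2" using p4 by presburger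
    finally show ?thesis by (simp add: power_mult[symmetric])
  qed
  also have "[g ^ ((p - 1) * j + (p - 1) div 2) = ?h] (mod p)"
    by (subst power_g_cong_iff) (simp add: unique_euclidean_semiring_class.cong_def)
  finally have "[int n ^ ((p - 1) div 4) = int ?h] (mod int p)"
    by (metis cong_int_iff of_nat_power)
  then show ?thesis using h by (rule cong_trans)
qed

end

section \<open>Comparison of Euler products and behaviour at 1\<close>

text \<open>Comparison with the integral of \<open>x powr - s\<close>, by the mean value theorem on
  each unit interval.\<close>

lemma sum_powr_le:
  fixes s :: real
  assumes s: "s > 1" and N: "N \<ge> 1"
  shows "(\<Sum>n=1..N. real n powr - s) \<le> 1 + (1 - real N powr (1 - s)) / (s - 1)"
  using N
proof (induction N rule: dec_induct)
  case base
  then show ?case by simp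
next
  case (step N)
  let ?F = "\<lambda>x. - (x powr (1 - s) / (s - 1))"
  have D: "(?F has_real_derivative x powr - s) (at x)" if "x > 0" for x
  proof (rule DERIV_cong[OF DERIV_minus[OF DERIV_cdivide[OF has_real_derivative_powr[OF that]]]])
    have "(1 - s) / (s - 1) = -1" using s by (simp add: field_simps)
    then show "- ((1 - s) * x powr (1 - s - 1) / (s - 1)) = x powr - s"
      by (simp only: times_divide_eq_left[symmetric]) simp
  qed
  obtain z where z: "z > real N" "z < real (Suc N)" "?F (real (Suc N)) - ?F (real N) = (real (Suc N) - real N) * z powr - s"
    using MVT2[of "real N" "real (Suc N)" ?F "\<lambda>x. x powr - s"] D step by auto
  have "real (Suc N) powr - s \<le> z powr - s"
    using z s step by (intro powr_mono2') auto
  then have "real (Suc N) powr - s \<le> ?F (real (Suc N)) - ?F (real N)" using z(3) by simp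
  moreover have "(\<Sum>n=1..Suc N. real n powr - s) = (\<Sum>n=1..N. real n powr - s) + real (Suc N) powr - s"
    by simp
  ultimately show ?case using step.IH by (simp add: diff_divide_distrib)
qed

lemma (in residue_character) dirichlet_series_le_zeta:
  assumes s: "s > 1"
  shows "norm (dirichlet_series f s) \<le> 1 + 1 / (s - 1)"
proof -
  have "norm (dirichlet_series f s) \<le> suminf (\<lambda>n. norm (f n * of_real (real n powr - s)))"
    unfolding dirichlet_series_def by (rule summable_norm[OF summable_norm_terms[OF s]])
  also have "\<dots> \<le> 1 + 1 / (s - 1)"
  proof (rule suminf_le_const[OF summable_norm_terms[OF s]])
    fix N
    \<comment> \<open>The range is enlarged to \<open>Suc (Suc N)\<close> so that the sum starting
      at 1 is never empty and \<open>sum_powr_le\<close> applies.\<close>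
    have "(\<Sum>n<N. norm (f n * of_real (real n powr - s))) \<le> (\<Sum>n<Suc (Suc N). real n powr - s)"
    proof (rule sum_le_included[where i = id])
      show "\<forall>n\<in>{..<N}. \<exists>k\<in>{..<Suc (Suc N)}. id k = n \<and> norm (f n * of_real (real n powr - s)) \<le> real k powr - s"
        using mult_right_mono[OF norm_le_1, of "real _ powr - s"] by (auto simp: norm_mult intro!: bexI)
    qed auto
    also have "\<dots> = (\<Sum>n=1..Suc N. real n powr - s)"
      by (rule sum.mono_neutral_cong_right) (auto simp: not_le)
    also have "\<dots> \<le> 1 + (1 - real (Suc N) powr (1 - s)) / (s - 1)" by (rule sum_powr_le[OF s]) simp
    also have "\<dots> \<le> 1 + 1 / (s - 1)" using s by (simp add: divide_right_mono)
    finally show "(\<Sum>n<N. norm (f n * of_real (real n powr - s))) \<le> 1 + 1 / (s - 1)" .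
  qed
  finally show ?thesis .
qed

text \<open>Multiplying each limit by the other factor gives two limits of one sequence, so
  \<open>L = M\<close> without convergence of \<open>P\<close> itself. The bound on \<open>P\<close>
  forces \<open>L\<close> to be at least 1 in norm.\<close>

lemma euler_product_comparison:
  fixes P Q :: "nat \<Rightarrow> 'a::real_normed_field"
  assumes "\<And>N. P N = Q N" "\<And>N. norm (P N) \<le> 1"
    and P: "(\<lambda>N. P N * L) \<longlonglongrightarrow> 1" and Q: "(\<lambda>N. Q N * M) \<longlonglongrightarrow> 1"
  shows "L = M" "norm L \<ge> 1"
proof -
  have Q': "(\<lambda>N. P N * M) \<longlonglongrightarrow> 1" using Q assms(1) by simp
  have "(\<lambda>N. (P N * L) * M) \<longlonglongrightarrow> 1 * M" by (intro tendsto_intros P)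
  moreover have "(\<lambda>N. (P N * M) * L) \<longlonglongrightarrow> 1 * L" by (intro tendsto_intros Q')
  moreover have "(\<lambda>N. (P N * L) * M) = (\<lambda>N. (P N * M) * L)" by (simp add: mult_ac)
  ultimately show "L = M" using LIMSEQ_unique by fastforce
  have "1 \<le> norm L"
  proof -
    have "norm (P n * L) \<le> norm L" for n
      using assms(2)[of n] by (simp add: norm_mult mult_left_le_one_le)
    then show ?thesis using LIMSEQ_le_const2[OF tendsto_norm[OF P], of "norm L"] by simp
  qed
  then show "norm L \<ge> 1" by simp
qed

text \<open>Outside the excluded pair both products equal \<open>(1 - x) ^ 4\<close>,
  \<open>(1 - x ^ 2) ^ 2\<close> or \<open>1 - x ^ 4\<close>, all of them in the unit interval; at
  \<open>w = z = -1\<close> they would be \<open>(1 - x) ^ 4\<close> and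
  \<open>(1 + x) ^ 4\<close>.\<close>

lemma character_euler_factors:
  fixes x :: real and w z :: complex
  assumes w: "w = 1 \<or> w = -1" "\<not> (w = -1 \<and> z = -1)" and z: "z = 1 \<or> z = -1 \<or> z = \<i> \<or> z = - \<i>"
    and x: "0 \<le> x" "x \<le> 1"
  shows "(1 - of_real x) * (1 - z ^ 2 * of_real x) * (1 - w * z * of_real x) * (1 - w * z ^ 3 * of_real x) =
           (1 - w * of_real x) * (1 - w * z ^ 2 * of_real x) * (1 - z * of_real x) * (1 - z ^ 3 * of_real x) \<and>
         norm ((1 - of_real x) * (1 - z ^ 2 * of_real x) * (1 - w * z * of_real x) * (1 - w * z ^ 3 * of_real x)) \<le> 1"
    (is "?l = ?r \<and> _")
proof -
  let ?X = "of_real x :: complex"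
  have "?l = ?r \<and> (?l = (1 - ?X) ^ 4 \<or> ?l = (1 - ?X ^ 2) ^ 2 \<or> ?l = 1 - ?X ^ 4)"
    using w z by (elim disjE) (simp_all add: eval_nat_numeral, simp_all add: algebra_simps)
  moreover have "norm ((1 - ?X ^ j) ^ k) \<le> 1" for j k
  proof -
    have "norm (1 - ?X ^ j) = \<bar>1 - x ^ j\<bar>" by (metis norm_of_real of_real_1 of_real_diff of_real_power)
    also have "\<dots> \<le> 1" using x by (auto simp: power_le_one)
    finally show ?thesis by (simp add: norm_power power_le_one)
  qed
  from this[of 1 4] this[of 2 2] this[of 4 1]
  have "norm ((1 - ?X) ^ 4) \<le> 1" "norm ((1 - ?X ^ 2) ^ 2) \<le> 1" "norm (1 - ?X ^ 4) \<le> 1" by simp_all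
  ultimately show ?thesis by metis
qed

context quartic_characters
begin

abbreviation L :: "nat \<Rightarrow> nat \<Rightarrow> real \<Rightarrow> complex" where
  "L a b \<equiv> dirichlet_series (chr a b)"

lemma euler_factors:
  fixes x :: real
  assumes x: "0 \<le> x" "x \<le> 1" and n: "\<not> (n mod 4 = 3 \<and> \<i> ^ ind n = -1)"
  defines "e \<equiv> \<lambda>a b. 1 - chr a b n * of_real x"
  shows "e 0 0 * e 0 2 * e 1 1 * e 1 3 = e 1 0 * e 1 2 * e 0 1 * e 0 3"
    and "norm (e 0 0 * e 0 2 * e 1 1 * e 1 3) \<le> 1"
proof -
  have "(e 0 0 * e 0 2 * e 1 1 * e 1 3 = e 1 0 * e 1 2 * e 0 1 * e 0 3) \<and>
    norm (e 0 0 * e 0 2 * e 1 1 * e 1 3) \<le> 1"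
  proof (cases "coprime n (4 * p)")
    case False
    then have "e a b = 1" for a b unfolding e_def chr_def by (simp only: if_False) simp
    then show ?thesis by simp
  next
    case True
    then have "odd n" using coprime_4p_iff by blast
    then have m: "n mod 4 = 1 \<or> n mod 4 = 3" by presburger
    define w :: complex where "w = (if n mod 4 = 1 then 1 else -1)"
    define z where "z = \<i> ^ ind n"
    have e: "e a b = 1 - w ^ a * z ^ b * of_real x" for a b
      unfolding e_def w_def z_def chr_nonzero[OF True] ..
    have w: "w = 1 \<or> w = -1" "\<not> (w = -1 \<and> z = -1)"
      using m n by (auto simp: w_def z_def)
    have z: "z = 1 \<or> z = -1 \<or> z = \<i> \<or> z = - \<i>"
      unfolding z_def by (cases rule: ind_eq_cases[of n]) auto
    have es: "e 0 0 = 1 - of_real x" "e 0 2 = 1 - z ^ 2 * of_real x" "e 1 1 = 1 - w * z * of_real x"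
      "e 1 3 = 1 - w * z ^ 3 * of_real x" "e 1 0 = 1 - w * of_real x" "e 1 2 = 1 - w * z ^ 2 * of_real x"
      "e 0 1 = 1 - z * of_real x" "e 0 3 = 1 - z ^ 3 * of_real x"
      by (simp_all add: e)
    show ?thesis unfolding es by (rule character_euler_factors[OF w z x])
  qed
  then show "e 0 0 * e 0 2 * e 1 1 * e 1 3 = e 1 0 * e 1 2 * e 0 1 * e 0 3"
    and "norm (e 0 0 * e 0 2 * e 1 1 * e 1 3) \<le> 1" by auto
qed

lemma L_identity:
  assumes none: "\<And>r. Factorial_Ring.prime r \<Longrightarrow> r mod 4 = 3 \<Longrightarrow> \<i> ^ ind r \<noteq> -1" and s: "s > 1"
  shows "L 0 0 s * L 0 2 s * L 1 1 s * L 1 3 s = L 1 0 s * L 1 2 s * L 0 1 s * L 0 3 s"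
    and "norm (L 0 0 s * L 0 2 s * L 1 1 s * L 1 3 s) \<ge> 1"
proof -
  let ?e = "\<lambda>a b q. 1 - chr a b q * of_real (real q powr - s)"
  let ?S = "\<lambda>N. {q. Factorial_Ring.prime q \<and> q \<le> (N::nat)}"
  let ?E = "\<lambda>a b N. \<Prod>q\<in>?S N. ?e a b q"
  have lim: "(\<lambda>N. ?E a b N * L a b s) \<longlonglongrightarrow> 1" for a b
    by (rule residue_character.euler_product[OF residue_character_chr s])
  have lim4: "(\<lambda>N. (?E a b N * ?E a' b' N * ?E a'' b'' N * ?E a3 b3 N) * (L a b s * L a' b' s * L a'' b'' s * L a3 b3 s)) \<longlonglongrightarrow> 1"
    for a b a' b' a'' b'' a3 b3
    using tendsto_mult[OF tendsto_mult[OF tendsto_mult[OF lim[of a b] lim[of a' b']] lim[of a'' b'']] lim[of a3 b3]]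
    by (simp add: mult_ac)
  have q: "0 \<le> real q powr - s \<and> real q powr - s \<le> 1 \<and> \<not> (q mod 4 = 3 \<and> \<i> ^ ind q = -1)" if "q \<in> ?S N" for q N
    using that none s powr_mono2'[of "-s" 1 "real q"] prime_ge_1_nat[of q] by auto
  have eq: "?E 0 0 N * ?E 0 2 N * ?E 1 1 N * ?E 1 3 N = ?E 1 0 N * ?E 1 2 N * ?E 0 1 N * ?E 0 3 N" for N
    unfolding prod.distrib[symmetric] using q by (intro prod.cong refl euler_factors(1)) blast+
  have le: "norm (?E 0 0 N * ?E 0 2 N * ?E 1 1 N * ?E 1 3 N) \<le> 1" for N
    unfolding prod.distrib[symmetric] prod_norm[symmetric] using q
    by (intro prod_le_1 conjI norm_ge_zero euler_factors(2)) blast+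
  show "L 0 0 s * L 0 2 s * L 1 1 s * L 1 3 s = L 1 0 s * L 1 2 s * L 0 1 s * L 0 3 s"
    by (rule euler_product_comparison(1)[OF eq le lim4 lim4])
  show "norm (L 0 0 s * L 0 2 s * L 1 1 s * L 1 3 s) \<ge> 1"
    by (rule euler_product_comparison(2)[OF eq le lim4 lim4])
qed

lemma L_continuous:
  assumes "a < 2" "b < 4" "(a, b) \<noteq> (0, 0)"
  shows "(L a b \<longlongrightarrow> L a b 1) (at_right 1)"
proof -
  interpret nonprincipal_character "4 * p" "chr a b" by (rule nonprincipal_chr[OF assms])
  obtain C where C: "C > 0" "\<And>s t. s \<ge> 1 \<Longrightarrow> t \<ge> 1 \<Longrightarrow> norm (L a b s - L a b t) \<le> C * \<bar>s - t\<bar>"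
    using lipschitz by blast
  have "((\<lambda>s. C * \<bar>s - 1\<bar>) \<longlongrightarrow> C * \<bar>1 - 1\<bar>) (at_right 1)"
    by (intro tendsto_intros)
  then have "((\<lambda>s. L a b s - L a b 1) \<longlongrightarrow> 0) (at_right 1)"
    by (intro Lim_null_comparison[of "\<lambda>s. L a b s - L a b 1" "\<lambda>s. C * \<bar>s - 1\<bar>"])
       (use C(2)[of _ 1] in \<open>auto simp: eventually_at_filter intro!: always_eventually\<close>)
  then show ?thesis by (simp add: LIM_zero_iff)
qed

text \<open>\<open>chi\<close> is real and \<open>psi ^ 3\<close> is the conjugate of
  \<open>psi\<close>. A zero of one of the two series at 1 therefore counts twice in the
  product.\<close>

lemma L_1_3: "s \<ge> 1 \<Longrightarrow> L 1 3 s = cnj (L 1 1 s)"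
proof -
  assume s: "s \<ge> 1"
  interpret nonprincipal_character "4 * p" "chr 1 1" by (rule nonprincipal_chr) auto
  have "chr 1 3 n = cnj (chr 1 1 n)" for n
  proof (cases "coprime n (4 * p)")
    case True
    then show ?thesis
      by (cases rule: ind_eq_cases[of n]) (auto simp: chr_nonzero power3_eq_cube)
  next
    case False
    then show ?thesis unfolding chr_def by (simp only: if_False complex_cnj_zero)
  qed
  then have "(\<lambda>n. chr 1 3 n * of_real (real n powr - s)) = (\<lambda>n. cnj (chr 1 1 n * of_real (real n powr - s)))"
    by auto
  then show ?thesis
    unfolding dirichlet_series_def
    using bounded_linear.suminf[OF bounded_linear_cnj summable_terms[OF s]] by simp
qed

lemma L_0_2_nonzero: "L 0 2 1 \<noteq> 0"
proof
  assume z: "L 0 2 1 = 0"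
  interpret nonprincipal_character "4 * p" "chr 0 2" by (rule nonprincipal_chr) auto
  define c where "c n = Re (chr 0 2 n)" for n
  have "chr 0 2 n \<in> {-1, 0, 1}" for n
  proof (cases "coprime n (4 * p)")
    case True
    then show ?thesis by (cases rule: ind_eq_cases[of n]) (simp_all only: chr_nonzero, simp_all)
  next
    case False
    then show ?thesis unfolding chr_def by (simp only: if_False) simp
  qed
  then have c: "chr 0 2 n = of_real (c n)" "c n \<in> {-1, 0, 1}" for n
    unfolding c_def by (cases "chr 0 2 n = 0"; cases "chr 0 2 n = 1"; force)+
  have mult_c: "c (m * n) = c m * c n" for m n
  proof -
    have "complex_of_real (c (m * n)) = complex_of_real (c m * c n)"
      using mult[of m n] by (simp add: c(1))
    then show ?thesis by (simp only: of_real_eq_iff)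
  qed
  have "\<bar>\<Sum>n<N. c n\<bar> \<le> real (4 * p)" for N
    using partial_sum_bound[of N] by (simp only: c(1) of_real_sum[symmetric] norm_of_real)
  moreover have "c 1 = 1" using one by (simp add: c_def)
  ultimately have "\<not> (\<lambda>N. \<Sum>n=1..N. c n / real n) \<longlonglongrightarrow> 0"
    by (intro real_character_series_nonzero[where B = "real (4 * p)"] mult_c c(2))
  moreover have "(\<lambda>N. \<Sum>n=1..N. c n / real n) \<longlonglongrightarrow> 0"
  proof -
    have "(\<lambda>N. Re (\<Sum>n<Suc N. chr 0 2 n * of_real (real n powr - 1))) \<longlonglongrightarrow> Re 0"
      using LIMSEQ_Suc[OF partial_sums_tendsto[of 1]] z by (intro tendsto_Re) simp
    moreover have "Re (\<Sum>n<Suc N. chr 0 2 n * of_real (real n powr - 1)) = (\<Sum>n=1..N. c n / real n)" for N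
      unfolding partial_sum_eq by (simp add: c(1) powr_minus_divide atLeastLessThanSuc_atLeastAtMost)
    ultimately show ?thesis by simp
  qed
  ultimately show False by blast
qed

text \<open>The terms are nonnegative, so a bound near 1 would pass to all partial sums at
  \<open>s = 1\<close>; but the arguments \<open>4 * p * k + 1\<close> alone dominate a multiple of
  the harmonic series.\<close>

lemma L_0_0_unbounded: "\<not> eventually (\<lambda>s. norm (L 0 0 s) \<le> B) (at_right 1)"
proof
  assume ev: "eventually (\<lambda>s. norm (L 0 0 s) \<le> B) (at_right 1)"
  interpret residue_character "4 * p" "chr 0 0" by (rule residue_character_chr)
  let ?c = "\<lambda>n. if coprime n (4 * p) then 1 else 0 :: real"
  have c: "chr 0 0 n = of_real (?c n)" for n by (simp add: chr_def)
  have partial: "(\<Sum>n<N. ?c n * (real n powr - s)) \<le> norm (L 0 0 s)" if s: "s > 1" for N s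
  proof -
    have sm: "summable (\<lambda>n. ?c n * (real n powr - s))"
      using summable_norm_terms[OF s] by (simp add: c norm_mult)
    have "L 0 0 s = of_real (suminf (\<lambda>n. ?c n * (real n powr - s)))"
      unfolding dirichlet_series_def c using suminf_of_real[OF sm, where 'a = complex] by simp
    moreover have "(\<Sum>n<N. ?c n * (real n powr - s)) \<le> suminf (\<lambda>n. ?c n * (real n powr - s))"
      by (rule sum_le_suminf[OF sm]) auto
    ultimately show ?thesis by simp
  qed
  have bound: "(\<Sum>n<N. ?c n * (real n powr - 1)) \<le> B" for N
  proof (rule tendsto_le[of "at_right (1::real)"])
    show "((\<lambda>s. \<Sum>n<N. ?c n * (real n powr - s)) \<longlongrightarrow> (\<Sum>n<N. ?c n * (real n powr - 1))) (at_right 1)"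
    proof (intro tendsto_sum tendsto_mult tendsto_const)
      show "((\<lambda>s. real n powr - s) \<longlongrightarrow> real n powr - 1) (at_right 1)" for n
        using tendsto_powr[OF tendsto_const tendsto_minus[OF tendsto_ident_at], of "real n" 1 "{1<..}"]
        by (cases "n = 0") (simp_all del: powr_minus_divide)
    qed
    show "eventually (\<lambda>s. (\<Sum>n<N. ?c n * (real n powr - s)) \<le> B) (at_right 1)"
      using ev eventually_at_right_less[of "1::real"]
      by (rule eventually_elim2) (blast intro: order_trans[OF partial])
  qed auto
  have K: "(\<Sum>k<K. inverse (real (Suc k))) \<le> B * real (4 * p)" for K
  proof -
    have "(\<Sum>k<K. inverse (real (Suc k)) / real (4 * p)) \<le> (\<Sum>k<K. ?c (4 * p * k + 1) * (real (4 * p * k + 1) powr - 1))"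
    proof (rule sum_mono)
      fix k
      have cp: "coprime (4 * p * k + 1) (4 * p)" 
      proof (rule coprimeI)
        fix d assume "d dvd 4 * p * k + 1" "d dvd 4 * p"
        then show "is_unit d" by (meson dvd_add_right_iff dvd_mult2)
      qed
      have "4 * p * k + 1 \<le> Suc k * (4 * p)" using p_gt_1 by (simp add: algebra_simps)
      then have "real (4 * p * k + 1) \<le> real (Suc k) * real (4 * p)" by (metis of_nat_le_iff of_nat_mult)
      then have "inverse (real (Suc k) * real (4 * p)) \<le> inverse (real (4 * p * k + 1))"
        by (rule le_imp_inverse_le) (simp add: add_pos_nonneg)
      moreover have "real (4 * p * k + 1) powr - 1 = inverse (real (4 * p * k + 1))"
        by (simp only: powr_minus powr_one[OF of_nat_0_le_iff])
      ultimately show "inverse (real (Suc k)) / real (4 * p) \<le> ?c (4 * p * k + 1) * (real (4 * p * k + 1) powr - 1)"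
        by (simp only: cp if_True mult_1_left divide_inverse inverse_mult_distrib)
    qed
    also have "\<dots> = (\<Sum>n\<in>(\<lambda>k. 4 * p * k + 1) ` {..<K}. ?c n * (real n powr - 1))"
      using p_gt_1 by (subst sum.reindex) (auto intro!: inj_onI)
    also have "\<dots> \<le> (\<Sum>n<4 * p * K + 1. ?c n * (real n powr - 1))"
      using p_gt_1 by (intro sum_mono2) auto
    also have "\<dots> \<le> B" by (rule bound)
    finally have "(\<Sum>k<K. inverse (real (Suc k))) / real (4 * p) \<le> B" unfolding sum_divide_distrib .
    then show ?thesis using p_gt_1 by (simp add: field_simps)
  qed
  have "summable (\<lambda>k. inverse (real (Suc k)))"
  proof (rule bounded_imp_summable)
    show "(\<Sum>k\<le>n. inverse (real (Suc k))) \<le> B * real (4 * p)" for n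
      using K[of "Suc n"] by (simp only: lessThan_Suc_atMost)
  qed simp
  then have "summable (\<lambda>k. inverse (real k))" by (subst (asm) summable_Suc_iff)
  then show False using not_summable_harmonic[where 'a = real] by simp
qed

theorem ex_prime_nonquartic:
  "\<exists>r. Factorial_Ring.prime r \<and> r mod 4 = 3 \<and> [int r ^ ((p - 1) div 4) = -1] (mod int p)"
proof (rule ccontr)
  assume no: "\<not> ?thesis"
  have none: "\<i> ^ ind r \<noteq> -1" if r: "Factorial_Ring.prime r" "r mod 4 = 3" for r
  proof
    assume "\<i> ^ ind r = -1"
    moreover have "r \<noteq> p" using r(2) p_mod_8 by presburger
    then have "coprime r p" using r(1) p_prime primes_coprime by blast
    ultimately show False using power_quarter_cong[of r] no r by blast
  qed
  let ?m = "real (4 * p)"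
  have bnd: "norm (L a b s) \<le> 2 * ?m" if "a < 2" "b < 4" "(a, b) \<noteq> (0, 0)" "s \<ge> 1" for a b s
    using nonprincipal_character.bounded[OF nonprincipal_chr[OF that(1-3)] that(4)] .
  \<comment> \<open>Each of the four nonprincipal factors of the second product is bounded by twice
    the modulus \<open>4 * p\<close>.\<close>
  let ?D = "(2 * ?m) * (2 * ?m) * (2 * ?m) * (2 * ?m)"
  have le: "norm (L 0 0 s) * norm (L 0 2 s) * (norm (L 1 1 s)) ^ 2 \<le> ?D"
    and ge: "norm (L 0 0 s) * norm (L 0 2 s) * (norm (L 1 1 s)) ^ 2 \<ge> 1" if s: "s > 1" for s
  proof -
    have eq: "norm (L 0 0 s * L 0 2 s * L 1 1 s * L 1 3 s) = norm (L 0 0 s) * norm (L 0 2 s) * (norm (L 1 1 s)) ^ 2"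
    proof -
      have "norm (L 1 3 s) = norm (L 1 1 s)" using s by (subst L_1_3) auto
      then show ?thesis by (simp only: norm_mult power2_eq_square mult_ac)
    qed
    have "norm (L 1 0 s * L 1 2 s * L 0 1 s * L 0 3 s) \<le> ?D"
      unfolding norm_mult using s by (intro mult_mono bnd mult_nonneg_nonneg) auto
    then show "norm (L 0 0 s) * norm (L 0 2 s) * (norm (L 1 1 s)) ^ 2 \<le> ?D"
      using L_identity(1)[OF none s] eq by simp
    show "norm (L 0 0 s) * norm (L 0 2 s) * (norm (L 1 1 s)) ^ 2 \<ge> 1"
      using L_identity(2)[OF none s] eq by simp
  qed
  have gt: "eventually (\<lambda>s::real. s > 1) (at_right 1)" by (rule eventually_at_right_less)
  show False
  proof (cases "L 1 1 1 = 0")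
    case False
    let ?c = "norm (L 0 2 1) * (norm (L 1 1 1)) ^ 2"
    have c: "?c > 0" using False L_0_2_nonzero by simp
    have "((\<lambda>s. norm (L 0 2 s) * (norm (L 1 1 s)) ^ 2) \<longlongrightarrow> ?c) (at_right 1)"
      by (intro tendsto_intros L_continuous) auto
    then have "eventually (\<lambda>s. norm (L 0 2 s) * (norm (L 1 1 s)) ^ 2 > ?c / 2) (at_right 1)"
      using c by (intro order_tendstoD) auto
    then have "eventually (\<lambda>s. norm (L 0 0 s) \<le> ?D / (?c / 2)) (at_right 1)"
      using gt
    proof (rule eventually_elim2)
      fix s :: real
      assume h: "norm (L 0 2 s) * (norm (L 1 1 s)) ^ 2 > ?c / 2" and s: "s > 1"
      have "norm (L 0 0 s) * (?c / 2) \<le> norm (L 0 0 s) * (norm (L 0 2 s) * (norm (L 1 1 s)) ^ 2)"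
        using h by (intro mult_left_mono) auto
      also have "\<dots> \<le> ?D" using le[OF s] by (simp only: mult.assoc)
      finally show "norm (L 0 0 s) \<le> ?D / (?c / 2)" using c by (subst pos_le_divide_eq) auto
    qed
    then show False using L_0_0_unbounded by blast
  next
    case True
    interpret nonprincipal_character "4 * p" "chr 1 1" by (rule nonprincipal_chr) auto
    obtain C where C: "C > 0" "\<And>s t. s \<ge> 1 \<Longrightarrow> t \<ge> 1 \<Longrightarrow> norm (L 1 1 s - L 1 1 t) \<le> C * \<bar>s - t\<bar>"
      using lipschitz by blast
    \<comment> \<open>\<open>C * (s - 1)\<close> bounds both \<open>L 1 1 s\<close> and
      \<open>L 1 3 s\<close>; against \<open>1 + 1 / (s - 1) = s / (s - 1)\<close> this double zero
      leaves one factor \<open>s - 1\<close>, which tends to 0.\<close>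
    let ?G = "\<lambda>s::real. s * (s - 1) * (2 * ?m) * C ^ 2"
    have "(?G \<longlongrightarrow> 1 * (1 - 1) * (2 * ?m) * C ^ 2) (at_right 1)"
      by (intro tendsto_intros)
    then have "eventually (\<lambda>s. ?G s < 1) (at_right 1)"
      by (intro order_tendstoD) auto
    then have "eventually (\<lambda>s::real. False) (at_right 1)"
      using gt
    proof (rule eventually_elim2)
      fix s :: real
      assume h: "?G s < 1" and s: "s > 1"
      have "norm (L 0 0 s) \<le> 1 + 1 / (s - 1)"
        by (rule residue_character.dirichlet_series_le_zeta[OF residue_character_chr s])
      moreover have "norm (L 0 2 s) \<le> 2 * ?m" using s by (intro bnd) auto
      moreover have "(norm (L 1 1 s)) ^ 2 \<le> (C * (s - 1)) ^ 2"
        using C(2)[of s 1] s True by (intro power_mono) auto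
      ultimately have "norm (L 0 0 s) * norm (L 0 2 s) * (norm (L 1 1 s)) ^ 2 \<le> (1 + 1 / (s - 1)) * (2 * ?m) * (C * (s - 1)) ^ 2"
        using s by (intro mult_mono mult_nonneg_nonneg) auto
      also have "\<dots> = ?G s"
      proof -
        have "(1 + 1 / (s - 1)) * (s - 1) = s" using s by (simp add: field_simps)
        then have "(1 + 1 / (s - 1)) * (s - 1) * ((2 * ?m) * C ^ 2 * (s - 1)) = s * ((2 * ?m) * C ^ 2 * (s - 1))" by simp
        then show ?thesis by (simp only: power2_eq_square mult_ac)
      qed
      finally show False using ge[OF s] h by linarith
    qed
    then show False by simp
  qed
qed

end

section \<open>Integrality via finitely generated modules\<close>

inductive_set zspan :: "'a::ring_1 set \<Rightarrow> 'a set" for B where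
  zero: "0 \<in> zspan B"
| base: "b \<in> B \<Longrightarrow> b \<in> zspan B"
| diff: "x \<in> zspan B \<Longrightarrow> y \<in> zspan B \<Longrightarrow> x - y \<in> zspan B"

lemma zspan_uminus: "x \<in> zspan B \<Longrightarrow> - x \<in> zspan B"
  using zspan.diff[OF zspan.zero, of x B] by simp

lemma zspan_add: "x \<in> zspan B \<Longrightarrow> y \<in> zspan B \<Longrightarrow> x + y \<in> zspan B"
  using zspan.diff[OF _ zspan_uminus, of x B y] by simp

lemma zspan_sum: "(\<And>i. i \<in> S \<Longrightarrow> f i \<in> zspan B) \<Longrightarrow> sum f S \<in> zspan B"
  by (induction S rule: infinite_finite_induct) (auto intro: zspan.zero zspan_add)

lemma zspan_of_int_mult: "x \<in> zspan B \<Longrightarrow> of_int k * x \<in> zspan B"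
proof (induction k rule: int_induct[where k = 0])
  case (step1 i)
  then show ?case by (simp add: algebra_simps zspan_add)
next
  case (step2 i)
  then show ?case by (simp add: algebra_simps zspan.diff)
qed (simp add: zspan.zero)

lemma zspan_mult_closed:
  assumes "\<And>b. b \<in> B \<Longrightarrow> x * b \<in> zspan C" and "y \<in> zspan B"
  shows "x * y \<in> zspan C"
  using assms(2) by induction (auto simp: right_diff_distrib intro: assms(1) zspan.zero zspan.diff)

lemma zspan_finite:
  assumes "finite B" "x \<in> zspan B"
  shows "\<exists>c. x = (\<Sum>b\<in>B. of_int (c b) * b)"
  using assms(2)
proof induction
  case zero
  then show ?case by (intro exI[of _ "\<lambda>_. 0"]) simp
next
  case (base b)
  have "(\<Sum>b'\<in>B. of_int (if b' = b then 1 else 0) * b') = (\<Sum>b'\<in>B. if b' = b then b' else 0)"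
    by (intro sum.cong) auto
  then show ?case using base assms(1) by (intro exI[of _ "\<lambda>b'. if b' = b then 1 else 0"]) simp
next
  case (diff x y)
  then obtain c d where "x = (\<Sum>b\<in>B. of_int (c b) * b)" "y = (\<Sum>b\<in>B. of_int (d b) * b)" by blast
  then show ?case
    by (intro exI[of _ "\<lambda>b. c b - d b"]) (simp add: sum_subtractf left_diff_distrib)
qed

text \<open>A version of Nakayama's lemma, by eliminating one generator at a time.\<close>

lemma one_mem_if_span_eq:
  fixes E B :: "'a::field set"
  assumes E: "0 \<in> E" "\<And>x y. x \<in> E \<Longrightarrow> y \<in> E \<Longrightarrow> x - y \<in> E" "\<And>x y. x \<in> E \<Longrightarrow> y \<in> E \<Longrightarrow> x * y \<in> E"
    and B: "finite B" "\<not> B \<subseteq> {0}" "\<And>b. b \<in> B \<Longrightarrow> b = (\<Sum>b'\<in>B. e b b' * b')"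
    and e: "\<And>b b'. b \<in> B \<Longrightarrow> b' \<in> B \<Longrightarrow> e b b' \<in> E"
  shows "1 \<in> E"
  using B e
proof (induction B arbitrary: e rule: finite_induct)
  case empty
  then show ?case by simp
next
  case (insert a B)
  have add: "x + y \<in> E" if "x \<in> E" "y \<in> E" for x y
    using E(2)[OF that(1) E(2)[OF E(1) that(2)]] by simp
  have a: "a = e a a * a + (\<Sum>b\<in>B. e a b * b)" using insert by simp
  show ?case
  proof (cases "B \<subseteq> {0}")
    case True
    then have "(\<Sum>b\<in>B. e a b * b) = 0" by (intro sum.neutral) auto
    then have "a = e a a * a" using a by simp
    moreover have "a \<noteq> 0" using True insert.prems by auto
    ultimately have "e a a = 1" by simp
    then show ?thesis using insert.prems(3)[of a a] by simp
  next
    case False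
    \<comment> \<open>The relation for \<open>b\<close> is multiplied by \<open>1 - e a a\<close>,
      and \<open>(1 - e a a) * a\<close> is replaced by its expansion in \<open>B\<close>. Moving
      \<open>e a a * b\<close> to the right-hand side keeps all coefficients in \<open>E\<close>,
      which is not yet known to contain 1.\<close>
    let ?e = "\<lambda>b b'. e b b' - e a a * e b b' + e b a * e a b' + (if b = b' then e a a else 0)"
    show ?thesis
    proof (rule insert.IH[OF False])
      fix b assume b: "b \<in> B"
      have b_eq: "b = e b a * a + (\<Sum>b'\<in>B. e b b' * b')" using insert b by simp
      have "(\<Sum>b'\<in>B. ?e b b' * b') = (\<Sum>b'\<in>B. e b b' * b') - e a a * (\<Sum>b'\<in>B. e b b' * b')
          + e b a * (\<Sum>b'\<in>B. e a b' * b') + (\<Sum>b'\<in>B. if b = b' then e a a * b' else 0)"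
        by (simp add: sum.distrib[symmetric] sum_subtractf[symmetric] sum_distrib_left algebra_simps if_distrib cong: if_cong)
           (intro sum.cong, auto simp: algebra_simps)
      also have "(\<Sum>b'\<in>B. if b = b' then e a a * b' else 0) = e a a * b" using b insert.hyps by simp
      also have "(\<Sum>b'\<in>B. e b b' * b') = b - e b a * a" using b_eq by (simp add: algebra_simps)
      also have "(\<Sum>b'\<in>B. e a b' * b') = a - e a a * a" using a by (simp add: algebra_simps)
      finally show "b = (\<Sum>b'\<in>B. ?e b b' * b')" by (simp add: algebra_simps)
    next
      fix b b' assume "b \<in> B" "b' \<in> B"
      then show "?e b b' \<in> E" using insert.prems(3) by (auto intro!: add E)
    qed
  qed
qed

text \<open>A substitute for the determinant trick. For \<open>y = inverse x\<close> the set
  \<open>E = y Z[y]\<close> is closed under differences and products, and stability expresses each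
  generator through the others with coefficients in \<open>E\<close>. Hence
  \<open>1 = y * q(y)\<close> for an integral polynomial \<open>q\<close>, which becomes a monic
  equation for \<open>x\<close>.\<close>

lemma algebraic_int_if_stable:
  fixes x :: "'a::field_char_0"
  assumes B: "finite B" "\<not> B \<subseteq> {0}" "\<And>b. b \<in> B \<Longrightarrow> x * b \<in> zspan B"
  shows "algebraic_int x"
proof (cases "x = 0")
  case False
  let ?y = "inverse x"
  define E where "E = {?y * poly q ?y | q. \<forall>i. coeff q i \<in> \<int>}"
  have "1 \<in> E"
  proof -
    have "\<exists>c. \<forall>b\<in>B. x * b = (\<Sum>b'\<in>B. of_int (c b b') * b')"
      using zspan_finite[OF B(1) B(3)] by metis
    then obtain c where c: "\<And>b. b \<in> B \<Longrightarrow> x * b = (\<Sum>b'\<in>B. of_int (c b b') * b')" by blast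
    show ?thesis
    proof (rule one_mem_if_span_eq[where B = B and e = "\<lambda>b b'. ?y * of_int (c b b')"])
      show "0 \<in> E" unfolding E_def by (auto intro!: exI[of _ 0])
      show "u - v \<in> E" if uv: "u \<in> E" "v \<in> E" for u v
      proof -
        obtain q r where "u = ?y * poly q ?y" "v = ?y * poly r ?y" "\<forall>i. coeff q i \<in> \<int>" "\<forall>i. coeff r i \<in> \<int>"
          using uv unfolding E_def by blast
        then show ?thesis unfolding E_def by (auto intro!: exI[of _ "q - r"] simp: algebra_simps)
      qed
      show "u * v \<in> E" if uv: "u \<in> E" "v \<in> E" for u v
      proof -
        obtain q r where "u = ?y * poly q ?y" "v = ?y * poly r ?y" "\<forall>i. coeff q i \<in> \<int>" "\<forall>i. coeff r i \<in> \<int>"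
          using uv unfolding E_def by blast
        then show ?thesis unfolding E_def
          by (auto intro!: exI[of _ "pCons 0 (q * r)"] Ints_sum simp: coeff_pCons coeff_mult split: nat.split)
      qed
      show "b = (\<Sum>b'\<in>B. ?y * of_int (c b b') * b')" if "b \<in> B" for b
      proof -
        have "(\<Sum>b'\<in>B. ?y * of_int (c b b') * b') = ?y * (x * b)"
          unfolding c[OF that] by (simp add: sum_distrib_left mult.assoc)
        then show ?thesis using False by simp
      qed
      show "?y * of_int (c b b') \<in> E" for b b'
        unfolding E_def by (auto intro!: exI[of _ "[:of_int (c b b'):]"] simp: coeff_pCons split: nat.split)
    qed (use B in auto)
  qed
  then obtain q where q: "1 = ?y * poly q ?y" "\<forall>i. coeff q i \<in> \<int>" unfolding E_def by blast
  \<comment> \<open>The constant coefficient 1 becomes the leading coefficient of the reflected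
    polynomial.\<close>
  define r where "r = pCons 1 (- q)"
  have "poly r ?y = 0" using q(1) by (simp add: r_def)
  moreover have r0: "coeff r 0 = 1" by (simp add: r_def)
  then have "lead_coeff (reflect_poly r) = 1" by (simp add: coeff_reflect_poly)
  moreover have "\<forall>i. coeff (reflect_poly r) i \<in> \<int>"
    using q(2) by (auto simp: coeff_reflect_poly r_def coeff_pCons split: nat.split)
  moreover have "poly (reflect_poly r) x = 0"
    using False poly_reflect_poly_nz[of x r] \<open>poly r ?y = 0\<close> by simp
  ultimately show ?thesis unfolding algebraic_int.simps by blast
qed simp

lemma algebraic_int_power_zspan:
  fixes x :: "'a::field_char_0"
  assumes "algebraic_int x"
  obtains n where "n > 0" "x ^ n \<in> zspan ((\<lambda>i. x ^ i) ` {..<n})"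
proof -
  obtain f where f: "\<forall>i. coeff f i \<in> \<int>" "lead_coeff f = 1" "poly f x = 0"
    using assms unfolding algebraic_int.simps by blast
  have n: "degree f > 0"
  proof (rule Nat.gr0I)
    assume "degree f = 0"
    then obtain a where "f = [:a:]" by (rule degree_eq_zeroE)
    then show False using f by simp
  qed
  have "0 = (\<Sum>i<degree f. coeff f i * x ^ i) + x ^ degree f"
    using f(2,3) by (simp add: poly_altdef lessThan_Suc_atMost[symmetric])
  then have "x ^ degree f = - (\<Sum>i<degree f. coeff f i * x ^ i)" by (simp add: eq_neg_iff_add_eq_0 add.commute)
  also have "\<dots> \<in> zspan ((\<lambda>i. x ^ i) ` {..<degree f})"
  proof (intro zspan_uminus zspan_sum)
    fix i assume i: "i \<in> {..<degree f}"
    obtain k where k: "coeff f i = of_int k" using f(1) Ints_cases by metis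
    show "coeff f i * x ^ i \<in> zspan ((\<lambda>i. x ^ i) ` {..<degree f})"
      unfolding k using i by (intro zspan_of_int_mult zspan.base) auto
  qed
  finally show thesis using that n by blast
qed

text \<open>The monomials \<open>x ^ i * y ^ j\<close> with exponents below the degrees of two monic
  equations span a group stable under \<open>x\<close> and \<open>y\<close>, hence also under their
  sum and product.\<close>

lemma algebraic_int_common_module:
  fixes x y :: "'a::field_char_0"
  assumes "algebraic_int x" "algebraic_int y"
  obtains B where "finite B" "\<not> B \<subseteq> {0}" "\<And>b. b \<in> zspan B \<Longrightarrow> x * b \<in> zspan B" "\<And>b. b \<in> zspan B \<Longrightarrow> y * b \<in> zspan B"
proof -
  obtain m where m: "m > 0" "x ^ m \<in> zspan ((\<lambda>i. x ^ i) ` {..<m})" by (rule algebraic_int_power_zspan[OF assms(1)])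
  obtain n where n: "n > 0" "y ^ n \<in> zspan ((\<lambda>i. y ^ i) ` {..<n})" by (rule algebraic_int_power_zspan[OF assms(2)])
  define B where "B = (\<lambda>(i, j). x ^ i * y ^ j) ` ({..<m} \<times> {..<n})"
  have mem: "x ^ i * y ^ j \<in> B" if "i < m" "j < n" for i j using that by (auto simp: B_def)
  have "1 \<in> B" using mem[of 0 0] m n by simp
  have "x * b \<in> zspan B" if bB: "b \<in> B" for b
  proof -
    obtain i j where b: "b = x ^ i * y ^ j" "i < m" "j < n" using bB by (auto simp: B_def)
    show ?thesis
    proof (cases "Suc i < m")
      case True
      then show ?thesis using zspan.base[OF mem[of "Suc i" j]] b by (simp add: mult.assoc)
    next
      case False
      then have "Suc i = m" using b by simp
      have "y ^ j * x ^ m \<in> zspan B"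
        by (rule zspan_mult_closed[OF _ m(2)]) (use b mem in \<open>auto intro!: zspan.base simp: mult.commute\<close>)
      then show ?thesis using \<open>Suc i = m\<close> b by (auto simp: mult_ac)
    qed
  qed
  then have 1: "x * b \<in> zspan B" if "b \<in> zspan B" for b using that by (rule zspan_mult_closed)
  have "y * b \<in> zspan B" if bB: "b \<in> B" for b
  proof -
    obtain i j where b: "b = x ^ i * y ^ j" "i < m" "j < n" using bB by (auto simp: B_def)
    show ?thesis
    proof (cases "Suc j < n")
      case True
      then show ?thesis using zspan.base[OF mem[of i "Suc j"]] b by (simp add: mult_ac)
    next
      case False
      then have "Suc j = n" using b by simp
      have "x ^ i * y ^ n \<in> zspan B"
        by (rule zspan_mult_closed[OF _ n(2)]) (use b mem in \<open>auto intro!: zspan.base\<close>)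
      then show ?thesis using \<open>Suc j = n\<close> b by (auto simp: mult_ac)
    qed
  qed
  then have 2: "y * b \<in> zspan B" if "b \<in> zspan B" for b using that by (rule zspan_mult_closed)
  show thesis
    by (rule that[of B]) (use 1 2 \<open>1 \<in> B\<close> in \<open>auto simp: B_def\<close>)
qed

lemma algebraic_int_add:
  fixes x y :: "'a::field_char_0"
  assumes "algebraic_int x" "algebraic_int y"
  shows "algebraic_int (x + y)"
proof -
  obtain B where B: "finite B" "\<not> B \<subseteq> {0}" "\<And>b. b \<in> zspan B \<Longrightarrow> x * b \<in> zspan B" "\<And>b. b \<in> zspan B \<Longrightarrow> y * b \<in> zspan B"
    using algebraic_int_common_module[OF assms] by blast
  show ?thesis
    by (rule algebraic_int_if_stable[OF B(1,2)]) (simp add: distrib_right zspan_add B zspan.base)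
qed

lemma algebraic_int_mult:
  fixes x y :: "'a::field_char_0"
  assumes "algebraic_int x" "algebraic_int y"
  shows "algebraic_int (x * y)"
proof -
  obtain B where B: "finite B" "\<not> B \<subseteq> {0}" "\<And>b. b \<in> zspan B \<Longrightarrow> x * b \<in> zspan B" "\<And>b. b \<in> zspan B \<Longrightarrow> y * b \<in> zspan B"
    using algebraic_int_common_module[OF assms] by blast
  show ?thesis
    by (rule algebraic_int_if_stable[OF B(1,2)]) (simp add: mult.assoc B zspan.base)
qed

section \<open>The ideal class group\<close>

abbreviation iprod :: "'a::field_char_0 set \<Rightarrow> 'a set \<Rightarrow> 'a set" (infixl "\<odot>" 70) where
  "I \<odot> J \<equiv> ideal_prod ring_of_type_algebra I J"

lemma iprod_mult: "x \<in> I \<Longrightarrow> y \<in> J \<Longrightarrow> x * y \<in> I \<odot> J"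
  using ideal_prod.prod[of x I y J ring_of_type_algebra] by (simp add: ring_of_type_algebra_def)

lemma iprod_add: "x \<in> I \<odot> J \<Longrightarrow> y \<in> I \<odot> J \<Longrightarrow> x + y \<in> I \<odot> J"
  using ideal_prod.sum[of x ring_of_type_algebra I J y] by (simp add: ring_of_type_algebra_def)

lemma iprod_induct [consumes 1, case_names mult add]:
  assumes "x \<in> I \<odot> J"
    and "\<And>a b. a \<in> I \<Longrightarrow> b \<in> J \<Longrightarrow> P (a * b)"
    and "\<And>a b. a \<in> I \<odot> J \<Longrightarrow> b \<in> I \<odot> J \<Longrightarrow> P a \<Longrightarrow> P b \<Longrightarrow> P (a + b)"
  shows "P x"
  using assms(1) by (induction rule: ideal_prod.induct) (use assms(2,3) in \<open>auto simp: ring_of_type_algebra_def\<close>)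

lemma iprod_commute: "I \<odot> J = J \<odot> (I :: 'a::field_char_0 set)"
proof -
  have "I \<odot> J \<subseteq> J \<odot> I" for I J :: "'a set"
  proof
    fix x assume "x \<in> I \<odot> J"
    then show "x \<in> J \<odot> I"
    proof (induction rule: iprod_induct)
      case (mult a b)
      then show ?case using iprod_mult[of b J a I] by (simp add: mult.commute)
    qed (rule iprod_add)
  qed
  then show ?thesis by blast
qed

lemma iprod_assoc: "(I \<odot> J) \<odot> L = I \<odot> (J \<odot> (L :: 'a::field_char_0 set))"
proof
  show "(I \<odot> J) \<odot> L \<subseteq> I \<odot> (J \<odot> L)"
  proof
    fix x assume "x \<in> (I \<odot> J) \<odot> L"
    then show "x \<in> I \<odot> (J \<odot> L)"
    proof (induction rule: iprod_induct)
      case (mult a b)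
      from mult(1) show ?case
        by (induction rule: iprod_induct)
           (auto simp: mult.assoc distrib_right intro!: iprod_mult iprod_add mult(2))
    qed (rule iprod_add)
  qed
  show "I \<odot> (J \<odot> L) \<subseteq> (I \<odot> J) \<odot> L"
  proof
    fix x assume "x \<in> I \<odot> (J \<odot> L)"
    then show "x \<in> (I \<odot> J) \<odot> L"
    proof (induction rule: iprod_induct)
      case (mult a b)
      from mult(2) show ?case
        by (induction rule: iprod_induct)
           (auto simp: mult.assoc[symmetric] distrib_left intro!: iprod_mult iprod_add mult(1))
    qed (rule iprod_add)
  qed
qed

text \<open>Beyond being a subfield, \<open>K\<close> enters the invertibility of ideals through
  three facts: denominators exist, ideals are finitely generated abelian groups, and a finite family
  of sets represents all ideals up to scaling. Prime ideals do not occur.\<close>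

locale ideal_theory =
  fixes K :: "'a::field_char_0 set"
  assumes K_1: "1 \<in> K"
    and K_diff: "x \<in> K \<Longrightarrow> y \<in> K \<Longrightarrow> x - y \<in> K"
    and K_mult: "x \<in> K \<Longrightarrow> y \<in> K \<Longrightarrow> x * y \<in> K"
    and K_inverse: "x \<in> K \<Longrightarrow> inverse x \<in> K"
    and denominator: "x \<in> K \<Longrightarrow> \<exists>d\<in>ring_of_integers K. d \<noteq> 0 \<and> d * x \<in> ring_of_integers K"
    and finitely_generated: "fractional_ideal K I \<Longrightarrow> \<exists>B. finite B \<and> B \<subseteq> I \<and> I \<subseteq> zspan B"
    and finite_classes: "\<exists>F. finite F \<and> (\<forall>I. fractional_ideal K I \<longrightarrow> (\<exists>a\<in>K. a \<noteq> 0 \<and> (\<lambda>x. a * x) ` I \<in> F))"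
begin

abbreviation \<O> :: "'a set" where "\<O> \<equiv> ring_of_integers K"

lemma K_0: "0 \<in> K" using K_diff[OF K_1 K_1] by simp

lemma K_add: "x \<in> K \<Longrightarrow> y \<in> K \<Longrightarrow> x + y \<in> K"
  using K_diff[OF _ K_diff[OF K_0], of x y] by simp

lemma O_1: "1 \<in> \<O>" and O_0: "0 \<in> \<O>"
  using K_1 K_0 by (auto simp: ring_of_integers_def)

lemma O_add: "x \<in> \<O> \<Longrightarrow> y \<in> \<O> \<Longrightarrow> x + y \<in> \<O>"
  by (auto simp: ring_of_integers_def K_add algebraic_int_add)

lemma O_uminus: "x \<in> \<O> \<Longrightarrow> - x \<in> \<O>"
  using K_diff[OF K_0, of x] by (auto simp: ring_of_integers_def)

lemma O_mult: "x \<in> \<O> \<Longrightarrow> y \<in> \<O> \<Longrightarrow> x * y \<in> \<O>"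
  by (auto simp: ring_of_integers_def K_mult algebraic_int_mult)

lemma fractional_idealD:
  assumes "fractional_ideal K I"
  shows "I \<subseteq> K" "0 \<in> I" "\<exists>x\<in>I. x \<noteq> 0" "\<And>x y. x \<in> I \<Longrightarrow> y \<in> I \<Longrightarrow> x + y \<in> I"
    "\<And>a x. a \<in> \<O> \<Longrightarrow> x \<in> I \<Longrightarrow> a * x \<in> I"
    "\<exists>d\<in>\<O>. d \<noteq> 0 \<and> (\<forall>x\<in>I. d * x \<in> \<O>)"
    "\<And>x y. x \<in> I \<Longrightarrow> y \<in> I \<Longrightarrow> x - y \<in> I"
proof -
  show "I \<subseteq> K" "0 \<in> I" and add: "\<And>x y. x \<in> I \<Longrightarrow> y \<in> I \<Longrightarrow> x + y \<in> I"
    and mult: "\<And>a x. a \<in> \<O> \<Longrightarrow> x \<in> I \<Longrightarrow> a * x \<in> I"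
    and "\<exists>d\<in>\<O>. d \<noteq> 0 \<and> (\<forall>x\<in>I. d * x \<in> \<O>)"
    using assms by (auto simp: fractional_ideal_def)
  show "\<exists>x\<in>I. x \<noteq> 0" using assms by (auto simp: fractional_ideal_def)
  fix x y assume "x \<in> I" "y \<in> I"
  then show "x - y \<in> I" using add[of x "- 1 * y"] mult[OF O_uminus[OF O_1], of y] by simp
qed

lemma fractional_idealI:
  assumes "I \<subseteq> K" "0 \<in> I" "x \<in> I" "x \<noteq> 0" "\<And>x y. x \<in> I \<Longrightarrow> y \<in> I \<Longrightarrow> x + y \<in> I"
    "\<And>a x. a \<in> \<O> \<Longrightarrow> x \<in> I \<Longrightarrow> a * x \<in> I" "d \<in> \<O>" "d \<noteq> 0" "\<And>x. x \<in> I \<Longrightarrow> d * x \<in> \<O>"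
  shows "fractional_ideal K I"
  unfolding fractional_ideal_def using assms by auto

lemma fractional_ideal_O: "fractional_ideal K \<O>"
  by (rule fractional_idealI[of _ 1 1]) (auto simp: O_0 O_1 O_add O_mult, simp add: ring_of_integers_def)

lemma fractional_ideal_scale:
  assumes I: "fractional_ideal K I" and c: "c \<in> K" "c \<noteq> 0"
  shows "fractional_ideal K ((\<lambda>x. c * x) ` I)"
proof -
  note D = fractional_idealD[OF I]
  obtain x where x: "x \<in> I" "x \<noteq> 0" using D(3) by blast
  obtain d where d: "d \<in> \<O>" "d \<noteq> 0" "\<And>x. x \<in> I \<Longrightarrow> d * x \<in> \<O>" using D(6) by blast
  obtain e where e: "e \<in> \<O>" "e \<noteq> 0" "e * c \<in> \<O>" using denominator[OF c(1)] by blast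
  show ?thesis
  proof (rule fractional_idealI[of _ "c * x" "e * d"])
    show "(\<lambda>x. c * x) ` I \<subseteq> K" using D(1) c K_mult by auto
    show "y + z \<in> (\<lambda>x. c * x) ` I" if "y \<in> (\<lambda>x. c * x) ` I" "z \<in> (\<lambda>x. c * x) ` I" for y z
      using that by (auto simp: distrib_left[symmetric] D(4))
    show "a * y \<in> (\<lambda>x. c * x) ` I" if "a \<in> \<O>" "y \<in> (\<lambda>x. c * x) ` I" for a y
      using that D(5) by (auto simp: image_iff mult.left_commute)
    show "e * d * y \<in> \<O>" if y: "y \<in> (\<lambda>x. c * x) ` I" for y
    proof -
      obtain x where "x \<in> I" "y = c * x" using y by blast
      then have "e * d * y = (e * c) * (d * x)" by (simp add: mult_ac)
      then show ?thesis using O_mult[OF e(3) d(3)[OF \<open>x \<in> I\<close>]] by (simp only:)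
    qed
  qed (use x c d e D(2) O_mult in auto)
qed

lemma fractional_ideal_prod:
  assumes I: "fractional_ideal K I" and J: "fractional_ideal K J"
  shows "fractional_ideal K (I \<odot> J)"
proof -
  note DI = fractional_idealD[OF I] note DJ = fractional_idealD[OF J]
  obtain x where x: "x \<in> I" "x \<noteq> 0" using DI(3) by blast
  obtain y where y: "y \<in> J" "y \<noteq> 0" using DJ(3) by blast
  obtain d where d: "d \<in> \<O>" "d \<noteq> 0" "\<And>x. x \<in> I \<Longrightarrow> d * x \<in> \<O>" using DI(6) by blast
  obtain e where e: "e \<in> \<O>" "e \<noteq> 0" "\<And>x. x \<in> J \<Longrightarrow> e * x \<in> \<O>" using DJ(6) by blast
  show ?thesis
  proof (rule fractional_idealI[of _ "x * y" "d * e"])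
    show "I \<odot> J \<subseteq> K"
    proof
      fix z assume "z \<in> I \<odot> J"
      then show "z \<in> K" by (induction rule: iprod_induct) (use DI(1) DJ(1) in \<open>auto intro: K_add K_mult\<close>)
    qed
    show "0 \<in> I \<odot> J" using iprod_mult[OF DI(2) DJ(2)] by simp
    show "a * z \<in> I \<odot> J" if a: "a \<in> \<O>" and z: "z \<in> I \<odot> J" for a z
      using z
    proof (induction rule: iprod_induct)
      case (mult u v)
      then show ?case using iprod_mult[OF DI(5)[OF a mult(1)] mult(2)] by (simp add: mult.assoc)
    qed (simp add: distrib_left iprod_add)
    show "d * e * z \<in> \<O>" if z: "z \<in> I \<odot> J" for z
      using z
    proof (induction rule: iprod_induct)
      case (mult u v)
      then show ?case using O_mult[OF d(3)[OF mult(1)] e(3)[OF mult(2)]] by (simp add: mult_ac)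
    qed (simp add: distrib_left O_add)
  qed (use x y d e in \<open>auto intro: iprod_mult iprod_add O_mult\<close>)
qed

lemma O_iprod:
  assumes I: "fractional_ideal K I"
  shows "\<O> \<odot> I = I"
proof
  note D = fractional_idealD[OF I]
  show "\<O> \<odot> I \<subseteq> I"
  proof
    fix z assume "z \<in> \<O> \<odot> I"
    then show "z \<in> I" by (induction rule: iprod_induct) (auto intro: D)
  qed
  show "I \<subseteq> \<O> \<odot> I" using iprod_mult[OF O_1, of _ I] by force
qed

lemma scale_iprod: "((\<lambda>x. c * x) ` I) \<odot> J = (\<lambda>x. c * x) ` (I \<odot> J)"
proof
  show "((\<lambda>x. c * x) ` I) \<odot> J \<subseteq> (\<lambda>x. c * x) ` (I \<odot> J)"
  proof
    fix z assume "z \<in> ((\<lambda>x. c * x) ` I) \<odot> J"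
    then show "z \<in> (\<lambda>x. c * x) ` (I \<odot> J)"
    proof (induction rule: iprod_induct)
      case (mult a b)
      then obtain a' where "a' \<in> I" "a = c * a'" by blast
      then show ?case using iprod_mult[of a' I b J] mult(2) by (auto simp: mult.assoc)
    next
      case (add a b)
      then obtain a' b' where "a' \<in> I \<odot> J" "a = c * a'" "b' \<in> I \<odot> J" "b = c * b'" by blast
      then show ?case using iprod_add[of a' I J b'] by (auto simp: distrib_left[symmetric])
    qed
  qed
  show "(\<lambda>x. c * x) ` (I \<odot> J) \<subseteq> ((\<lambda>x. c * x) ` I) \<odot> J"
  proof
    fix z assume "z \<in> (\<lambda>x. c * x) ` (I \<odot> J)"
    then obtain w where w: "w \<in> I \<odot> J" "z = c * w" by blast
    from w(1) have "c * w \<in> ((\<lambda>x. c * x) ` I) \<odot> J"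
    proof (induction rule: iprod_induct)
      case (mult a b)
      then show ?case using iprod_mult[OF imageI[OF mult(1), of "\<lambda>x. c * x"] mult(2)] by (simp add: mult.assoc)
    qed (simp add: distrib_left iprod_add)
    then show "z \<in> ((\<lambda>x. c * x) ` I) \<odot> J" using w(2) by simp
  qed
qed

text \<open>The shape required by the Nakayama argument: coefficients in \<open>I\<close>,
  generators taken from a generating set of \<open>J\<close> as an abelian group.\<close>

lemma iprod_generators:
  assumes "finite B" "J \<subseteq> zspan B" "fractional_ideal K I" "x \<in> I \<odot> J"
  shows "\<exists>e. (\<forall>b. e b \<in> I) \<and> x = (\<Sum>b\<in>B. e b * b)"
  using assms(4)
proof (induction rule: iprod_induct)
  case (mult a y)
  obtain c where c: "y = (\<Sum>b\<in>B. of_int (c b) * b)" using zspan_finite assms mult by blast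
  have "a * of_int k \<in> I" for k
  proof -
    have "of_int k \<in> zspan {1 :: 'a}" using zspan_of_int_mult[OF zspan.base, of 1 "{1 :: 'a}" k] by simp
    then have "of_int k * a \<in> zspan {a}"
      using zspan_mult_closed[of "{1}" a "{a}" "of_int k"] zspan.base[of a "{a}"] by (simp add: mult.commute)
    moreover have "z \<in> I" if "z \<in> zspan {a}" for z
      using that by (induction rule: zspan.induct) (use fractional_idealD[OF assms(3)] mult(1) in auto)
    ultimately show ?thesis by (simp add: mult.commute)
  qed
  then show ?case
    by (intro exI[of _ "\<lambda>b. a * of_int (c b)"]) (simp add: c sum_distrib_left mult.assoc)
next
  case (add x y)
  then obtain e f where "\<forall>b. e b \<in> I" "x = (\<Sum>b\<in>B. e b * b)" "\<forall>b. f b \<in> I" "y = (\<Sum>b\<in>B. f b * b)" by blast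
  then show ?case
    by (intro exI[of _ "\<lambda>b. e b + f b"]) (auto simp: sum.distrib distrib_right fractional_idealD(4)[OF assms(3)])
qed

text \<open>Cancellation of \<open>B\<close> before any inverse is available. Elements of
  \<open>A / c\<close> map the finitely generated \<open>B\<close> into itself, so they are
  integral; hence \<open>A / c\<close> is closed under products, and since it carries
  \<open>B\<close> onto \<open>B\<close>, Nakayama's lemma puts 1 into it.\<close>

lemma eq_principal_if_iprod_eq_scale:
  assumes A: "fractional_ideal K A" and B: "fractional_ideal K B" and c: "c \<in> K" "c \<noteq> 0"
    and eq: "A \<odot> B = (\<lambda>x. c * x) ` B"
  shows "A = (\<lambda>x. c * x) ` \<O>"
proof -
  note DA = fractional_idealD[OF A] note DB = fractional_idealD[OF B]
  obtain G where G: "finite G" "G \<subseteq> B" "B \<subseteq> zspan G" using finitely_generated[OF B] by blast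
  have G0: "\<not> G \<subseteq> {0}"
  proof
    assume zero: "G \<subseteq> {0}"
    have "x = 0" if "x \<in> zspan G" for x using that by (induction rule: zspan.induct) (use zero in auto)
    then show False using G DB(3) by blast
  qed
  have sub: "x / c \<in> \<O>" if x: "x \<in> A" for x
  proof -
    have "algebraic_int (x / c)"
    proof (rule algebraic_int_if_stable[OF G(1) G0])
      fix b assume b: "b \<in> G"
      have "x * b \<in> (\<lambda>x. c * x) ` B" using iprod_mult[OF x, of b B] b G eq by auto
      then show "x / c * b \<in> zspan G" using c G(3) by auto
    qed
    moreover have "x / c \<in> K" using x DA(1) c K_mult K_inverse by (auto simp: divide_inverse)
    ultimately show ?thesis by (simp add: ring_of_integers_def)
  qed
  have "1 \<in> {x / c | x. x \<in> A}"
  proof -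
    have "\<exists>e. (\<forall>b'. e b' \<in> A) \<and> c * b = (\<Sum>b'\<in>G. e b' * b')" if "b \<in> G" for b
      by (rule iprod_generators[OF G(1,3) A]) (use that eq G in auto)
    then obtain e where e: "\<And>b b'. b \<in> G \<Longrightarrow> e b b' \<in> A" "\<And>b. b \<in> G \<Longrightarrow> c * b = (\<Sum>b'\<in>G. e b b' * b')"
      by metis
    show ?thesis
    proof (rule one_mem_if_span_eq[OF _ _ _ G(1) G0, where e = "\<lambda>b b'. e b b' / c"])
      show "0 \<in> {x / c | x. x \<in> A}" using DA(2) by force
      show "u - v \<in> {x / c | x. x \<in> A}" if "u \<in> {x / c | x. x \<in> A}" "v \<in> {x / c | x. x \<in> A}" for u v
        using that DA(7) by (auto simp: diff_divide_distrib[symmetric])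
      show "u * v \<in> {x / c | x. x \<in> A}" if uv: "u \<in> {x / c | x. x \<in> A}" "v \<in> {x / c | x. x \<in> A}" for u v
      proof -
        obtain x y where "u = x / c" "v = y / c" "x \<in> A" "y \<in> A" using uv by blast
        then have "u * v = ((x / c) * y) / c" "(x / c) * y \<in> A" using DA(5)[OF sub] by auto
        then show ?thesis by blast
      qed
      show "b = (\<Sum>b'\<in>G. e b b' / c * b')" if "b \<in> G" for b
      proof -
        have "(\<Sum>b'\<in>G. e b b' / c * b') = (c * b) / c" unfolding e(2)[OF that] by (simp add: sum_divide_distrib)
        then show ?thesis using c by simp
      qed
      show "e b b' / c \<in> {x / c | x. x \<in> A}" if "b \<in> G" for b b' using e(1)[OF that] by blast
    qed
  qed
  then have "c \<in> A" using c by auto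
  show ?thesis
  proof
    show "A \<subseteq> (\<lambda>x. c * x) ` \<O>"
    proof
      fix x assume "x \<in> A"
      then show "x \<in> (\<lambda>x. c * x) ` \<O>" using sub[of x] c by (intro image_eqI[of _ _ "x / c"]) auto
    qed
    show "(\<lambda>x. c * x) ` \<O> \<subseteq> A" using DA(5)[OF _ \<open>c \<in> A\<close>] by (auto simp: mult.commute)
  qed
qed

end

section \<open>The group of fractional ideals and its quotient\<close>

context ideal_theory
begin

abbreviation G :: "'a set monoid" where "G \<equiv> ideal_group K"
abbreviation P :: "'a set set" where "P \<equiv> principal_fractional_ideals K"

lemma ideal_group_simps:
  "carrier G = {I. fractional_ideal K I}" "I \<otimes>\<^bsub>G\<^esub> J = I \<odot> J" "\<one>\<^bsub>G\<^esub> = \<O>"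
  by (simp_all add: ideal_group_def)

lemma comm_monoid_ideal_group: "comm_monoid G"
  by (rule comm_monoidI)
     (simp_all add: ideal_group_simps fractional_ideal_prod fractional_ideal_O iprod_assoc O_iprod, rule iprod_commute)

lemma scale_scale: "(\<lambda>x. a * x) ` ((\<lambda>x. b * x) ` I) = (\<lambda>x. a * b * x) ` (I :: 'a set)"
  by (auto simp: image_image mult.assoc)

lemma ex_inverse:
  assumes I: "fractional_ideal K I"
  shows "\<exists>J. fractional_ideal K J \<and> J \<odot> I = \<O>"
proof -
  interpret comm_monoid G by (rule comm_monoid_ideal_group)
  have pow: "fractional_ideal K (I [^]\<^bsub>G\<^esub> n)" for n :: nat
    using nat_pow_closed[of I n] I by (simp add: ideal_group_simps)
  obtain F where F: "finite F" "\<And>I. fractional_ideal K I \<Longrightarrow> \<exists>a\<in>K. a \<noteq> 0 \<and> (\<lambda>x. a * x) ` I \<in> F"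
    using finite_classes by blast
  have "\<forall>n::nat. \<exists>a. a \<in> K \<and> a \<noteq> 0 \<and> (\<lambda>x. a * x) ` (I [^]\<^bsub>G\<^esub> n) \<in> F" using F(2)[OF pow] by blast
  then obtain a where a: "\<And>n::nat. a n \<in> K" "\<And>n. a n \<noteq> 0" "\<And>n. (\<lambda>x. a n * x) ` (I [^]\<^bsub>G\<^esub> n) \<in> F"
    by metis
  have "\<not> inj (\<lambda>n. (\<lambda>x. a n * x) ` (I [^]\<^bsub>G\<^esub> n))"
  proof
    assume "inj (\<lambda>n. (\<lambda>x. a n * x) ` (I [^]\<^bsub>G\<^esub> n))"
    moreover have "finite (range (\<lambda>n. (\<lambda>x. a n * x) ` (I [^]\<^bsub>G\<^esub> n)))"
      by (rule finite_subset[OF _ F(1)]) (use a(3) in auto)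
    ultimately show False using finite_imageD by (metis infinite_UNIV_nat)
  qed
  then obtain i j where "i \<noteq> j" and ij_eq: "(\<lambda>x. a i * x) ` (I [^]\<^bsub>G\<^esub> i) = (\<lambda>x. a j * x) ` (I [^]\<^bsub>G\<^esub> j)"
    unfolding inj_def by blast
  then obtain i j where ij: "i < j" and eq: "(\<lambda>x. a i * x) ` (I [^]\<^bsub>G\<^esub> i) = (\<lambda>x. a j * x) ` (I [^]\<^bsub>G\<^esub> j)"
    by (metis nat_neq_iff)
  \<comment> \<open>One less than the exponent of the principal power, so that the
    \<open>k\<close>-th power of \<open>I\<close>, divided by the scalar, inverts
    \<open>I\<close>.\<close>
  define k where "k = j - i - 1"
  have j: "j = Suc k + i" using ij by (simp add: k_def)
  let ?c = "inverse (a j) * a i"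
  have c: "?c \<in> K" "?c \<noteq> 0" using a K_mult K_inverse by auto
  have "(I [^]\<^bsub>G\<^esub> Suc k) \<odot> (I [^]\<^bsub>G\<^esub> i) = I [^]\<^bsub>G\<^esub> j"
    using nat_pow_mult[of I "Suc k" i] I j by (simp add: ideal_group_simps)
  also have "\<dots> = (\<lambda>x. inverse (a j) * a j * x) ` (I [^]\<^bsub>G\<^esub> j)" using a(2)[of j] by simp
  also have "\<dots> = (\<lambda>x. ?c * x) ` (I [^]\<^bsub>G\<^esub> i)"
    using arg_cong[OF eq, of "image (\<lambda>x. inverse (a j) * x)"] by (simp only: scale_scale)
  finally have "I [^]\<^bsub>G\<^esub> Suc k = (\<lambda>x. ?c * x) ` \<O>"
    by (rule eq_principal_if_iprod_eq_scale[OF pow pow c])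
  then have *: "(I [^]\<^bsub>G\<^esub> k) \<odot> I = (\<lambda>x. ?c * x) ` \<O>" by (simp add: ideal_group_simps)
  let ?J = "(\<lambda>x. inverse ?c * x) ` (I [^]\<^bsub>G\<^esub> k)"
  have "fractional_ideal K ?J" using c by (intro fractional_ideal_scale pow K_inverse) auto
  moreover have "?J \<odot> I = \<O>"
    unfolding scale_iprod * scale_scale by (simp only: left_inverse[OF c(2)]) simp
  ultimately show ?thesis by blast
qed

lemma comm_group_ideal_group: "comm_group G"
proof -
  interpret comm_monoid G by (rule comm_monoid_ideal_group)
  have "Group.group G"
    by (rule group_l_invI) (use ex_inverse in \<open>auto simp: ideal_group_simps\<close>)
  then show ?thesis by (simp add: comm_group_def comm_monoid_ideal_group)
qed

lemma principal_iprod: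
  assumes "fractional_ideal K I"
  shows "((\<lambda>x. a * x) ` \<O>) \<odot> I = (\<lambda>x. a * x) ` I"
  by (simp add: scale_iprod O_iprod[OF assms])

lemma fractional_ideal_principal: "a \<in> K \<Longrightarrow> a \<noteq> 0 \<Longrightarrow> fractional_ideal K ((\<lambda>x. a * x) ` \<O>)"
  by (rule fractional_ideal_scale[OF fractional_ideal_O])

lemma subgroup_principal: "subgroup P G"
proof -
  interpret comm_group G by (rule comm_group_ideal_group)
  show ?thesis
  proof (rule subgroupI)
    show "P \<subseteq> carrier G"
      by (auto simp: principal_fractional_ideals_def ideal_group_simps intro: fractional_ideal_principal)
    show "P \<noteq> {}" using K_1 by (auto simp: principal_fractional_ideals_def)
    fix I assume "I \<in> P"
    then obtain a where a: "a \<in> K" "a \<noteq> 0" "I = (\<lambda>x. a * x) ` \<O>" by (auto simp: principal_fractional_ideals_def)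
    let ?J = "(\<lambda>x. inverse a * x) ` \<O>"
    have J: "fractional_ideal K ?J" using a by (intro fractional_ideal_principal K_inverse) auto
    have I: "fractional_ideal K I" using a by (auto intro: fractional_ideal_principal)
    have "?J \<odot> I = (\<lambda>x. inverse a * x) ` I" by (rule principal_iprod[OF I])
    also have "\<dots> = \<O>" unfolding a(3) scale_scale using a(2) by simp
    finally have "?J \<odot> I = \<O>" .
    then have "inv\<^bsub>G\<^esub> I = ?J"
      using I J by (intro inv_equality) (simp_all add: ideal_group_simps)
    then show "inv\<^bsub>G\<^esub> I \<in> P" using a K_inverse by (auto simp: principal_fractional_ideals_def)
  next
    fix I J assume "I \<in> P" "J \<in> P"
    then obtain a b where a: "a \<in> K" "a \<noteq> 0" "I = (\<lambda>x. a * x) ` \<O>" and b: "b \<in> K" "b \<noteq> 0" "J = (\<lambda>x. b * x) ` \<O>"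
      by (auto simp: principal_fractional_ideals_def)
    have "I \<otimes>\<^bsub>G\<^esub> J = (\<lambda>x. a * b * x) ` \<O>"
      unfolding ideal_group_simps a(3) b(3) by (simp only: principal_iprod[OF fractional_ideal_principal[OF b(1,2)]] scale_scale)
    then show "I \<otimes>\<^bsub>G\<^esub> J \<in> P" using a b K_mult by (auto simp: principal_fractional_ideals_def)
  qed
qed

lemma normal_principal: "P \<lhd> G"
  using comm_group.subgroup_imp_normal[OF comm_group_ideal_group subgroup_principal] .

text \<open>A class contains every scalar multiple of its members, so it meets the finite family of
  representatives.\<close>

lemma finite_class_group: "finite (carrier (class_group K))"
proof -
  interpret comm_group G by (rule comm_group_ideal_group)
  obtain F where F: "finite F" "\<And>I. fractional_ideal K I \<Longrightarrow> \<exists>a\<in>K. a \<noteq> 0 \<and> (\<lambda>x. a * x) ` I \<in> F"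
    using finite_classes by blast
  have "carrier (class_group K) \<subseteq> (\<lambda>J. P #>\<^bsub>G\<^esub> J) ` F"
  proof
    fix C assume "C \<in> carrier (class_group K)"
    then obtain I where I: "fractional_ideal K I" "C = P #>\<^bsub>G\<^esub> I"
      by (auto simp: class_group_def FactGroup_def RCOSETS_def ideal_group_simps)
    obtain a where a: "a \<in> K" "a \<noteq> 0" "(\<lambda>x. a * x) ` I \<in> F" using F(2)[OF I(1)] by blast
    have "(\<lambda>x. a * x) ` \<O> \<in> P" using a by (auto simp: principal_fractional_ideals_def)
    then have "(\<lambda>x. a * x) ` I \<in> P #>\<^bsub>G\<^esub> I"
      unfolding r_coset_def ideal_group_simps using principal_iprod[OF I(1), of a] by force
    then have "P #>\<^bsub>G\<^esub> I = P #>\<^bsub>G\<^esub> ((\<lambda>x. a * x) ` I)"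
      using I(1) by (intro repr_independence subgroup_principal) (simp_all add: ideal_group_simps)
    then show "C \<in> (\<lambda>J. P #>\<^bsub>G\<^esub> J) ` F" using a(3) I(2) by blast
  qed
  then show ?thesis using F(1) finite_subset by blast
qed

lemma power_class_number_principal:
  assumes J: "fractional_ideal K J"
  shows "J [^]\<^bsub>G\<^esub> class_number K \<in> P"
proof -
  interpret comm_group G by (rule comm_group_ideal_group)
  interpret normal P G by (rule normal_principal)
  have Jc: "J \<in> carrier G" using J by (simp add: ideal_group_simps)
  have grp: "Group.group (G Mod P)" by (rule factorgroup_is_group)
  have "group_hom G (G Mod P) (\<lambda>a. P #>\<^bsub>G\<^esub> a)"
    using grp r_coset_hom_Mod by (simp add: group_hom_def group_hom_axioms_def group_axioms)
  then have "P #>\<^bsub>G\<^esub> (J [^]\<^bsub>G\<^esub> class_number K) = (P #>\<^bsub>G\<^esub> J) [^]\<^bsub>G Mod P\<^esub> class_number K"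
    using Jc by (rule group_hom.hom_nat_pow)
  also have "\<dots> = \<one>\<^bsub>G Mod P\<^esub>"
    using group.pow_order_eq_1[OF grp, of "P #>\<^bsub>G\<^esub> J"] Jc
    by (auto simp: class_number_def class_group_def FactGroup_def RCOSETS_def)
  finally have "P #>\<^bsub>G\<^esub> (J [^]\<^bsub>G\<^esub> class_number K) = P" by (simp add: FactGroup_def)
  then show ?thesis
    using coset_join1[OF _ nat_pow_closed[OF Jc] subgroup_principal] by blast
qed

lemma pow_mem: "x \<in> I \<Longrightarrow> x ^ n \<in> I [^]\<^bsub>G\<^esub> (n::nat)"
proof (induction n)
  case 0
  then show ?case by (simp add: ideal_group_simps O_1)
next
  case (Suc n)
  then show ?case using iprod_mult[of "x ^ n" "I [^]\<^bsub>G\<^esub> n" x I] by (simp add: ideal_group_simps mult.commute)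
qed

lemma pow_principal: "a \<in> K \<Longrightarrow> a \<noteq> 0 \<Longrightarrow> ((\<lambda>x. a * x) ` \<O>) [^]\<^bsub>G\<^esub> (n::nat) = (\<lambda>x. a ^ n * x) ` \<O>"
proof (induction n)
  case 0
  then show ?case by (simp add: ideal_group_simps)
next
  case (Suc n)
  then have "((\<lambda>x. a * x) ` \<O>) [^]\<^bsub>G\<^esub> n = (\<lambda>x. a ^ n * x) ` \<O>" by blast
  then show ?case
    by (simp only: nat_pow_Suc ideal_group_simps principal_iprod[OF fractional_ideal_principal[OF Suc.prems]] scale_scale power_Suc2)
qed

end

section \<open>Arithmetic of the quartic field\<close>

text \<open>\<open>nrm P a b c d\<close> is the norm of \<open>a + b t + c t\<^sup>2 + d t\<^sup>3\<close> where \<open>t ^ 4 = P\<close>, computed through the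
  intermediate norm \<open>u + v t\<^sup>2\<close> down to the quadratic subfield.\<close>

definition nrm_u :: "'a::comm_ring_1 \<Rightarrow> 'a \<Rightarrow> 'a \<Rightarrow> 'a \<Rightarrow> 'a \<Rightarrow> 'a" where
  "nrm_u P a b c d = a\<^sup>2 + P * c\<^sup>2 - 2 * P * b * d"

definition nrm_v :: "'a::comm_ring_1 \<Rightarrow> 'a \<Rightarrow> 'a \<Rightarrow> 'a \<Rightarrow> 'a \<Rightarrow> 'a" where
  "nrm_v P a b c d = 2 * a * c - b\<^sup>2 - P * d\<^sup>2"

definition nrm :: "'a::comm_ring_1 \<Rightarrow> 'a \<Rightarrow> 'a \<Rightarrow> 'a \<Rightarrow> 'a \<Rightarrow> 'a" where
  "nrm P a b c d = (nrm_u P a b c d)\<^sup>2 - P * (nrm_v P a b c d)\<^sup>2"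

text \<open>The arguments on the left are the coordinates of a product modulo
  \<open>t ^ 4 = P\<close>. The identity is split along the tower of fields: the pairs
  \<open>(u, v)\<close> multiply like \<open>u + v * s\<close> with \<open>s ^ 2 = P\<close>, whose
  norm is multiplicative in turn.\<close>

lemma nrm_mult:
  fixes P :: "'a::comm_ring_1"
  shows "nrm P (a * a' + P * (b * d' + c * c' + d * b')) (a * b' + b * a' + P * (c * d' + d * c')) (a * c' + b * b' + c * a' + P * d * d') (a * d' + b * c' + c * b' + d * a')
    = nrm P a b c d * nrm P a' b' c' d'"
proof -
  let ?A = "a * a' + P * (b * d' + c * c' + d * b')" and ?B = "a * b' + b * a' + P * (c * d' + d * c')"
  let ?C = "a * c' + b * b' + c * a' + P * d * d'" and ?D = "a * d' + b * c' + c * b' + d * a'"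
  let ?u = "nrm_u P a b c d" and ?v = "nrm_v P a b c d" and ?u' = "nrm_u P a' b' c' d'" and ?v' = "nrm_v P a' b' c' d'"
  have u: "nrm_u P ?A ?B ?C ?D = ?u * ?u' + P * ?v * ?v'"
    unfolding nrm_u_def nrm_v_def by (simp add: algebra_simps power2_eq_square eval_nat_numeral)
  have v: "nrm_v P ?A ?B ?C ?D = ?u * ?v' + ?v * ?u'"
    unfolding nrm_u_def nrm_v_def by (simp add: algebra_simps power2_eq_square eval_nat_numeral)
  show ?thesis unfolding nrm_def u v by (simp add: algebra_simps power2_eq_square eval_nat_numeral)
qed

lemma nrm_scale: "nrm P (k * a) (k * b) (k * c) (k * d) = k ^ 4 * nrm P a b c d"
  unfolding nrm_def nrm_u_def nrm_v_def by (simp add: algebra_simps power2_eq_square eval_nat_numeral)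

text \<open>Multiplication by \<open>t\<close> takes \<open>b + c t + d t^2 + a t^3\<close> to
  \<open>P a + b t + c t^2 + d t^3\<close>, and the norm of \<open>t\<close> is
  \<open>- P\<close>.\<close>

lemma nrm_shift: "nrm P (P * a) b c d = - P * nrm P b c d a"
  unfolding nrm_def nrm_u_def nrm_v_def by (simp add: algebra_simps power2_eq_square eval_nat_numeral)

lemma nrm_decomp: "\<exists>k. nrm P a b c d = a ^ 4 + P * k"
proof -
  let ?w = "P * c\<^sup>2 - 2 * P * b * d"
  have "nrm P a b c d = a ^ 4 + P * (2 * a\<^sup>2 * (c\<^sup>2 - 2 * b * d) + P * (c\<^sup>2 - 2 * b * d)\<^sup>2 - (nrm_v P a b c d)\<^sup>2)"
    unfolding nrm_def nrm_u_def by (simp add: algebra_simps power2_eq_square eval_nat_numeral)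
  then show ?thesis by blast
qed

lemma nrm_hom:
  assumes "\<And>x y. h (x + y) = h x + h y" "\<And>x y. h (x - y) = h x - h y" "\<And>x y. h (x * y) = h x * h y" "h 1 = 1"
  shows "h (nrm P a b c d) = nrm (h P) (h a) (h b) (h c) (h d)"
proof -
  have "h 2 = 2" using assms(1)[of 1 1] assms(4) by simp
  then show ?thesis unfolding nrm_def nrm_u_def nrm_v_def by (simp add: assms power2_eq_square)
qed

lemma dvd_nrmD:
  fixes p :: int
  assumes p: "Factorial_Ring.prime p" and dvd: "p dvd nrm p a b c d"
  shows "p dvd a"
proof -
  obtain k where "nrm p a b c d = a ^ 4 + p * k" using nrm_decomp by blast
  then have "p dvd a ^ 4" using dvd by (simp add: dvd_add_left_iff)
  then show ?thesis using p prime_dvd_power by blast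
qed

lemma dvd_nrm_step:
  fixes p :: int
  assumes p: "Factorial_Ring.prime p" and dvd: "p ^ Suc n dvd nrm p a b c d"
  obtains a' where "a = p * a'" "p ^ n dvd nrm p b c d a'"
proof -
  have "p dvd nrm p a b c d" using dvd by (meson dvd_power dvd_trans zero_less_Suc dvd_power_same le_imp_power_dvd power_le_dvd dvd_refl dvd_mult_left power_Suc)
  then obtain a' where a': "a = p * a'" using dvd_nrmD[OF p] by blast
  then have "p * p ^ n dvd p * nrm p b c d a'" using dvd nrm_shift[of p a' b c d] by simp
  then have "p ^ n dvd nrm p b c d a'" using p by (simp add: prime_gt_0_int)
  then show thesis using a' that by blast
qed

text \<open>A norm divisible by \<open>p\<close> allows division by \<open>t\<close>, which rotates
  the coordinates; four divisions visit each coordinate once and amount to division by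
  \<open>t ^ 4 = p\<close>.\<close>

lemma pow_4_dvd_nrmD:
  fixes p :: int
  assumes p: "Factorial_Ring.prime p" and dvd: "p ^ 4 dvd nrm p a b c d"
  obtains a' b' c' d' where "a = p * a'" "b = p * b'" "c = p * c'" "d = p * d'" "nrm p a b c d = p ^ 4 * nrm p a' b' c' d'"
proof -
  have d4: "p ^ Suc (Suc (Suc (Suc 0))) dvd nrm p a b c d" using dvd by (simp add: eval_nat_numeral)
  obtain a' where a: "a = p * a'" and d3: "p ^ Suc (Suc (Suc 0)) dvd nrm p b c d a'" by (rule dvd_nrm_step[OF p d4])
  obtain b' where b: "b = p * b'" and d2: "p ^ Suc (Suc 0) dvd nrm p c d a' b'" by (rule dvd_nrm_step[OF p d3])
  obtain c' where c: "c = p * c'" and d1: "p ^ Suc 0 dvd nrm p d a' b' c'" by (rule dvd_nrm_step[OF p d2])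
  obtain d' where d: "d = p * d'" by (rule dvd_nrm_step[OF p d1])
  show thesis by (rule that[OF a b c d]) (simp only: a b c d nrm_scale)
qed

text \<open>Infinite descent at \<open>p\<close>. It takes the place of the irreducibility of
  \<open>X ^ 4 - p\<close>: the linear independence of the powers of the root rests on it.\<close>

lemma nrm_int_eq_0D:
  fixes p :: int
  assumes p: "Factorial_Ring.prime p" and z: "nrm p a b c d = 0"
  shows "a = 0 \<and> b = 0 \<and> c = 0 \<and> d = 0"
proof -
  have dvd: "p ^ n dvd a \<and> p ^ n dvd b \<and> p ^ n dvd c \<and> p ^ n dvd d" for n
    using z
  proof (induction n arbitrary: a b c d)
    case (Suc n)
    have "p ^ 4 dvd nrm p a b c d" using Suc.prems by simp
    then obtain a' b' c' d' where e: "a = p * a'" "b = p * b'" "c = p * c'" "d = p * d'"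
      and n: "nrm p a b c d = p ^ 4 * nrm p a' b' c' d'"
      by (rule pow_4_dvd_nrmD[OF p])
    have "nrm p a' b' c' d' = 0" using n Suc.prems p by auto
    then show ?case using Suc.IH e by (auto intro!: mult_dvd_mono)
  qed simp
  have "x = 0" if "\<And>n. p ^ n dvd x" for x
  proof (rule ccontr)
    assume x: "x \<noteq> 0"
    have "p ^ n \<le> \<bar>x\<bar>" for n using that[of n] x by (metis dvd_imp_le_int abs_ge_self order_trans)
    moreover have "int n < p ^ n" for n
      using prime_ge_2_int[OF p] by (metis less_exp of_nat_less_iff of_nat_power of_nat_numeral order_less_le_trans power_mono zero_le_numeral)
    ultimately show False using x by (metis abs_of_nat less_irrefl nat_0_le order_less_le_trans abs_ge_zero)
  qed
  then show ?thesis using dvd by blast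
qed

section \<open>Coordinates and conjugates\<close>

text \<open>The root \<open>t\<close> is a parameter in an arbitrary field of characteristic 0, so
  that the same rational coordinates can be evaluated at the real root and at all complex
  ones.\<close>

definition el :: "'a::field_char_0 \<Rightarrow> rat \<Rightarrow> rat \<Rightarrow> rat \<Rightarrow> rat \<Rightarrow> 'a" where
  "el t a b c d = of_rat a + of_rat b * t + of_rat c * t ^ 2 + of_rat d * t ^ 3"

lemma el_add: "el t a b c d + el t a' b' c' d' = el t (a + a') (b + b') (c + c') (d + d')"
  by (simp add: el_def of_rat_add algebra_simps)

lemma el_diff: "el t a b c d - el t a' b' c' d' = el t (a - a') (b - b') (c - c') (d - d')"
  by (simp add: el_def of_rat_diff algebra_simps)

lemma el_of_rat: "el t a 0 0 0 = of_rat a"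
  by (simp add: el_def)

lemma el_of_int: "el t (of_int k) 0 0 0 = of_int k"
  by (simp add: el_def)

lemma el_mult:
  assumes t: "t ^ 4 = of_nat p"
  shows "el t a b c d * el t a' b' c' d' =
    el t (a * a' + of_nat p * (b * d' + c * c' + d * b')) (a * b' + b * a' + of_nat p * (c * d' + d * c'))
      (a * c' + b * b' + c * a' + of_nat p * d * d') (a * d' + b * c' + c * b' + d * a')"
proof -
  have t4: "t * (t * (t * (t * x))) = of_nat p * x" for x
    using t by (simp add: eval_nat_numeral mult.assoc[symmetric])
  show ?thesis
    by (simp add: el_def of_rat_add of_rat_mult eval_nat_numeral algebra_simps t4)
qed

text \<open>The cofactor is the image under \<open>t -> - t\<close> times the conjugate of the
  intermediate norm. Being explicit, it also shows that the field is closed under inverses.\<close>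

lemma el_norm:
  assumes t: "t ^ 4 = of_nat p"
  shows "el t a b c d * (el t a (- b) c (- d) * el t (nrm_u (of_nat p) a b c d) 0 (- nrm_v (of_nat p) a b c d) 0)
    = of_rat (nrm (of_nat p) a b c d)"
proof -
  let ?u = "nrm_u (of_nat p) a b c d" and ?v = "nrm_v (of_nat p) a b c d"
  have 1: "el t a b c d * el t a (- b) c (- d) = el t ?u 0 ?v 0"
    unfolding el_mult[OF t] nrm_u_def nrm_v_def by (simp add: power2_eq_square algebra_simps)
  have 2: "el t ?u 0 ?v 0 * el t ?u 0 (- ?v) 0 = el t (nrm (of_nat p) a b c d) 0 0 0"
    unfolding el_mult[OF t] nrm_def by (simp add: power2_eq_square algebra_simps)
  show ?thesis using 1 2 by (simp add: mult.assoc[symmetric] el_of_rat)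
qed

lemma rat_common_denominator:
  fixes a b c d :: rat
  obtains D A B C E :: int where "D > 0" "a = of_int A / of_int D" "b = of_int B / of_int D"
    "c = of_int C / of_int D" "d = of_int E / of_int D"
proof -
  have ex: "\<exists>n m :: int. m > 0 \<and> x = of_int n / of_int m" for x :: rat
    by (metis quotient_of_denom_pos quotient_of_div surj_pair)
  obtain a1 a2 where a: "a2 > 0" "a = of_int a1 / of_int a2" using ex by blast
  obtain b1 b2 where b: "b2 > 0" "b = of_int b1 / of_int b2" using ex by blast
  obtain c1 c2 where c: "c2 > 0" "c = of_int c1 / of_int c2" using ex by blast
  obtain d1 d2 where d: "d2 > 0" "d = of_int d1 / of_int d2" using ex by blast
  show thesis
    by (rule that[of "a2 * b2 * c2 * d2" "a1 * b2 * c2 * d2" "b1 * a2 * c2 * d2" "c1 * a2 * b2 * d2" "d1 * a2 * b2 * c2"])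
       (use a b c d in \<open>simp_all add: field_simps\<close>)
qed

lemma of_int_nrm: "of_int (nrm P a b c d) = nrm (of_int P) (of_int a) (of_int b) (of_int c) (of_int d)"
  by (rule nrm_hom) simp_all

lemma nrm_rat_eq_0D:
  assumes p: "Factorial_Ring.prime p" and z: "nrm (of_nat p) a b c (d :: rat) = 0"
  shows "a = 0 \<and> b = 0 \<and> c = 0 \<and> d = 0"
proof -
  obtain D A B C E :: int where D: "D > 0" "a = of_int A / of_int D" "b = of_int B / of_int D"
    "c = of_int C / of_int D" "d = of_int E / of_int D"
    by (rule rat_common_denominator)
  have "(of_int (nrm (int p) A B C E) :: rat) = nrm (of_nat p) (of_int D * a) (of_int D * b) (of_int D * c) (of_int D * d)"
    using D by (simp add: of_int_nrm)
  also have "\<dots> = 0" by (simp only: nrm_scale z mult_zero_right)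
  finally have "nrm (int p) A B C E = 0" by simp
  then have "A = 0 \<and> B = 0 \<and> C = 0 \<and> E = 0" using p by (intro nrm_int_eq_0D) auto
  then show ?thesis using D by simp
qed

lemma el_eq_0D:
  assumes p: "Factorial_Ring.prime p" and t: "t ^ 4 = of_nat p" and z: "el t a b c d = 0"
  shows "a = 0 \<and> b = 0 \<and> c = 0 \<and> d = 0"
proof -
  have "(of_rat (nrm (of_nat p) a b c d) :: 'a) = 0"
    using el_norm[OF t, of a b c d] z by simp
  then show ?thesis by (intro nrm_rat_eq_0D[OF p]) simp
qed

text \<open>Plays the role of a field embedding: the coordinates of a polynomial value are computed
  by rules that use only \<open>t ^ 4 = p\<close>, so they are the same for every root.\<close>

lemma poly_el:
  fixes s :: "'a::field_char_0" and t :: "'b::field_char_0"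
  assumes s: "s ^ 4 = of_nat p"
  shows "\<exists>A B C D. poly (map_poly of_int g) (el s a b c d) = el s A B C D \<and>
    (\<forall>t::'b. t ^ 4 = of_nat p \<longrightarrow> poly (map_poly of_int g) (el t a b c d) = el t A B C D)"
proof (induction g)
  case 0
  show ?case by (intro exI[of _ 0]) (simp add: el_def)
next
  case (pCons k g)
  then obtain A B C D where IH: "poly (map_poly of_int g) (el s a b c d) = el s A B C D"
    "\<And>t::'b. t ^ 4 = of_nat p \<Longrightarrow> poly (map_poly of_int g) (el t a b c d) = el t A B C D" by blast
  let ?c = "of_int k"
  let ?A = "?c + (a * A + of_nat p * (b * D + c * C + d * B))" and ?B = "0 + (a * B + b * A + of_nat p * (c * D + d * C))"
  let ?C = "0 + (a * C + b * B + c * A + of_nat p * d * D)" and ?D = "0 + (a * D + b * C + c * B + d * A)"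
  have "poly (map_poly of_int (pCons k g)) (el s a b c d) = el s ?c 0 0 0 + el s a b c d * el s A B C D"
    by (simp add: map_poly_pCons IH el_of_int)
  then have 1: "poly (map_poly of_int (pCons k g)) (el s a b c d) = el s ?A ?B ?C ?D"
    by (simp only: el_mult[OF s] el_add)
  have "poly (map_poly of_int (pCons k g)) (el t a b c d) = el t ?c 0 0 0 + el t a b c d * el t A B C D"
    if "t ^ 4 = of_nat p" for t :: 'b
    using that by (simp add: map_poly_pCons IH el_of_int)
  then have 2: "poly (map_poly of_int (pCons k g)) (el t a b c d) = el t ?A ?B ?C ?D"
    if "t ^ 4 = of_nat p" for t :: 'b
    using that by (simp only: el_mult[OF that] el_add)
  show ?case using 1 2 by blast
qed

text \<open>The value at \<open>s\<close> of a monic polynomial is 0 only if all its coordinates are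
  0, by linear independence; then the value at \<open>t\<close> is 0 as well.\<close>

lemma algebraic_int_conj:
  fixes s :: "'a::field_char_0" and t :: "'b::field_char_0"
  assumes p: "Factorial_Ring.prime p" and s: "s ^ 4 = of_nat p" and t: "t ^ 4 = of_nat p"
    and x: "algebraic_int (el s a b c d)"
  shows "algebraic_int (el t a b c d)"
proof -
  obtain g where g: "poly (map_poly of_int g) (el s a b c d) = 0" "lead_coeff g = 1"
    using x unfolding algebraic_int_altdef_ipoly by blast
  obtain A B C D where "poly (map_poly of_int g) (el s a b c d) = el s A B C D"
    "\<And>t::'b. t ^ 4 = of_nat p \<Longrightarrow> poly (map_poly of_int g) (el t a b c d) = el t A B C D"
    using poly_el[OF s, where 'b = 'b] by blast
  moreover from this g have "A = 0 \<and> B = 0 \<and> C = 0 \<and> D = 0" by (intro el_eq_0D[OF p s]) simp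
  ultimately have "poly (map_poly of_int g) (el t a b c d) = 0" using t by (simp add: el_def)
  then show ?thesis unfolding algebraic_int_altdef_ipoly using g(2) by blast
qed

section \<open>The field of the real root and its norm\<close>

locale quartic_field =
  fixes p :: nat and \<theta> :: real
  assumes p: "Factorial_Ring.prime p" and \<theta>: "\<theta> ^ 4 = of_nat p"
begin

definition K :: "real set" where "K = {el \<theta> a b c d | a b c d. True}"

lemma el_in_K: "el \<theta> a b c d \<in> K"
  by (auto simp: K_def)

lemma K_cases:
  assumes "x \<in> K"
  obtains a b c d where "x = el \<theta> a b c d"
  using assms by (auto simp: K_def)

lemma el_inject:
  "el \<theta> a b c d = el \<theta> a' b' c' d' \<longleftrightarrow> a = a' \<and> b = b' \<and> c = c' \<and> d = d'"
  using el_eq_0D[OF p \<theta>, of "a - a'" "b - b'" "c - c'" "d - d'"] by (auto simp: el_diff[symmetric])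

definition N :: "real \<Rightarrow> rat" where
  "N x = (THE r. \<exists>a b c d. x = el \<theta> a b c d \<and> r = nrm (of_nat p) a b c d)"

lemma N_el: "N (el \<theta> a b c d) = nrm (of_nat p) a b c d"
  unfolding N_def by (rule the_equality) (auto simp: el_inject)

lemma N_mult: "x \<in> K \<Longrightarrow> y \<in> K \<Longrightarrow> N (x * y) = N x * N y"
  by (auto elim!: K_cases simp: el_mult[OF \<theta>] N_el nrm_mult)

lemma N_eq_0D: "x \<in> K \<Longrightarrow> N x = 0 \<Longrightarrow> x = 0"
proof -
  assume "x \<in> K" and z: "N x = 0"
  then obtain a b c d where x: "x = el \<theta> a b c d" by (blast elim: K_cases)
  then have "a = 0 \<and> b = 0 \<and> c = 0 \<and> d = 0" using z by (intro nrm_rat_eq_0D[OF p]) (simp add: N_el)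
  then show "x = 0" using x by (simp add: el_def)
qed

lemma K_of_rat: "of_rat r \<in> K"
  using el_in_K[of r 0 0 0] by (simp add: el_of_rat)

lemma N_of_rat: "N (of_rat r) = r ^ 4"
  using N_el[of r 0 0 0] by (simp add: el_of_rat nrm_def nrm_u_def nrm_v_def)

lemma N_of_int: "N (of_int r) = of_int r ^ 4"
  using N_of_rat[of "of_int r"] by simp

lemma K_of_int: "of_int r \<in> K"
  using K_of_rat[of "of_int r"] by simp

lemma K_diff: "x \<in> K \<Longrightarrow> y \<in> K \<Longrightarrow> x - y \<in> K"
  by (auto elim!: K_cases simp: el_diff el_in_K)

lemma K_add: "x \<in> K \<Longrightarrow> y \<in> K \<Longrightarrow> x + y \<in> K"
  by (auto elim!: K_cases simp: el_add el_in_K)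

lemma K_mult: "x \<in> K \<Longrightarrow> y \<in> K \<Longrightarrow> x * y \<in> K"
  by (auto elim!: K_cases simp: el_mult[OF \<theta>] el_in_K)

lemma K_inverse:
  assumes "x \<in> K"
  shows "inverse x \<in> K"
proof (cases "x = 0")
  case True
  then show ?thesis using assms by simp
next
  case False
  obtain a b c d where x: "x = el \<theta> a b c d" using assms by (rule K_cases)
  obtain y where y: "y \<in> K" "x * y = of_rat (N x)"
    using el_norm[OF \<theta>, of a b c d] x K_mult[OF el_in_K el_in_K] by (metis N_el)
  have "N x \<noteq> 0" using False N_eq_0D assms by blast
  then have "y \<noteq> 0" using y(2) by auto
  then have "inverse x = y * inverse (x * y)" using False by (simp add: field_simps)
  then have "inverse x = y * of_rat (inverse (N x))" by (simp only: y(2) of_rat_inverse)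
  then show ?thesis using K_mult[OF y(1) K_of_rat] by simp
qed

lemma K_\<theta>: "\<theta> \<in> K"
  using el_in_K[of 0 1 0 0] by (simp add: el_def)

lemma K_power: "x \<in> K \<Longrightarrow> x ^ n \<in> K"
  using K_of_int[of 1] by (induction n) (auto intro: K_mult)

lemma N_power: "x \<in> K \<Longrightarrow> N (x ^ n) = N x ^ n"
  using N_of_int[of 1] by (induction n) (auto simp: N_mult K_power)

lemma rat_adjoin_eq: "rat_adjoin \<theta> = K"
proof -
  let ?R = "ring_of_type_algebra :: real ring"
  interpret R: Ring.field ?R by (rule field_from_type_algebra)
  have ops: "x \<otimes>\<^bsub>?R\<^esub> y = x * y" "x \<oplus>\<^bsub>?R\<^esub> y = x + y" "\<one>\<^bsub>?R\<^esub> = 1" "\<zero>\<^bsub>?R\<^esub> = 0" "carrier ?R = UNIV" for x y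
    by (simp_all add: ring_of_type_algebra_def)
  have minus: "\<ominus>\<^bsub>?R\<^esub> x = - x" for x
    by (rule R.minus_equality) (simp_all add: ops)
  have inv: "inv\<^bsub>?R\<^esub> x = inverse x" if "x \<noteq> 0" for x
    by (rule R.comm_inv_char) (use that in \<open>simp_all add: ops\<close>)
  let ?F = "generate_field ?R {\<theta>}"
  have one: "1 \<in> ?F" using generate_field.one[of ?R "{\<theta>}"] by (simp add: ops)
  have th: "\<theta> \<in> ?F" by (rule generate_field.incl) simp
  have add: "x + y \<in> ?F" if "x \<in> ?F" "y \<in> ?F" for x y using generate_field.eng_add[OF that] by (simp add: ops)
  have mult: "x * y \<in> ?F" if "x \<in> ?F" "y \<in> ?F" for x y using generate_field.eng_mult[OF that] by (simp add: ops)
  have um: "- x \<in> ?F" if "x \<in> ?F" for x using generate_field.a_inv[OF that] by (simp add: minus)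
  have inverse: "inverse x \<in> ?F" if "x \<in> ?F" "x \<noteq> 0" for x
    using generate_field.m_inv[OF that(1)] that(2) by (simp add: inv ops)
  have zero: "0 \<in> ?F" using add[OF one um[OF one]] by simp
  have nat: "of_nat n \<in> ?F" for n by (induction n) (auto simp: zero intro: add one)
  have int: "of_int k \<in> ?F" for k by (cases k) (auto intro: nat um simp del: of_nat_Suc)
  have rat: "of_rat r \<in> ?F" for r
  proof -
    obtain n m where r: "m > 0" "r = of_int n / of_int m" by (metis quotient_of_denom_pos quotient_of_div surj_pair)
    have "of_rat r = of_int n * inverse (of_int m :: real)" unfolding r(2) of_rat_divide by (simp add: divide_inverse)
    then show ?thesis using mult[OF int inverse[OF int]] r(1) by simp
  qed
  have pow: "\<theta> ^ n \<in> ?F" for n by (induction n) (auto intro: one mult th)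
  show ?thesis unfolding rat_adjoin_def
  proof
    show "?F \<subseteq> K"
    proof
      fix x assume "x \<in> ?F"
      then show "x \<in> K"
      proof (induction rule: generate_field.induct)
        case one
        then show ?case using K_of_int[of 1] by (simp add: ops)
      next
        case (a_inv h)
        then show ?case using K_diff[OF K_of_int[of 0]] by (force simp: minus)
      next
        case (m_inv h)
        then show ?case by (simp add: inv ops K_inverse)
      qed (auto simp: ops intro: K_\<theta> K_add K_mult)
    qed
    show "K \<subseteq> ?F"
      by (auto elim!: K_cases simp: el_def intro!: add mult rat th pow)
  qed
qed

lemma algebraic_int_\<theta>: "algebraic_int \<theta>"
  by (rule algebraic_int_root[of "of_nat p" "monom 1 4"])
     (use \<theta> in \<open>simp_all add: poly_monom degree_monom_eq coeff_monom\<close>)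

end

section \<open>Integral elements\<close>

lemma el_mult_conj:
  assumes t: "t ^ 4 = of_nat p"
  shows "el t a b c d * el (- t) a b c d = el t (nrm_u (of_nat p) a b c d) 0 (nrm_v (of_nat p) a b c d) 0"
proof -
  have "el (- t) a b c d = el t a (- b) c (- d)" by (simp add: el_def of_rat_minus)
  then show ?thesis
    unfolding nrm_u_def nrm_v_def by (simp add: el_mult[OF t]) (simp add: power2_eq_square algebra_simps)
qed

lemma of_rat_in_Ints:
  assumes "(of_rat x :: 'a::field_char_0) \<in> \<int>"
  shows "x \<in> \<int>"
proof -
  obtain k where "(of_rat x :: 'a) = of_int k" using assms by (rule Ints_cases)
  then have "(of_rat x :: 'a) = of_rat (of_int k)" by simp
  then show ?thesis by (simp only: of_rat_eq_iff Ints_of_int)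
qed

lemma algebraic_int_of_rat:
  assumes "algebraic_int (of_rat x :: 'a::field_char_0)"
  shows "x \<in> \<int>"
  using rational_algebraic_int_is_int[OF assms] by (intro of_rat_in_Ints[where 'a = 'a]) simp

text \<open>A crude homogeneous estimate: what matters is the degree 4 in \<open>e\<close>, since
  the constant is later absorbed by the choice of denominators.\<close>

lemma nrm_bound:
  fixes P :: "'a::linordered_idom"
  assumes P: "P \<ge> 0" and e: "\<bar>a\<bar> \<le> e" "\<bar>b\<bar> \<le> e" "\<bar>c\<bar> \<le> e" "\<bar>d\<bar> \<le> e"
  shows "\<bar>nrm P a b c d\<bar> \<le> ((1 + 3 * P)\<^sup>2 + P * (3 + P)\<^sup>2) * e ^ 4"
proof -
  have e0: "e \<ge> 0" using e(1) by linarith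
  have m: "\<bar>x * y\<bar> \<le> e\<^sup>2" if "\<bar>x\<bar> \<le> e" "\<bar>y\<bar> \<le> e" for x y
    unfolding abs_mult power2_eq_square using that e0 by (intro mult_mono) auto
  have u: "\<bar>nrm_u P a b c d\<bar> \<le> (1 + 3 * P) * e\<^sup>2"
  proof -
    have "\<bar>nrm_u P a b c d\<bar> \<le> \<bar>a * a\<bar> + P * \<bar>c * c\<bar> + P * (2 * \<bar>b * d\<bar>)"
    proof -
      have "nrm_u P a b c d = a * a + P * (c * c) - P * (2 * (b * d))"
        by (simp add: nrm_u_def power2_eq_square algebra_simps)
      moreover have "\<bar>P * (c * c)\<bar> = P * \<bar>c * c\<bar>" "\<bar>P * (2 * (b * d))\<bar> = P * (2 * \<bar>b * d\<bar>)"
        using P by (simp_all add: abs_mult)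
      ultimately show ?thesis by linarith
    qed
    also have "\<dots> \<le> e\<^sup>2 + P * e\<^sup>2 + P * (2 * e\<^sup>2)"
      using P m[OF e(1) e(1)] m[OF e(3) e(3)] m[OF e(2) e(4)] by (intro add_mono mult_left_mono) auto
    also have "\<dots> = (1 + 3 * P) * e\<^sup>2" by (simp add: algebra_simps)
    finally show ?thesis .
  qed
  have v: "\<bar>nrm_v P a b c d\<bar> \<le> (3 + P) * e\<^sup>2"
  proof -
    have "\<bar>nrm_v P a b c d\<bar> \<le> 2 * \<bar>a * c\<bar> + \<bar>b * b\<bar> + P * \<bar>d * d\<bar>"
    proof -
      have "nrm_v P a b c d = 2 * (a * c) - b * b - P * (d * d)"
        by (simp add: nrm_v_def power2_eq_square algebra_simps)
      moreover have "\<bar>P * (d * d)\<bar> = P * \<bar>d * d\<bar>" using P by (simp add: abs_mult)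
      ultimately show ?thesis by linarith
    qed
    also have "\<dots> \<le> 2 * e\<^sup>2 + e\<^sup>2 + P * e\<^sup>2"
      using P m[OF e(1) e(3)] m[OF e(2) e(2)] m[OF e(4) e(4)] by (intro add_mono mult_left_mono) auto
    also have "\<dots> = (3 + P) * e\<^sup>2" by (simp add: algebra_simps)
    finally show ?thesis .
  qed
  have "\<bar>nrm P a b c d\<bar> \<le> \<bar>nrm_u P a b c d\<bar>\<^sup>2 + P * \<bar>nrm_v P a b c d\<bar>\<^sup>2"
  proof -
    have "0 \<le> (nrm_u P a b c d)\<^sup>2" "0 \<le> P * (nrm_v P a b c d)\<^sup>2" using P by auto
    then show ?thesis unfolding nrm_def power2_abs by linarith
  qed
  also have "\<dots> \<le> ((1 + 3 * P) * e\<^sup>2)\<^sup>2 + P * ((3 + P) * e\<^sup>2)\<^sup>2"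
    using u v P by (intro add_mono mult_left_mono power_mono) auto
  also have "\<dots> = ((1 + 3 * P)\<^sup>2 + P * (3 + P)\<^sup>2) * e ^ 4"
    by (simp add: eval_nat_numeral algebra_simps)
  finally show ?thesis .
qed

context quartic_field
begin

text \<open>The order generated by \<theta>, explicit through integer coordinates. It stands in for
  the ring of integers, of which no basis is computed.\<close>

definition Z\<theta> :: "real set" where
  "Z\<theta> = {el \<theta> (of_int A) (of_int B) (of_int C) (of_int D) | A B C D. True}"

lemma complex_roots:
  defines "r \<equiv> complex_of_real \<theta>"
  shows "r ^ 4 = of_nat p" "(- r) ^ 4 = of_nat p" "(\<i> * r) ^ 4 = of_nat p" "(- (\<i> * r)) ^ 4 = of_nat p"
proof -
  show r: "r ^ 4 = of_nat p" unfolding r_def using \<theta> by (metis of_real_of_nat_eq of_real_power)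
  then show "(- r) ^ 4 = of_nat p" by simp
  show 3: "(\<i> * r) ^ 4 = of_nat p" using r by (simp add: power_mult_distrib)
  then show "(- (\<i> * r)) ^ 4 = of_nat p" by simp
qed

text \<open>Summing over the four roots cancels all powers of the root except the constant one, so
  \<open>4 * a\<close> is the trace.\<close>

lemma trace_int:
  assumes x: "algebraic_int (el \<theta> a b c d)"
  shows "4 * a \<in> \<int>"
proof -
  let ?r = "complex_of_real \<theta>"
  note alg = algebraic_int_conj[OF p \<theta> complex_roots(1) x] algebraic_int_conj[OF p \<theta> complex_roots(2) x]
    algebraic_int_conj[OF p \<theta> complex_roots(3) x] algebraic_int_conj[OF p \<theta> complex_roots(4) x]
  have "algebraic_int (el ?r a b c d + el (- ?r) a b c d + el (\<i> * ?r) a b c d + el (- (\<i> * ?r)) a b c d)"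
    by (intro algebraic_int_add alg)
  moreover have "el ?r a b c d + el (- ?r) a b c d + el (\<i> * ?r) a b c d + el (- (\<i> * ?r)) a b c d = of_rat (4 * a)"
    by (simp add: el_def of_rat_mult power_mult_distrib power2_eq_square)
  ultimately show ?thesis using algebraic_int_of_rat by metis
qed

lemma N_int:
  assumes x: "x \<in> K" "algebraic_int x"
  shows "N x \<in> \<int>"
proof -
  obtain a b c d where e: "x = el \<theta> a b c d" using x(1) by (rule K_cases)
  let ?r = "complex_of_real \<theta>" and ?u = "nrm_u (of_nat p) a b c d" and ?v = "nrm_v (of_nat p) a b c d"
  note alg = algebraic_int_conj[OF p \<theta> complex_roots(1) x(2)[unfolded e]] algebraic_int_conj[OF p \<theta> complex_roots(2) x(2)[unfolded e]]
    algebraic_int_conj[OF p \<theta> complex_roots(3) x(2)[unfolded e]] algebraic_int_conj[OF p \<theta> complex_roots(4) x(2)[unfolded e]]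
  have "algebraic_int ((el ?r a b c d * el (- ?r) a b c d) * (el (\<i> * ?r) a b c d * el (- (\<i> * ?r)) a b c d))"
    by (intro algebraic_int_mult alg)
  also have "(el ?r a b c d * el (- ?r) a b c d) * (el (\<i> * ?r) a b c d * el (- (\<i> * ?r)) a b c d)
      = el ?r ?u 0 ?v 0 * el (\<i> * ?r) ?u 0 ?v 0"
    unfolding el_mult_conj[OF complex_roots(1)] el_mult_conj[OF complex_roots(3)] ..
  also have "el (\<i> * ?r) ?u 0 ?v 0 = el ?r ?u 0 (- ?v) 0"
    by (simp add: el_def of_rat_minus power_mult_distrib)
  also have "el ?r ?u 0 ?v 0 * el ?r ?u 0 (- ?v) 0 = el ?r (nrm (of_nat p) a b c d) 0 0 0"
    unfolding el_mult[OF complex_roots(1)] nrm_def by (simp add: power2_eq_square algebra_simps)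
  also have "\<dots> = of_rat (N x)" by (simp add: el_of_rat e N_el)
  finally show ?thesis by (rule algebraic_int_of_rat)
qed

lemma el_mult_\<theta>: "\<theta> * el \<theta> a b c d = el \<theta> (of_nat p * d) a b c"
  using el_mult[OF \<theta>, of 0 1 0 0 a b c d] by (simp add: el_def)

lemma algebraic_int_of_int [simp]: "algebraic_int (of_int k)"
  by (rule int_imp_algebraic_int) simp

text \<open>The traces of \<open>x\<close> times powers of \<theta> make \<open>4 a\<close>,
  \<open>4 p b\<close>, \<open>4 p c\<close> and \<open>4 p d\<close> integers. The spurious factor
  \<open>p\<close> is removed by the norm: that of \<open>4 p x\<close> is divisible by
  \<open>p ^ 4\<close>, hence all its coordinates by \<open>p\<close>.\<close>

lemma four_mult_in_Z\<theta>:
  assumes x: "x \<in> K" "algebraic_int x"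
  shows "4 * x \<in> Z\<theta>"
proof -
  obtain a b c d where e: "x = el \<theta> a b c d" using x(1) by (rule K_cases)
  let ?P = "of_nat p :: rat"
  have alg: "algebraic_int (el \<theta> a b c d)" using x e by simp
  have alg1: "algebraic_int (el \<theta> (?P * d) a b c)"
    using algebraic_int_mult[OF algebraic_int_\<theta> alg] by (simp only: el_mult_\<theta>)
  have alg2: "algebraic_int (el \<theta> (?P * c) (?P * d) a b)"
    using algebraic_int_mult[OF algebraic_int_\<theta> alg1] by (simp only: el_mult_\<theta>)
  have alg3: "algebraic_int (el \<theta> (?P * b) (?P * c) (?P * d) a)"
    using algebraic_int_mult[OF algebraic_int_\<theta> alg2] by (simp only: el_mult_\<theta>)
  obtain A where A: "4 * a = of_int A" using trace_int[OF alg] by (rule Ints_cases)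
  obtain D where D: "4 * (?P * d) = of_int D" using trace_int[OF alg1] by (rule Ints_cases)
  obtain C where C: "4 * (?P * c) = of_int C" using trace_int[OF alg2] by (rule Ints_cases)
  obtain B where B: "4 * (?P * b) = of_int B" using trace_int[OF alg3] by (rule Ints_cases)
  obtain n where n: "N x = of_int n" using N_int[OF x] by (rule Ints_cases)
  have "(of_int (nrm (int p) (int p * A) B C D) :: rat) = nrm ?P (?P * 4 * a) (?P * 4 * b) (?P * 4 * c) (?P * 4 * d)"
    by (simp add: of_int_nrm A[symmetric] B[symmetric] C[symmetric] D[symmetric] mult_ac)
  also have "\<dots> = (?P * 4) ^ 4 * N x" by (simp only: nrm_scale e N_el)
  also have "\<dots> = of_int (int p ^ 4 * (256 * n))" by (simp add: n power_mult_distrib)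
  finally have "nrm (int p) (int p * A) B C D = int p ^ 4 * (256 * n)" by (simp only: of_int_eq_iff)
  then have dvd: "int p ^ 4 dvd nrm (int p) (int p * A) B C D" by simp
  have pp: "Factorial_Ring.prime (int p)" using p by simp
  obtain A' B' C' D' where "int p * A = int p * A'" "B = int p * B'" "C = int p * C'" "D = int p * D'"
    by (rule pow_4_dvd_nrmD[OF pp dvd])
  then have "4 * b = of_int B'" "4 * c = of_int C'" "4 * d = of_int D'"
    using B C D prime_gt_0_nat[OF p] by auto
  moreover have "4 * x = el \<theta> (4 * a) (4 * b) (4 * c) (4 * d)"
    unfolding e by (simp add: el_def of_rat_mult algebra_simps)
  ultimately show ?thesis using A by (auto simp: Z\<theta>_def)
qed

lemma N_quartic_residue:
  assumes x: "x \<in> K" "algebraic_int x"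
  obtains n A :: int where "N x = of_int n" "[256 * n = A ^ 4] (mod int p)"
proof -
  obtain n where n: "N x = of_int n" using N_int[OF x] by (rule Ints_cases)
  obtain A B C D where e: "4 * x = el \<theta> (of_int A) (of_int B) (of_int C) (of_int D)"
    using four_mult_in_Z\<theta>[OF x] by (auto simp: Z\<theta>_def)
  have "of_int (nrm (int p) A B C D) = N (4 * x)" unfolding e by (simp add: N_el of_int_nrm)
  also have "\<dots> = of_int (256 * n)"
    using N_mult[OF K_of_int[of 4] x(1)] N_of_int[of 4] by (simp add: n)
  finally have "nrm (int p) A B C D = 256 * n" by (simp only: of_int_eq_iff)
  moreover obtain k where "nrm (int p) A B C D = A ^ 4 + int p * k" using nrm_decomp by blast
  ultimately have "256 * n - A ^ 4 = int p * k" by simp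
  then have "[256 * n = A ^ 4] (mod int p)" by (simp add: cong_iff_dvd_diff)
  then show thesis using that n by blast
qed

lemma Z\<theta>_subset_K: "z \<in> Z\<theta> \<Longrightarrow> z \<in> K"
  by (auto simp: Z\<theta>_def el_in_K)

lemma Z\<theta>_algebraic_int:
  assumes "z \<in> Z\<theta>"
  shows "algebraic_int z"
proof -
  obtain A B C D where "z = of_int A + of_int B * \<theta> + of_int C * (\<theta> * \<theta>) + of_int D * (\<theta> * (\<theta> * \<theta>))"
    using assms by (auto simp: Z\<theta>_def el_def power2_eq_square power3_eq_cube mult.assoc)
  then show ?thesis
    by (simp only:) (intro algebraic_int_add algebraic_int_mult algebraic_int_of_int algebraic_int_\<theta>)
qed

lemma Z\<theta>_of_int: "of_int k \<in> Z\<theta>"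
  unfolding Z\<theta>_def
  by (rule CollectI) (rule exI[of _ k], rule exI[of _ 0], rule exI[of _ 0], rule exI[of _ 0], simp add: el_def)

text \<open>Dirichlet's simultaneous approximation of the four coordinates, with a multiplier up to
  \<open>m ^ 4\<close> and errors below \<open>1 / m\<close>, makes the norm at most
  \<open>C / m ^ 4\<close>. This is Hurwitz's weak form of division with remainder.\<close>

lemma approximation:
  obtains M :: nat where "M > 0"
    "\<And>x. x \<in> K \<Longrightarrow> \<exists>t\<in>{1..M}. \<exists>w\<in>Z\<theta>. \<bar>N (of_nat t * x - w)\<bar> < 1"
proof -
  let ?P = "of_nat p :: rat"
  let ?C = "(1 + 3 * ?P)\<^sup>2 + ?P * (3 + ?P)\<^sup>2"
  \<comment> \<open>\<open>?C\<close> is the constant of \<open>nrm_bound\<close>; exceeding it by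
    \<open>m\<close> is enough because \<open>m ^ 4\<close> is at least \<open>m\<close>.\<close>
  obtain m :: nat where m: "?C < of_nat m" using reals_Archimedean2 by blast
  have "?C > 0" by (intro add_pos_nonneg zero_less_power mult_nonneg_nonneg) (auto intro: add_pos_nonneg)
  then have m0: "m > 0" using m by (metis of_nat_0 gr0I less_trans less_irrefl)
  show thesis
  proof (rule that[of "m ^ 4"])
    show "m ^ 4 > 0" using m0 by simp
    fix x assume "x \<in> K"
    then obtain a b c d where x: "x = el \<theta> a b c d" by (rule K_cases)
    define f where "f i = (if i = 0 then real_of_rat a else if i = 1 then real_of_rat b else if i = 2 then real_of_rat c else real_of_rat d)" for i :: nat
    obtain q k where q: "0 < q" "q \<le> int (m ^ 4)" "\<And>i. i < 4 \<Longrightarrow> \<bar>of_int q * f i - of_int (k i)\<bar> < 1 / real m"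
      using Dirichlet_approx_simult[of m 4 f] m0 by auto
    have close: "\<bar>of_int q * y - of_int (k i)\<bar> \<le> 1 / of_nat m" if "i < 4" "f i = real_of_rat y" for i y
    proof -
      have "real_of_rat (of_int q * y - of_int (k i)) < real_of_rat (1 / of_nat m)"
        "real_of_rat (- (of_int q * y - of_int (k i))) < real_of_rat (1 / of_nat m)"
        using q(3)[OF that(1)] by (auto simp: that(2) of_rat_mult of_rat_diff of_rat_divide of_rat_minus abs_less_iff)
      then show ?thesis unfolding of_rat_less by linarith
    qed
    let ?t = "nat q" and ?w = "el \<theta> (of_int (k 0)) (of_int (k 1)) (of_int (k 2)) (of_int (k 3))"
    have "of_nat ?t * x - ?w = el \<theta> (of_int q * a - of_int (k 0)) (of_int q * b - of_int (k 1)) (of_int q * c - of_int (k 2)) (of_int q * d - of_int (k 3))"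
      using q(1) unfolding x by (simp add: el_def of_rat_mult of_rat_diff algebra_simps)
    then have "\<bar>N (of_nat ?t * x - ?w)\<bar> \<le> ?C * (1 / of_nat m) ^ 4"
      by (simp only: N_el) (intro nrm_bound close, simp_all add: f_def)
    also have "\<dots> < 1"
    proof -
      have "?C < of_nat m ^ 4"
        using m m0 self_le_power[of m 4] by (metis less_le_trans of_nat_le_iff of_nat_power zero_less_numeral One_nat_def Suc_leI)
      then show ?thesis using m0 by (simp add: power_divide)
    qed
    finally have "\<bar>N (of_nat ?t * x - ?w)\<bar> < 1" .
    moreover have "?t \<in> {1..m ^ 4}" using q(1,2) by (simp add: nat_le_iff Suc_le_eq)
    moreover have "?w \<in> Z\<theta>" by (auto simp: Z\<theta>_def)
    ultimately show "\<exists>t\<in>{1..m ^ 4}. \<exists>w\<in>Z\<theta>. \<bar>N (of_nat t * x - w)\<bar> < 1" by blast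
  qed
qed

end

section \<open>Finiteness of the class group\<close>

context quartic_field
begin

lemma Z\<theta>_mult_int: "z \<in> Z\<theta> \<Longrightarrow> of_int k * z \<in> Z\<theta>"
proof -
  assume "z \<in> Z\<theta>"
  then obtain A B C D where z: "z = el \<theta> (of_int A) (of_int B) (of_int C) (of_int D)" by (auto simp: Z\<theta>_def)
  have "of_int k * z = el \<theta> (of_int (k * A)) (of_int (k * B)) (of_int (k * C)) (of_int (k * D))"
    unfolding z el_def of_rat_of_int_eq by (simp add: algebra_simps)
  then show ?thesis unfolding Z\<theta>_def by blast
qed

lemma integers_diff: "x \<in> ring_of_integers K \<Longrightarrow> y \<in> ring_of_integers K \<Longrightarrow> x - y \<in> ring_of_integers K"
  using algebraic_int_add[of x "- y"] K_diff by (auto simp: ring_of_integers_def)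

lemma Z\<theta>_integers: "z \<in> Z\<theta> \<Longrightarrow> z \<in> ring_of_integers K"
  by (simp add: ring_of_integers_def Z\<theta>_subset_K Z\<theta>_algebraic_int)

lemma of_int_integers: "of_int k \<in> ring_of_integers K"
  by (rule Z\<theta>_integers[OF Z\<theta>_of_int])

text \<open>For a nonzero \<open>\<beta>\<close> of least norm in \<open>I\<close>, the element
  \<open>t * x - w * \<beta>\<close> of \<open>I\<close> has a smaller norm and so vanishes; thus
  \<open>t * x\<close> lies in \<open>Z\<theta> * \<beta>\<close> for some \<open>t\<close> up to
  the approximation bound. The factorial of that bound is a common multiple of all these
  \<open>t\<close>, which gives a constant independent of \<open>I\<close>.\<close>

lemma fractional_ideal_between:
  obtains M :: nat where "M > 0"
    "\<And>I. fractional_ideal K I \<Longrightarrow> \<exists>a\<in>K. a \<noteq> 0 \<and> (\<forall>x\<in>I. a * x \<in> Z\<theta>) \<and> (\<forall>z\<in>Z\<theta>. of_nat M * z \<in> (\<lambda>x. a * x) ` I)"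
proof -
  obtain M :: nat where M: "M > 0"
    "\<And>x. x \<in> K \<Longrightarrow> \<exists>t\<in>{1..M}. \<exists>w\<in>Z\<theta>. \<bar>N (of_nat t * x - w)\<bar> < 1"
    using approximation by blast
  show thesis
  proof (rule that[of "fact M"])
    show "(fact M :: nat) > 0" by simp
    fix I assume I: "fractional_ideal K I"
    have IK: "x \<in> K" if "x \<in> I" for x using I that by (auto simp: fractional_ideal_def)
    have add: "x + y \<in> I" if "x \<in> I" "y \<in> I" for x y using I that by (auto simp: fractional_ideal_def)
    have mult: "a * x \<in> I" if "a \<in> ring_of_integers K" "x \<in> I" for a x using I that by (auto simp: fractional_ideal_def)
    obtain x0 where x0: "x0 \<in> I" "x0 \<noteq> 0" using I by (auto simp: fractional_ideal_def)
    obtain d where d: "d \<in> ring_of_integers K" "d \<noteq> 0" "\<And>x. x \<in> I \<Longrightarrow> d * x \<in> ring_of_integers K"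
      using I unfolding fractional_ideal_def by blast
    \<comment> \<open>\<open>d\<close> clears the denominators of \<open>I\<close>, so the norms
      compared are integers and a least one exists.\<close>
    define f where "f y = nat \<lfloor>\<bar>N (d * y)\<bar>\<rfloor>" for y
    obtain \<beta> where \<beta>: "\<beta> \<in> I" "\<beta> \<noteq> 0" and least: "\<And>y. y \<in> I \<Longrightarrow> y \<noteq> 0 \<Longrightarrow> f \<beta> \<le> f y"
      using ex_has_least_nat[of "\<lambda>y. y \<in> I \<and> y \<noteq> 0" x0 f] x0 by blast
    let ?a = "of_nat (fact M) * inverse \<beta> :: real"
    have "?a \<in> K" using K_mult[OF K_of_int[of "fact M"] K_inverse[OF IK[OF \<beta>(1)]]] by simp
    moreover have "?a \<noteq> 0" using \<beta>(2) by simp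
    moreover have "?a * x \<in> Z\<theta>" if x: "x \<in> I" for x
    proof -
      have "x * inverse \<beta> \<in> K" using x \<beta> by (intro K_mult K_inverse IK)
      then obtain t w where t: "t \<in> {1..M}" and w: "w \<in> Z\<theta>" and lt: "\<bar>N (of_nat t * (x * inverse \<beta>) - w)\<bar> < 1"
        using M(2) by blast
      let ?z = "of_nat t * (x * inverse \<beta>) - w"
      let ?y = "of_nat t * x + (- 1 * w) * \<beta>"
      have y: "?y = \<beta> * ?z" using \<beta>(2) by (simp add: algebra_simps)
      have "of_int (int t) * x + (of_int (- 1) * w) * \<beta> \<in> I"
        by (intro add mult x \<beta> of_int_integers Z\<theta>_integers Z\<theta>_mult_int w)
      then have yI: "?y \<in> I" by simp
      have "?y = 0"
      proof (rule ccontr)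
        assume ny: "?y \<noteq> 0"
        have zK: "?z \<in> K" using K_diff[OF K_mult[OF K_of_int[of "int t"] \<open>x * inverse \<beta> \<in> K\<close>] Z\<theta>_subset_K[OF w]] by simp
        have dK: "d * \<beta> \<in> K" using d(3)[OF \<beta>(1)] by (simp add: ring_of_integers_def)
        have "N (d * ?y) = N (d * \<beta>) * N ?z" unfolding y using N_mult[OF dK zK] by (simp add: mult.assoc)
        moreover have "N (d * \<beta>) \<noteq> 0" using N_eq_0D[OF dK] d(2) \<beta>(2) by auto
        ultimately have "\<bar>N (d * ?y)\<bar> < \<bar>N (d * \<beta>)\<bar>" using lt by (simp add: abs_mult mult_less_cancel_left1)
        moreover have "N (d * ?y) \<in> \<int>" "N (d * \<beta>) \<in> \<int>"
          using d(3)[OF yI] d(3)[OF \<beta>(1)] N_int by (auto simp: ring_of_integers_def)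
        ultimately have "f ?y < f \<beta>"
          unfolding f_def by (elim Ints_cases) (simp del: of_int_abs add: of_int_abs[symmetric])
        then show False using least[OF yI ny] by simp
      qed
      then have eq: "of_nat t * x = w * \<beta>" by simp
      obtain k where k: "(fact M :: nat) = t * k" using t dvd_fact[of t M] by (auto elim: dvdE)
      have "?a * x = of_nat k * (of_nat t * x) * inverse \<beta>" unfolding k by simp
      also have "\<dots> = of_int (int k) * w" unfolding eq using \<beta>(2) by simp
      finally show ?thesis using Z\<theta>_mult_int[OF w, of "int k"] by (simp only:)
    qed
    moreover have "of_nat (fact M) * z \<in> (\<lambda>x. ?a * x) ` I" if z: "z \<in> Z\<theta>" for z
    proof (rule image_eqI)
      show "of_nat (fact M) * z = ?a * (z * \<beta>)" using \<beta>(2) by simp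
      show "z * \<beta> \<in> I" by (rule mult[OF Z\<theta>_integers[OF z] \<beta>(1)])
    qed
    ultimately show "\<exists>a\<in>K. a \<noteq> 0 \<and> (\<forall>x\<in>I. a * x \<in> Z\<theta>) \<and> (\<forall>z\<in>Z\<theta>. of_nat (fact M) * z \<in> (\<lambda>x. a * x) ` I)"
      by blast
  qed
qed

lemma Z\<theta>_remainder:
  assumes M: "M > 0" and z: "z \<in> Z\<theta>"
  obtains r w where "z = r + of_nat M * w" "w \<in> Z\<theta>"
    "r \<in> (\<lambda>(A, B, C, D). el \<theta> (of_int A) (of_int B) (of_int C) (of_int D)) ` ({0..<int M} \<times> {0..<int M} \<times> {0..<int M} \<times> {0..<int M})"
proof -
  obtain A B C D where e: "z = el \<theta> (of_int A) (of_int B) (of_int C) (of_int D)" using z by (auto simp: Z\<theta>_def)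
  let ?m = "int M"
  let ?r = "el \<theta> (of_int (A mod ?m)) (of_int (B mod ?m)) (of_int (C mod ?m)) (of_int (D mod ?m))"
  let ?w = "el \<theta> (of_int (A div ?m)) (of_int (B div ?m)) (of_int (C div ?m)) (of_int (D div ?m))"
  have dm: "real_of_int k = real_of_int (k mod ?m) + real M * real_of_int (k div ?m)" for k
    by (metis mod_mult_div_eq of_int_add of_int_mult of_int_of_nat_eq)
  have "z = ?r + of_nat M * ?w"
    unfolding e el_def of_rat_of_int_eq by (subst (1 2 3 4) dm) (simp add: algebra_simps)
  moreover have "?w \<in> Z\<theta>" by (auto simp: Z\<theta>_def)
  ultimately show thesis by (rule that) (use M in \<open>auto intro!: image_eqI[where x = "(A mod ?m, B mod ?m, C mod ?m, D mod ?m)"]\<close>)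
qed

lemma Z\<theta>_zspan: "z \<in> Z\<theta> \<Longrightarrow> z \<in> zspan {1, \<theta>, \<theta>\<^sup>2, \<theta> ^ 3}"
proof -
  assume "z \<in> Z\<theta>"
  then obtain A B C D where e: "z = of_int A * 1 + of_int B * \<theta> + of_int C * \<theta>\<^sup>2 + of_int D * \<theta> ^ 3"
    by (auto simp: Z\<theta>_def el_def)
  show ?thesis unfolding e by (intro zspan_add zspan_of_int_mult zspan.base) auto
qed

lemma powers_in_Z\<theta>: "b \<in> {1, \<theta>, \<theta>\<^sup>2, \<theta> ^ 3} \<Longrightarrow> b \<in> Z\<theta>"
proof -
  have "1 = el \<theta> (of_int 1) (of_int 0) (of_int 0) (of_int 0)" "\<theta> = el \<theta> (of_int 0) (of_int 1) (of_int 0) (of_int 0)"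
    "\<theta>\<^sup>2 = el \<theta> (of_int 0) (of_int 0) (of_int 1) (of_int 0)" "\<theta> ^ 3 = el \<theta> (of_int 0) (of_int 0) (of_int 0) (of_int 1)"
    by (simp_all add: el_def)
  then show "b \<in> {1, \<theta>, \<theta>\<^sup>2, \<theta> ^ 3} \<Longrightarrow> b \<in> Z\<theta>" unfolding Z\<theta>_def by blast
qed

text \<open>A suitable multiple \<open>a * I\<close> lies between \<open>M * Z\<theta>\<close> and
  \<open>Z\<theta>\<close>, so it is a union of residue classes modulo \<open>M\<close>. Its
  representatives in the finite set \<open>R\<close> determine it, and together with the multiples
  \<open>M * \<theta> ^ i\<close> they generate it.\<close>

lemma ideal_theory_K: "ideal_theory K"
proof
  show "1 \<in> K" using K_of_int[of 1] by simp
  show "x - y \<in> K" "x * y \<in> K" if "x \<in> K" "y \<in> K" for x y using that K_diff K_mult by auto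
  show "inverse x \<in> K" if "x \<in> K" for x using that by (rule K_inverse)
  show "\<exists>d\<in>ring_of_integers K. d \<noteq> 0 \<and> d * x \<in> ring_of_integers K" if x: "x \<in> K" for x
  proof -
    obtain a b c d where e: "x = el \<theta> a b c d" using x by (rule K_cases)
    obtain D A B C E :: int where D: "D > 0" "a = of_int A / of_int D" "b = of_int B / of_int D"
      "c = of_int C / of_int D" "d = of_int E / of_int D"
      by (rule rat_common_denominator)
    have "of_int D * x = el \<theta> (of_int A) (of_int B) (of_int C) (of_int E)"
      unfolding e el_def D(2-5) of_rat_divide of_rat_of_int_eq using D(1) by (simp add: field_simps)
    then have "of_int D * x \<in> Z\<theta>" by (auto simp: Z\<theta>_def)
    then show ?thesis using D(1) by (intro bexI[of _ "of_int D"] conjI Z\<theta>_integers Z\<theta>_of_int) auto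
  qed
  obtain M :: nat where M: "M > 0"
    "\<And>I. fractional_ideal K I \<Longrightarrow> \<exists>a\<in>K. a \<noteq> 0 \<and> (\<forall>x\<in>I. a * x \<in> Z\<theta>) \<and> (\<forall>z\<in>Z\<theta>. of_nat M * z \<in> (\<lambda>x. a * x) ` I)"
    using fractional_ideal_between by blast
  define R where "R = (\<lambda>(A, B, C, D). el \<theta> (of_int A) (of_int B) (of_int C) (of_int D)) ` ({0..<int M} \<times> {0..<int M} \<times> {0..<int M} \<times> {0..<int M})"
  have finR: "finite R" by (simp add: R_def)
  have diff: "x - y \<in> I" if I: "fractional_ideal K I" and xy: "x \<in> I" "y \<in> I" for I x y
  proof -
    have "x + of_int (- 1) * y \<in> I"
      using I xy of_int_integers[of "- 1"] unfolding fractional_ideal_def by blast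
    then show ?thesis by simp
  qed
  have split: "\<exists>r\<in>R. \<exists>w\<in>Z\<theta>. a * x = r + of_nat M * w \<and> r \<in> (\<lambda>x. a * x) ` I"
    if I: "fractional_ideal K I" and a: "\<forall>x\<in>I. a * x \<in> Z\<theta>" "\<forall>z\<in>Z\<theta>. of_nat M * z \<in> (\<lambda>x. a * x) ` I" and x: "x \<in> I" for I a x
  proof -
    have "a * x \<in> Z\<theta>" using a(1) x by blast
    then obtain r w where rw: "a * x = r + of_nat M * w" "w \<in> Z\<theta>" "r \<in> R"
      by (rule Z\<theta>_remainder[OF M(1)]) (simp only: R_def)
    obtain y where y: "y \<in> I" "of_nat M * w = a * y" using a(2) rw(2) by blast
    have "r = a * (x - y)" using rw(1) y(2) by (simp add: algebra_simps)
    then have "r \<in> (\<lambda>x. a * x) ` I" using diff[OF I x y(1)] by blast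
    then show ?thesis using rw by blast
  qed
  show "\<exists>B. finite B \<and> B \<subseteq> I \<and> I \<subseteq> zspan B" if I: "fractional_ideal K I" for I
  proof -
    obtain a where a: "a \<in> K" "a \<noteq> 0" "\<forall>x\<in>I. a * x \<in> Z\<theta>" "\<forall>z\<in>Z\<theta>. of_nat M * z \<in> (\<lambda>x. a * x) ` I"
      using M(2)[OF I] by blast
    define B where "B = (\<lambda>y. inverse a * y) ` (R \<inter> (\<lambda>x. a * x) ` I \<union> (\<lambda>z. of_nat M * z) ` {1, \<theta>, \<theta>\<^sup>2, \<theta> ^ 3})"
    have "finite B" using finR by (simp add: B_def)
    moreover have "B \<subseteq> I"
    proof
      fix b assume "b \<in> B"
      then obtain y where y: "b = inverse a * y" "y \<in> (\<lambda>x. a * x) ` I"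
        using a(4) powers_in_Z\<theta> unfolding B_def by blast
      then obtain x where "x \<in> I" "y = a * x" by blast
      then show "b \<in> I" using a(2) y(1) by (simp add: mult.assoc[symmetric])
    qed
    moreover have "I \<subseteq> zspan B"
    proof
      fix x assume x: "x \<in> I"
      obtain r w where rw: "r \<in> R" "w \<in> Z\<theta>" "a * x = r + of_nat M * w" "r \<in> (\<lambda>x. a * x) ` I"
        using split[OF I a(3,4) x] by blast
      have "inverse a * r \<in> zspan B" using rw by (intro zspan.base) (auto simp: B_def)
      moreover have "(inverse a * of_nat M) * w \<in> zspan B"
        by (rule zspan_mult_closed[OF _ Z\<theta>_zspan[OF rw(2)]]) (auto simp: B_def mult.assoc intro!: zspan.base)
      moreover have "x = inverse a * r + (inverse a * of_nat M) * w"
        using a(2) rw(3) by (simp add: field_simps)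
      ultimately show "x \<in> zspan B" using zspan_add by metis
    qed
    ultimately show ?thesis by blast
  qed
  let ?F = "(\<lambda>S. {r + of_nat M * w | r w. r \<in> S \<and> w \<in> Z\<theta>}) ` Pow R"
  show "\<exists>F. finite F \<and> (\<forall>I. fractional_ideal K I \<longrightarrow> (\<exists>a\<in>K. a \<noteq> 0 \<and> (\<lambda>x. a * x) ` I \<in> F))"
  proof (intro exI[of _ ?F] conjI allI impI)
    show "finite ?F" using finR by simp
    fix I assume I: "fractional_ideal K I"
    obtain a where a: "a \<in> K" "a \<noteq> 0" "\<forall>x\<in>I. a * x \<in> Z\<theta>" "\<forall>z\<in>Z\<theta>. of_nat M * z \<in> (\<lambda>x. a * x) ` I"
      using M(2)[OF I] by blast
    let ?S = "R \<inter> (\<lambda>x. a * x) ` I"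
    have eq: "(\<lambda>x. a * x) ` I = {r + of_nat M * w | r w. r \<in> ?S \<and> w \<in> Z\<theta>}"
    proof (intro equalityI subsetI)
      fix y assume "y \<in> (\<lambda>x. a * x) ` I"
      then show "y \<in> {r + of_nat M * w | r w. r \<in> ?S \<and> w \<in> Z\<theta>}" using split[OF I a(3,4)] by blast
    next
      fix y assume "y \<in> {r + of_nat M * w | r w. r \<in> ?S \<and> w \<in> Z\<theta>}"
      then obtain r w where rw: "y = r + of_nat M * w" "r \<in> (\<lambda>x. a * x) ` I" "w \<in> Z\<theta>" by blast
      obtain u where u: "u \<in> I" "r = a * u" using rw(2) by blast
      obtain v where v: "v \<in> I" "of_nat M * w = a * v" using a(4) rw(3) by blast
      have "u + v \<in> I" using I u v by (auto simp: fractional_ideal_def)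
      moreover have "y = a * (u + v)" using rw(1) u v by (simp add: distrib_left)
      ultimately show "y \<in> (\<lambda>x. a * x) ` I" by blast
    qed
    have "(\<lambda>x. a * x) ` I \<in> ?F" by (rule image_eqI[where x = ?S], rule eq, blast)
    then show "\<exists>a\<in>K. a \<noteq> 0 \<and> (\<lambda>x. a * x) ` I \<in> ?F" using a by blast
  qed
qed

end

section \<open>An ideal class of even order\<close>

lemma fermat_int:
  fixes a :: int
  assumes p: "Factorial_Ring.prime p" and a: "\<not> int p dvd a"
  shows "[a ^ (p - 1) = 1] (mod int p)" 
proof -
  define b where "b = nat (a mod int p)"
  have b: "int b = a mod int p" using prime_gt_0_nat[OF p] by (simp add: b_def)
  have "\<not> p dvd b" using a b by (metis dvd_mod_iff dvd_refl int_dvd_int_iff)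
  then have "[b ^ (p - 1) = 1] (mod p)" by (rule fermat_theorem[OF p])
  then have "[int b ^ (p - 1) = 1] (mod int p)" by (metis cong_int_iff of_nat_1 of_nat_power)
  moreover have "[a = int b] (mod int p)" unfolding b by (simp add: unique_euclidean_semiring_class.cong_def)
  ultimately show ?thesis using cong_pow cong_trans by blast
qed

text \<open>If \<open>p\<close> is congruent to \<open>s ^ 2\<close> modulo \<open>r\<close>, then
  \<open>s ^ ((r + 1) div 4)\<close> is the fourth root sought, since its fourth power is
  \<open>s ^ (r - 1) * s ^ 2\<close>; the exponent is integral because
  \<open>r mod 4 = 3\<close>.\<close>

lemma quartic_residue_reciprocity:
  assumes p: "Factorial_Ring.prime p" "p mod 8 = 1" and r: "Factorial_Ring.prime r" "r mod 4 = 3"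
    and quarter: "[int r ^ ((p - 1) div 4) = -1] (mod int p)"
  obtains a where "[a ^ 4 = int p] (mod int r)"
proof -
  have neq: "r \<noteq> p" using p r by presburger
  have p2: "p > 2" and r2: "r > 2" using p r prime_gt_1_nat[of p] prime_gt_1_nat[of r] by presburger+
  have "(p - 1) div 2 = ((p - 1) div 4) * 2" using p(2) by presburger
  then have "[int r ^ ((p - 1) div 2) = (-1) ^ 2] (mod int p)"
    using cong_pow[OF quarter, of 2] by (simp add: power_mult)
  then have L: "[Legendre (int r) (int p) = 1] (mod int p)"
    using euler_criterion[OF p(1) p2, of "int r"] by (simp add: cong_trans)
  then have Lrp: "Legendre (int r) (int p) = 1"
  proof -
    have "Legendre (int r) (int p) \<in> {0, 1, -1}" by (simp add: Legendre_def)
    moreover have "\<not> [0 = 1] (mod int p)" "\<not> [-1 = 1] (mod int p)"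
      using p2 by (auto simp: cong_iff_dvd_diff zdvd_not_zless dest: zdvd_imp_le)
    ultimately show ?thesis using L by auto
  qed
  have "even (((p - 1) div 2) * ((r - 1) div 2))" using p(2) by (simp, presburger)
  then have "Legendre (int p) (int r) * Legendre (int r) (int p) = 1"
    using Quadratic_Reciprocity[OF p(1) p2 r(1) r2 neq[symmetric]] by simp
  then have "Legendre (int p) (int r) = 1" using Lrp by simp
  then have "QuadRes (int r) (int p)" by (auto simp: Legendre_def split: if_splits)
  then obtain s where s: "[s ^ 2 = int p] (mod int r)" by (auto simp: QuadRes_def)
  have "\<not> int r dvd int p" using p r neq by (metis int_dvd_int_iff primes_dvd_imp_eq)
  then have "\<not> int r dvd s" using s by (metis cong_dvd_iff dvd_power pos2 dvd_trans)
  then have fermat: "[s ^ (r - 1) = 1] (mod int r)" by (rule fermat_int[OF r(1)])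
  have "(s ^ ((r + 1) div 4)) ^ 4 = s ^ (r + 1)"
    using r(2) by (simp only: power_mult[symmetric]) (rule arg_cong[of _ _ "\<lambda>k. s ^ k"], presburger)
  also have "r + 1 = (r - 1) + 2" using r2 by simp
  also have "s ^ ((r - 1) + 2) = s ^ (r - 1) * s ^ 2" by (rule power_add)
  also have "[\<dots> = 1 * int p] (mod int r)" using fermat s by (rule cong_mult)
  finally show thesis using that by simp
qed

text \<open>If \<open>r ^ 2\<close> divides \<open>a ^ 4 - p\<close>, passing from \<open>a\<close>
  to \<open>a + r\<close> changes the quotient by \<open>4 * a ^ 3\<close> modulo \<open>r\<close>,
  which is a unit. Exact divisibility makes \<open>r\<close> and \<open>m\<close> coprime, and this
  yields an explicit complement to the ideal \<open>(r, \<theta> - b)\<close>, with product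
  \<open>(r)\<close>.\<close>

lemma quartic_root_exact:
  assumes p: "Factorial_Ring.prime p" and r: "Factorial_Ring.prime r" "odd r" "r \<noteq> p" and a: "[a ^ 4 = int p] (mod int r)"
  obtains b m where "b ^ 4 - int p = int r * m" "\<not> int r dvd m"
proof -
  obtain m where m: "a ^ 4 - int p = int r * m" using a by (auto simp: cong_iff_dvd_diff)
  show thesis
  proof (cases "int r dvd m")
    case False
    then show ?thesis using that m by blast
  next
    case True
    have pr: "Factorial_Ring.prime (int r)" using r by simp
    have "\<not> int r dvd int p" using p r by (metis int_dvd_int_iff primes_dvd_imp_eq)
    then have "\<not> int r dvd a ^ 4" using a cong_dvd_iff by blast
    then have na: "\<not> int r dvd a" by (meson dvd_power dvd_trans zero_less_numeral)
    have "\<not> int r dvd 4"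
    proof
      assume "int r dvd 4"
      then have "int r dvd 2 ^ 2" by simp
      then have "int r dvd 2" using pr prime_dvd_power by blast
      then have "r dvd 2" by presburger
      then show False using r(1,2) by (metis primes_dvd_imp_eq two_is_prime_nat even_numeral dvd_refl)
    qed
    then have n4: "\<not> int r dvd 4 * a ^ 3"
      using na pr by (metis prime_dvd_mult_iff prime_dvd_power)
    let ?k = "m + 4 * a ^ 3 + int r * (6 * a\<^sup>2 + 4 * a * int r + (int r)\<^sup>2)"
    have "(a + int r) ^ 4 - int p = int r * ?k"
    proof -
      have "(a + int r) ^ 4 - int p = (a ^ 4 - int p) + int r * (4 * a ^ 3 + int r * (6 * a\<^sup>2 + 4 * a * int r + (int r)\<^sup>2))"
        by (simp add: eval_nat_numeral algebra_simps)
      then show ?thesis unfolding m by (simp add: algebra_simps)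
    qed
    moreover have "\<not> int r dvd ?k"
      using True n4 by (simp add: dvd_add_left_iff dvd_add_right_iff)
    ultimately show ?thesis using that by blast
  qed
qed

text \<open>Does the work of ideal norms: \<open>x\<close> and \<open>y\<close> are powers of
  \<open>r\<close> up to sign, with exponents at most \<open>h\<close> and \<open>k\<close> because
  \<open>m\<close> is prime to \<open>r\<close>, while these exponents add up to at least
  \<open>h + k\<close>.\<close>

lemma prime_power_exact:
  fixes r x y m w :: int
  assumes r: "Factorial_Ring.prime r" and m: "\<not> r dvd m"
    and x: "x dvd (r * m) ^ h" and y: "y dvd (r * m) ^ k" and xy: "x * y = r ^ (h + k) * w" and dvd: "x dvd r ^ n" "y dvd r ^ n'"
  shows "\<bar>x\<bar> = r ^ h"
proof -
  have cop: "coprime r (m ^ i)" for i using r m prime_imp_coprime coprime_power_right_iff by blast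
  have r1: "r > 1" using r prime_gt_1_int by blast
  have pw: "\<exists>j\<le>i. \<bar>z\<bar> = r ^ j" if z: "z dvd r ^ l" "z dvd (r * m) ^ i" for z l i
  proof -
    obtain j where j: "\<bar>z\<bar> = r ^ j"
    proof -
      have "\<bar>z\<bar> dvd r ^ l" using z by simp
      then show ?thesis using that divides_primepow[OF r, of "\<bar>z\<bar>" l] by auto
    qed
    have "r ^ j dvd r ^ i * m ^ i" using z(2) j by (metis abs_dvd_iff power_mult_distrib)
    moreover have "coprime (r ^ j) (m ^ i)" using cop by simp
    ultimately have "r ^ j dvd r ^ i" using coprime_dvd_mult_left_iff by blast
    then have "j \<le> i" using r1 by (simp add: dvd_power_iff)
    then show ?thesis using j by blast
  qed
  obtain i where i: "i \<le> h" "\<bar>x\<bar> = r ^ i" using pw[OF dvd(1) x] by blast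
  obtain j where j: "j \<le> k" "\<bar>y\<bar> = r ^ j" using pw[OF dvd(2) y] by blast
  have "r ^ (h + k) dvd \<bar>x * y\<bar>" unfolding xy by simp
  then have "r ^ (h + k) dvd r ^ (i + j)" by (simp add: abs_mult i j power_add)
  then have "h + k \<le> i + j" using r1 by (simp add: dvd_power_iff)
  then have "i = h" using i(1) j(1) by linarith
  then show ?thesis using i(2) by simp
qed

lemma (in ideal_theory) iprod_subset_O: "I \<subseteq> \<O> \<Longrightarrow> J \<subseteq> \<O> \<Longrightarrow> I \<odot> J \<subseteq> \<O>"
proof
  fix x assume "I \<subseteq> \<O>" "J \<subseteq> \<O>" "x \<in> I \<odot> J"
  from this(3,1,2) show "x \<in> \<O>"
    by (induction rule: iprod_induct) (auto intro: O_mult O_add)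
qed

lemma (in ideal_theory) pow_subset_O: "I \<subseteq> \<O> \<Longrightarrow> I [^]\<^bsub>G\<^esub> (n::nat) \<subseteq> \<O>"
  by (induction n) (simp_all add: ideal_group_simps iprod_subset_O)

lemma (in ideal_theory) fractional_ideal_two_generators:
  assumes u: "u \<in> \<O>" "u \<noteq> 0" and v: "v \<in> \<O>"
  defines "J \<equiv> {x * u + y * v | x y. x \<in> \<O> \<and> y \<in> \<O>}"
  shows "fractional_ideal K J" "u \<in> J" "v \<in> J" "J \<subseteq> \<O>"
proof -
  have mem: "x * u + y * v \<in> J" if "x \<in> \<O>" "y \<in> \<O>" for x y using that by (auto simp: J_def)
  show uJ: "u \<in> J" using mem[OF O_1 O_0] by simp
  show "v \<in> J" using mem[OF O_0 O_1] by simp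
  show sub: "J \<subseteq> \<O>" using u v by (auto simp: J_def intro!: O_add O_mult)
  show "fractional_ideal K J"
  proof (rule fractional_idealI[OF _ _ uJ u(2) _ _ O_1])
    show "J \<subseteq> K" using sub by (auto simp: ring_of_integers_def)
    show "0 \<in> J" using mem[OF O_0 O_0] by simp
    show "a + b \<in> J" if ab: "a \<in> J" "b \<in> J" for a b
    proof -
      obtain x y x' y' where e: "a = x * u + y * v" "b = x' * u + y' * v" "x \<in> \<O>" "y \<in> \<O>" "x' \<in> \<O>" "y' \<in> \<O>"
        using ab unfolding J_def by blast
      have "a + b = (x + x') * u + (y + y') * v" by (simp add: e algebra_simps)
      then show ?thesis using mem[OF O_add[OF e(3,5)] O_add[OF e(4,6)]] by simp
    qed
    show "a * b \<in> J" if ab: "a \<in> \<O>" "b \<in> J" for a b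
    proof -
      obtain x y where e: "b = x * u + y * v" "x \<in> \<O>" "y \<in> \<O>" using ab unfolding J_def by blast
      have "a * b = (a * x) * u + (a * y) * v" by (simp add: e algebra_simps)
      then show ?thesis using mem[OF O_mult[OF ab(1) e(2)] O_mult[OF ab(1) e(3)]] by simp
    qed
    show "1 * a \<in> \<O>" if "a \<in> J" for a using that sub by auto
  qed simp
qed

lemma (in ideal_theory) principal_subset_imp:
  assumes "(\<lambda>x. a * x) ` \<O> \<subseteq> \<O>" shows "a \<in> \<O>"
  using assms O_1 by force

section \<open>The ideal over \<open>r\<close> and the parity of the class number\<close>

context quartic_field
begin

lemma N_theta_minus: "N (\<theta> - of_int a) = of_int (a ^ 4 - int p)"
proof -
  have "\<theta> - of_int a = el \<theta> (of_int (- a)) 1 0 0" by (simp add: el_def of_rat_minus)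
  then have "N (\<theta> - of_int a) = nrm (of_nat p) (of_int (- a)) 1 0 0" by (simp only: N_el)
  also have "\<dots> = of_int (a ^ 4 - int p)" by (simp add: nrm_def nrm_u_def nrm_v_def)
  finally show ?thesis .
qed

lemma int_N:
  assumes "x \<in> ring_of_integers K"
  obtains n where "N x = of_int n"
  using N_int assms Ints_cases unfolding ring_of_integers_def by blast

text \<open>Every norm \<open>n\<close> of an integral element is, up to the factor \<open>256 = 4 ^ 4\<close>, a fourth power modulo \<open>p\<close>;
  for \<open>n = \<plusminus> r ^ h\<close> this contradicts the choice of \<open>r\<close> when \<open>h\<close> is odd, because \<open>- 1\<close> is a fourth power.\<close>

lemma even_if_norm_prime_power:
  assumes p8: "p mod 8 = 1" and quarter: "[r ^ ((p - 1) div 4) = -1] (mod int p)"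
    and x: "x \<in> ring_of_integers K" "N x = of_int n" "\<bar>n\<bar> = r ^ h" and r: "\<not> int p dvd r"
  shows "even h"
proof (rule ccontr)
  assume h: "odd h"
  let ?q = "(p - 1) div 4"
  have q: "even ?q" "4 * ?q = p - 1" using p8 by presburger+
  have p2: "p > 2" using p8 prime_gt_1_nat[OF p] by presburger
  have pp: "Factorial_Ring.prime (int p)" using p by simp
  obtain n' A where "N x = of_int n'" "[256 * n' = A ^ 4] (mod int p)"
    using N_quartic_residue x(1) unfolding ring_of_integers_def by blast
  then have A: "[256 * n = A ^ 4] (mod int p)" using x(2) by simp
  have n2: "\<not> int p dvd 2"
  proof
    assume "int p dvd 2"
    then have "int p \<le> 2" by (rule zdvd_imp_le) simp
    then show False using p2 by simp
  qed
  have "\<not> int p dvd n"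
  proof
    assume "int p dvd n"
    then have "int p dvd r ^ h" using x(3) by (metis dvd_abs_iff)
    then show False using r prime_dvd_power[OF pp] by blast
  qed
  moreover have "\<not> int p dvd 256"
  proof
    assume "int p dvd 256"
    then have "int p dvd 2 ^ 8" by simp
    then show False using n2 prime_dvd_power[OF pp] by blast
  qed
  ultimately have "\<not> int p dvd 256 * n" using pp prime_dvd_mult_iff by blast
  then have "\<not> int p dvd A ^ 4" using A cong_dvd_iff by blast
  then have nA: "\<not> int p dvd A" by (meson dvd_power dvd_trans zero_less_numeral)
  have "[(256 * n) ^ ?q = (A ^ 4) ^ ?q] (mod int p)" by (rule cong_pow[OF A])
  also have "(A ^ 4) ^ ?q = A ^ (p - 1)" using q(2) by (metis power_mult)
  also have "[A ^ (p - 1) = 1] (mod int p)" by (rule fermat_int[OF p nA])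
  finally have 1: "[(256 * n) ^ ?q = 1] (mod int p)" .
  have "(256 :: int) ^ ?q = 4 ^ (p - 1)"
  proof -
    have "(256 :: int) = 4 ^ 4" by simp
    then show ?thesis using q(2) by (metis power_mult)
  qed
  moreover have "\<not> int p dvd 4"
  proof
    assume "int p dvd 4"
    then have "int p dvd 2 ^ 2" by simp
    then show False using n2 prime_dvd_power[OF pp] by blast
  qed
  then have "[4 ^ (p - 1) = 1] (mod int p)" by (rule fermat_int[OF p])
  ultimately have 2: "[256 ^ ?q = 1] (mod int p)" by simp
  have "n ^ ?q = \<bar>n\<bar> ^ ?q" using q(1) by (simp add: power_even_abs)
  also have "\<dots> = (r ^ ?q) ^ h" unfolding x(3) by (metis power_mult mult.commute)
  finally have "[n ^ ?q = (-1) ^ h] (mod int p)" using cong_pow[OF quarter, of h] by simp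
  then have "[256 ^ ?q * n ^ ?q = 1 * (-1) ^ h] (mod int p)" by (rule cong_mult[OF 2])
  then have "[1 = -1] (mod int p)"
    using 1 h by (simp add: power_mult_distrib) (meson cong_sym cong_trans)
  then have "int p dvd 2" by (simp add: cong_iff_dvd_diff)
  then show False using n2 by blast
qed

text \<open>The ideals \<open>J = (r, u)\<close> and \<open>J' = (r, v)\<close> have product
  \<open>(r)\<close>. Generators \<open>\<gamma>\<close> and \<open>\<gamma>'\<close> of their
  \<open>h\<close>-th powers divide \<open>u ^ h\<close> and \<open>v ^ h\<close>, and their product
  generates the same ideal as \<open>r ^ h\<close>; comparing norms leaves only
  \<open>r ^ h\<close>, up to sign, for the norm of \<open>\<gamma>\<close>.\<close>

lemma class_number_even:
  assumes p8: "p mod 8 = 1" and r: "Factorial_Ring.prime r" "r mod 4 = 3"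
    and quarter: "[int r ^ ((p - 1) div 4) = -1] (mod int p)"
  shows "even (class_number K)"
proof -
  interpret ideal_theory K by (rule ideal_theory_K)
  interpret G: comm_group G by (rule comm_group_ideal_group)
  have neq: "r \<noteq> p" using p8 r by presburger
  have "odd r" using r by presburger
  obtain a0 where "[a0 ^ 4 = int p] (mod int r)" by (rule quartic_residue_reciprocity[OF p p8 r quarter])
  then obtain a m where am: "a ^ 4 - int p = int r * m" "\<not> int r dvd m"
    by (rule quartic_root_exact[OF p r(1) \<open>odd r\<close> neq])
  have pr: "Factorial_Ring.prime (int r)" using r by simp
  have r0: "real r \<noteq> 0" using prime_gt_0_nat[OF r(1)] by simp
  let ?s = "real_of_int a"
  define u where "u = \<theta> - ?s"
  \<comment> \<open>The cofactor in \<open>\<theta> ^ 4 - a ^ 4 = u * v\<close>.\<close>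
  define v where "v = \<theta> ^ 3 + ?s * \<theta>\<^sup>2 + ?s\<^sup>2 * \<theta> + ?s ^ 3"
  have rO: "real r \<in> \<O>" using of_int_integers[of "int r"] by simp
  have "\<theta> = el \<theta> (of_int 0) (of_int 1) (of_int 0) (of_int 0)" by (simp add: el_def)
  then have "\<theta> \<in> Z\<theta>" unfolding Z\<theta>_def by blast
  then have thO: "\<theta> \<in> \<O>" by (rule Z\<theta>_integers)
  have powO: "x ^ n \<in> \<O>" if "x \<in> \<O>" for x n using that by (induction n) (auto intro: O_1 O_mult)
  have uO: "u \<in> \<O>" unfolding u_def by (intro integers_diff thO of_int_integers)
  have vO: "v \<in> \<O>" unfolding v_def by (intro O_add O_mult powO thO of_int_integers)
  have uv: "u * v = - (real r * of_int m)"
  proof -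
    have "u * v = \<theta> ^ 4 - ?s ^ 4" unfolding u_def v_def by (simp add: eval_nat_numeral algebra_simps)
    also have "\<dots> = - of_int (a ^ 4 - int p)" by (simp add: \<theta>)
    finally show ?thesis unfolding am(1) by simp
  qed
  have inK: "x \<in> K" if "x \<in> \<O>" for x using that by (simp add: ring_of_integers_def)
  define J where "J = {x * real r + y * u | x y. x \<in> \<O> \<and> y \<in> \<O>}"
  define J' where "J' = {x * real r + y * v | x y. x \<in> \<O> \<and> y \<in> \<O>}"
  note J = fractional_ideal_two_generators[OF rO r0 uO, folded J_def]
  note J' = fractional_ideal_two_generators[OF rO r0 vO, folded J'_def]
  have JJ': "J \<odot> J' = (\<lambda>x. real r * x) ` \<O>"
  proof
    have FP: "fractional_ideal K (J \<odot> J')" by (rule fractional_ideal_prod[OF J(1) J'(1)])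
    note D = fractional_idealD[OF FP]
    have FR: "fractional_ideal K ((\<lambda>x. real r * x) ` \<O>)" by (rule fractional_ideal_principal[OF inK[OF rO] r0])
    show "J \<odot> J' \<subseteq> (\<lambda>x. real r * x) ` \<O>"
    proof
      fix z assume "z \<in> J \<odot> J'"
      then show "z \<in> (\<lambda>x. real r * x) ` \<O>"
      proof (induction rule: iprod_induct)
        case (mult c d)
        obtain x y x' y' where e: "c = x * real r + y * u" "d = x' * real r + y' * v" "x \<in> \<O>" "y \<in> \<O>" "x' \<in> \<O>" "y' \<in> \<O>"
          using mult unfolding J_def J'_def by blast
        have "c * d = real r * (x * d + y * u * x') + y * y' * (u * v)" unfolding e by (simp add: algebra_simps)
        also have "\<dots> = real r * (x * d + y * u * x' - y * y' * of_int m)" unfolding uv by (simp add: algebra_simps)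
        finally show ?case
          using e J'(4) mult(2) uO vO rO by (auto intro!: imageI integers_diff O_add O_mult of_int_integers)
      qed (rule fractional_idealD(4)[OF FR])
    qed
    \<comment> \<open>The element \<open>r\<close> is recovered from \<open>r * r\<close> and
      \<open>u * v = - r * m\<close> by Bezout, as \<open>r\<close> does not divide
      \<open>m\<close>.\<close>
    have "coprime (int r) m" using pr am(2) prime_imp_coprime by blast
    then obtain e f where ef: "e * int r + f * m = 1" by (metis bezout_int coprime_imp_gcd_eq_1)
    have rr: "real r * real r \<in> J \<odot> J'" by (rule iprod_mult[OF J(2) J'(2)])
    have uvm: "u * v \<in> J \<odot> J'" by (rule iprod_mult[OF J(3) J'(3)])
    have "of_int e * (real r * real r) - of_int f * (u * v) = real r * of_int (e * int r + f * m)"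
      unfolding uv by (simp add: algebra_simps)
    then have "real r = of_int e * (real r * real r) - of_int f * (u * v)" by (simp add: ef)
    then have "real r \<in> J \<odot> J'" using D(7)[OF D(5)[OF of_int_integers rr] D(5)[OF of_int_integers uvm]] by metis
    then show "(\<lambda>x. real r * x) ` \<O> \<subseteq> J \<odot> J'" using D(5) by (auto simp: mult.commute)
  qed
  define h where "h = class_number K"
  obtain \<gamma> where \<gamma>: "\<gamma> \<in> K" "\<gamma> \<noteq> 0" "J [^]\<^bsub>G\<^esub> h = (\<lambda>x. \<gamma> * x) ` \<O>"
    using power_class_number_principal[OF J(1)] unfolding h_def principal_fractional_ideals_def by blast
  obtain \<gamma>' where \<gamma>': "\<gamma>' \<in> K" "\<gamma>' \<noteq> 0" "J' [^]\<^bsub>G\<^esub> h = (\<lambda>x. \<gamma>' * x) ` \<O>"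
    using power_class_number_principal[OF J'(1)] unfolding h_def principal_fractional_ideals_def by blast
  have \<gamma>O: "\<gamma> \<in> \<O>" by (rule principal_subset_imp) (use pow_subset_O[OF J(4), of h] \<gamma>(3) in simp)
  have \<gamma>'O: "\<gamma>' \<in> \<O>" by (rule principal_subset_imp) (use pow_subset_O[OF J'(4), of h] \<gamma>'(3) in simp)
  have "(\<lambda>x. real r ^ h * x) ` \<O> = (J \<odot> J') [^]\<^bsub>G\<^esub> h"
    unfolding JJ' by (rule pow_principal[OF inK[OF rO] r0, symmetric])
  also have "\<dots> = (J [^]\<^bsub>G\<^esub> h) \<odot> (J' [^]\<^bsub>G\<^esub> h)"
    using G.nat_pow_distrib[of J J' h] J(1) J'(1) by (simp add: ideal_group_simps)
  also have "\<dots> = (\<lambda>x. \<gamma> * \<gamma>' * x) ` \<O>"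
    unfolding \<gamma>(3) \<gamma>'(3) principal_iprod[OF fractional_ideal_principal[OF \<gamma>'(1,2)]] scale_scale ..
  finally have eq: "(\<lambda>x. real r ^ h * x) ` \<O> = (\<lambda>x. \<gamma> * \<gamma>' * x) ` \<O>" .
  have "\<gamma> * \<gamma>' \<in> (\<lambda>x. real r ^ h * x) ` \<O>" unfolding eq using O_1 by force
  then obtain w where w: "w \<in> \<O>" "\<gamma> * \<gamma>' = real r ^ h * w" by blast
  have "real r ^ h \<in> (\<lambda>x. \<gamma> * \<gamma>' * x) ` \<O>" unfolding eq[symmetric] using O_1 by force
  then obtain w' where w': "w' \<in> \<O>" "real r ^ h = \<gamma> * \<gamma>' * w'" by blast
  have "u ^ h \<in> (\<lambda>x. \<gamma> * x) ` \<O>" using pow_mem[OF J(3), of h] \<gamma>(3) by simp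
  then obtain x where x: "x \<in> \<O>" "u ^ h = \<gamma> * x" by blast
  have "v ^ h \<in> (\<lambda>x. \<gamma>' * x) ` \<O>" using pow_mem[OF J'(3), of h] \<gamma>'(3) by simp
  then obtain y where y: "y \<in> \<O>" "v ^ h = \<gamma>' * y" by blast
  obtain n where n: "N \<gamma> = of_int n" using \<gamma>O by (rule int_N)
  obtain n' where n': "N \<gamma>' = of_int n'" using \<gamma>'O by (rule int_N)
  obtain k where k: "N w = of_int k" using w(1) by (rule int_N)
  obtain k' where k': "N w' = of_int k'" using w'(1) by (rule int_N)
  obtain l where l: "N x = of_int l" using x(1) by (rule int_N)
  obtain l' where l': "N y = of_int l'" using y(1) by (rule int_N)
  have Nu: "N u = of_int (int r * m)" unfolding u_def N_theta_minus am(1) ..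
  have Nr: "N (real r ^ h) = of_int (int r ^ (4 * h))"
    using N_power[OF inK[OF rO], of h] N_of_int[of "int r"] by (simp add: power_mult[symmetric])
  have rm0: "int r * m \<noteq> 0" using am(2) prime_gt_0_nat[OF r(1)] by auto
  \<comment> \<open>The norms of \<open>u\<close> and of the integer \<open>u * v\<close> are known,
    so that of \<open>v\<close> is the quotient of \<open>(r * m) ^ 4\<close> by
    \<open>r * m\<close>.\<close>
  have Nv: "N v = of_int ((int r * m) ^ 3)"
  proof -
    have "N u * N v = N (of_int (- (int r * m)))"
      using N_mult[OF inK[OF uO] inK[OF vO]] uv by simp
    also have "\<dots> = of_int (int r * m) * of_int ((int r * m) ^ 3)" unfolding N_of_int by (simp add: eval_nat_numeral)
    finally show ?thesis unfolding Nu using rm0 by (simp only: mult_cancel_left of_int_eq_0_iff) blast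
  qed
  \<comment> \<open>The exponent \<open>4 * h\<close> is split into \<open>h\<close> for
    \<open>\<gamma>\<close> and \<open>3 * h\<close> for \<open>\<gamma>'\<close>, as expected for
    ideals of norm \<open>r\<close> and \<open>r ^ 3\<close>.\<close>
  have I: "n * n' = int r ^ (h + 3 * h) * k"
  proof -
    have "(of_int (n * n') :: rat) = N (\<gamma> * \<gamma>')" by (simp add: N_mult \<gamma> \<gamma>' n n')
    also have "\<dots> = of_int (int r ^ (4 * h) * k)"
      unfolding w(2) using N_mult[OF K_power[OF inK[OF rO]] inK[OF w(1)], of h] Nr k by simp
    finally have "n * n' = int r ^ (4 * h) * k" by (simp only: of_int_eq_iff)
    then show ?thesis by simp
  qed
  have II: "int r ^ (4 * h) = n * n' * k'"
  proof -
    have "(of_int (int r ^ (4 * h)) :: rat) = N (\<gamma> * \<gamma>' * w')" using Nr w'(2) by simp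
    also have "\<dots> = of_int (n * n' * k')" using N_mult[OF K_mult[OF \<gamma>(1) \<gamma>'(1)] inK[OF w'(1)]] N_mult[OF \<gamma>(1) \<gamma>'(1)]
      by (simp add: n n' k')
    finally show ?thesis by (simp only: of_int_eq_iff)
  qed
  have III: "(int r * m) ^ h = n * l"
  proof -
    have "(of_int ((int r * m) ^ h) :: rat) = N (\<gamma> * x)" using N_power[OF inK[OF uO], of h] Nu x(2) by simp
    also have "\<dots> = of_int (n * l)" using N_mult[OF \<gamma>(1) inK[OF x(1)]] by (simp add: n l)
    finally show ?thesis by (simp only: of_int_eq_iff)
  qed
  have IV: "(int r * m) ^ (3 * h) = n' * l'"
  proof -
    have "(of_int ((int r * m) ^ (3 * h)) :: rat) = N (\<gamma>' * y)" using N_power[OF inK[OF vO], of h] Nv y(2) by (simp add: power_mult)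
    also have "\<dots> = of_int (n' * l')" using N_mult[OF \<gamma>'(1) inK[OF y(1)]] by (simp add: n' l')
    finally show ?thesis by (simp only: of_int_eq_iff)
  qed
  have "\<bar>n\<bar> = int r ^ h"
  proof (rule prime_power_exact[OF pr am(2) _ _ I])
    show "n dvd (int r * m) ^ h" unfolding III by simp
    show "n' dvd (int r * m) ^ (3 * h)" unfolding IV by simp
    show "n dvd int r ^ (4 * h)" "n' dvd int r ^ (4 * h)" unfolding II by (simp_all add: mult.assoc)
  qed
  moreover have "\<not> int p dvd int r" using p r neq by (metis int_dvd_int_iff primes_dvd_imp_eq)
  ultimately show ?thesis
    using even_if_norm_prime_power[OF p8 quarter \<gamma>O n] by (simp add: h_def)
qed

end

text \<open>Finiteness accompanies parity because \<open>class_number\<close> is a cardinality: for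
  an infinite class group it would be 0 and hence even.\<close>

theorem theorem1:
  fixes p :: nat
  assumes "Factorial_Ring.prime p" and "[p = 1] (mod 8)"
  shows "finite (carrier (class_group (rat_adjoin (root 4 (real p))))) \<and>
         even (class_number (rat_adjoin (root 4 (real p))))"
proof -
  have p8: "p mod 8 = 1" using assms(2) by (simp add: unique_euclidean_semiring_class.cong_def)
  then have "odd p" by presburger
  then obtain g where "\<forall>k>0. residue_primroot (p ^ k) g"
    using residue_primroot_odd_prime_power_exists[OF assms(1)] by blast
  then have "residue_primroot p g" by (metis power_one_right zero_less_one)
  then interpret quartic_characters p g by unfold_locales (use assms(1) p8 in auto)
  obtain r where r: "Factorial_Ring.prime r" "r mod 4 = 3" "[int r ^ ((p - 1) div 4) = -1] (mod int p)"
    using ex_prime_nonquartic by blast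
  interpret quartic_field p "root 4 (real p)"
    by unfold_locales (use assms(1) in simp_all)
  interpret ideal_theory K by (rule ideal_theory_K)
  show ?thesis
    unfolding rat_adjoin_eq using finite_class_group class_number_even[OF p8 r] by blast
qed

end
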